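(* Let $F$ be a field and let $G$ be a finite subgroup of $\mathrm{PGL}_2(F)$. Let $\widetilde F$ be an extension field of $F$ such that every element of $G$ has a fixed point on $\mathbb{P}^1(\widetilde F)$. Set $$\Gamma=\{\gamma\in\mathbb{P}^1(\widetilde F) : \{\gamma\}=\mathrm{Fix}_{\mathbb{P}^1(\widetilde F)}(g)\text{ for some } g\in G\setminus\{1\}\}.$$ Then at least one of the following holds. (a) $G$ has an orbit of length $1$ or $2$ on $\mathbb{P}^1(\widetilde F)$. (b) $|G|$ is not divisible by $\operatorname{char} F$, $\Gamma=\emptyset$, and $G$ is a platonic group in its action on $\mathbb{P}^1(\widetilde F)$. (c) $|G|$ is divisible by $\operatorname{char} F$, $\Gamma$ is an orbit of $G$, there is exactly one other nonregular orbit $\Delta$ of $G$ on $\mathbb{P}^1(\widetilde F)$, and there are a finite subfield $E\subseteq F$ and an element $h\in\mathrm{PGL}_2(F)$ such that $\Gamma h=\mathbb{P}^1(E)$ and one of the following holds: (i) $h^{-1}Gh=\mathrm{PSL}_2(E)$ or $h^{-1}Gh=\mathrm{PGL}_2(E)$, and $|\Delta|=|E|(|E|-1)$; (ii) $\operatorname{char}F=3$, $F$ contains a square root of $-1$, $|E|=9$, $h^{-1}Gh=\overline{A}_5(F)\cong \mathrm{Alt}(5)$, and $|\Delta|=12$.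
   Context: $\mathbb{P}^1(F)$ is the set of $1$-dimensional subspaces of the space $F^2$ of row vectors; $[x:y]$ is the span of $(x,y)\neq(0,0)$. $\mathrm{GL}_2(F)$ acts on $\mathbb{P}^1(F)$ on the right by matrix multiplication, inducing a faithful action of $\mathrm{PGL}_2(F)=\mathrm{GL}_2(F)/Z(\mathrm{GL}_2(F))$. $\mathrm{PSL}_2(F)$ is identified with the image of $\mathrm{SL}_2(F)$ in $\mathrm{PGL}_2(F)$. For a subfield $E$ of a field $F$, $\mathrm{PGL}_2(E)$ and $\mathrm{PSL}_2(E)$ are identified with the images of $\mathrm{GL}_2(E)$ and $\mathrm{SL}_2(E)$ in $\mathrm{PGL}_2(F)$, and $\mathbb{P}^1(E)$ with the subset $\{[x:1]:x\in E\}\cup\{[1:0]\}$ of $\mathbb{P}^1(F)$; likewise for the extension $F\subseteq\widetilde F$, so $\mathrm{PGL}_2(F)$ acts on $\mathbb{P}^1(\widetilde F)$. $\mathrm{Fix}_\Omega(g)$ is the set of fixed points of $g$ on $\Omega$. An orbit is regular if point stabilizers on it are trivial, and nonregular otherwise. A group $G$ acting on a set $\Omega$ is a *platonic group in its action on $\Omega$* if the action is faithful, there are exactly three nonregular orbits, and the isomorphism type of $G$ together with the lengths of the three nonregular orbits is one of: $G\cong\mathrm{Alt}(4)$ with lengths $6,4,4$; $G\cong\mathrm{Sym}(4)$ with lengths $12,8,6$; $G\cong\mathrm{Alt}(5)$ with lengths $30,20,12$. If $\operatorname{char}F=3$ and $F$ contains a square root $i$ of $-1$, then $A_5(F)=\left\langle\begin{pmatrix}1&0\\1&1\end{pmatrix},\begin{pmatrix}1&i\\0&1\end{pmatrix}\right\rangle\le\mathrm{GL}_2(F)$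 and $\overline{A}_5(F)$ is the image of $A_5(F)$ in $\mathrm{PGL}_2(F)$. *)

theory Defs
  imports
    "HOL-Analysis.Cartesian_Space"
    "HOL-Analysis.Determinants"
    "HOL-Algebra.Sym_Groups"
    "HOL-Algebra.Algebraic_Closure_Type"
    "HOL-Library.Multiset"
begin

section \<open>Right actions\<close>

text \<open>The locale \<open>group_action\<close> of HOL-Algebra is about left actions, whereas matrices act on row vectors from the right.\<close>

locale right_action = group G for G :: "('g, 'm) monoid_scheme" (structure) +
  fixes \<Omega> :: "'x set" and act :: "'x \<Rightarrow> 'g \<Rightarrow> 'x"
  assumes act_closed: "x \<in> \<Omega> \<Longrightarrow> g \<in> carrier G \<Longrightarrow> act x g \<in> \<Omega>"
    and act_one: "x \<in> \<Omega> \<Longrightarrow> act x \<one> = x"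
    and act_mult: "x \<in> \<Omega> \<Longrightarrow> g \<in> carrier G \<Longrightarrow> h \<in> carrier G \<Longrightarrow> act x (g \<otimes> h) = act (act x g) h"

definition orbit_set :: "('g, 'm) monoid_scheme \<Rightarrow> 'x set \<Rightarrow> ('x \<Rightarrow> 'g \<Rightarrow> 'x) \<Rightarrow> 'x set set"
  where "orbit_set G \<Omega> act = (\<lambda>x. act x ` carrier G) ` \<Omega>"

definition pt_stabilizer :: "('g, 'm) monoid_scheme \<Rightarrow> ('x \<Rightarrow> 'g \<Rightarrow> 'x) \<Rightarrow> 'x \<Rightarrow> 'g set"
  where "pt_stabilizer G act x = {g \<in> carrier G. act x g = x}"

definition Fix :: "'x set \<Rightarrow> ('x \<Rightarrow> 'g \<Rightarrow> 'x) \<Rightarrow> 'g \<Rightarrow> 'x set"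
  where "Fix \<Omega> act g = {x \<in> \<Omega>. act x g = x}"

definition nonregular_orbits :: "('g, 'm) monoid_scheme \<Rightarrow> 'x set \<Rightarrow> ('x \<Rightarrow> 'g \<Rightarrow> 'x) \<Rightarrow> 'x set set"
  where "nonregular_orbits G \<Omega> act =
    {Y \<in> orbit_set G \<Omega> act. \<not> (\<forall>x\<in>Y. pt_stabilizer G act x = {\<one>\<^bsub>G\<^esub>})}"

definition faithful_on :: "('g, 'm) monoid_scheme \<Rightarrow> 'x set \<Rightarrow> ('x \<Rightarrow> 'g \<Rightarrow> 'x) \<Rightarrow> bool"
  where "faithful_on G \<Omega> act \<longleftrightarrow>
    (\<forall>g\<in>carrier G. (\<forall>x\<in>\<Omega>. act x g = x) \<longrightarrow> g = \<one>\<^bsub>G\<^esub>)"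

definition platonic :: "('g, 'm) monoid_scheme \<Rightarrow> 'x set \<Rightarrow> ('x \<Rightarrow> 'g \<Rightarrow> 'x) \<Rightarrow> bool"
  where "platonic G \<Omega> act \<longleftrightarrow>
    right_action G \<Omega> act \<and> faithful_on G \<Omega> act \<and>
    card (nonregular_orbits G \<Omega> act) = 3 \<and>
    (let lengths = image_mset card (mset_set (nonregular_orbits G \<Omega> act)) in
       G \<cong> alt_group 4 \<and> lengths = {#6, 4, 4#} \<or>
       G \<cong> sym_group 4 \<and> lengths = {#12, 8, 6#} \<or>
       G \<cong> alt_group 5 \<and> lengths = {#30, 20, 12#})"


section \<open>Linear groups of degree two\<close>

definition GL2 :: "('a::field^2^2) monoid"
  where "GL2 = \<lparr>carrier = {A. invertible A}, mult = (**), one = mat 1\<rparr>"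

definition group_center :: "('g, 'm) monoid_scheme \<Rightarrow> 'g set"
  where "group_center G = {z \<in> carrier G. \<forall>x\<in>carrier G. z \<otimes>\<^bsub>G\<^esub> x = x \<otimes>\<^bsub>G\<^esub> z}"

definition PGL2 :: "('a::field^2^2) set monoid"
  where "PGL2 = GL2 Mod group_center GL2"

definition to_PGL2 :: "'a::field^2^2 \<Rightarrow> ('a^2^2) set"
  where "to_PGL2 A = group_center GL2 #>\<^bsub>GL2\<^esub> A"

text \<open>In the following four definitions \<open>E\<close> is a subfield of \<open>'a\<close>; the
  projective groups over \<open>E\<close> are the images in \<open>PGL2\<close> over \<open>'a\<close>.\<close>

definition GL2_over :: "'a::field set \<Rightarrow> ('a^2^2) set"
  where "GL2_over E = {A. (\<forall>i j. A $ i $ j \<in> E) \<and>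
    (\<exists>B. (\<forall>i j. B $ i $ j \<in> E) \<and> A ** B = mat 1 \<and> B ** A = mat 1)}"

definition SL2_over :: "'a::field set \<Rightarrow> ('a^2^2) set"
  where "SL2_over E = {A. (\<forall>i j. A $ i $ j \<in> E) \<and> det A = 1}"

definition PGL2_over :: "'a::field set \<Rightarrow> ('a^2^2) set set"
  where "PGL2_over E = to_PGL2 ` GL2_over E"

definition PSL2_over :: "'a::field set \<Rightarrow> ('a^2^2) set set"
  where "PSL2_over E = to_PGL2 ` SL2_over E"

text \<open>Only meant for characteristic 3 and \<open>i\<^sup>2 = - 1\<close>.
  The group does not depend on the choice of the root, as replacing
  \<open>i\<close> by \<open>- i\<close> inverts the second generator.\<close>

definition A5 :: "'a::field \<Rightarrow> ('a^2^2) set"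
  where "A5 i = generate GL2
    {vector [vector [1, 0], vector [1, 1]], vector [vector [1, i], vector [0, 1]]}"

definition A5_bar :: "'a::field \<Rightarrow> ('a^2^2) set set"
  where "A5_bar i = to_PGL2 ` A5 i"


section \<open>The projective line\<close>

definition P1 :: "('b::field^2) set set"
  where "P1 = {p. vec.subspace p \<and> vec.dim p = 1}"

definition proj_pt :: "'b::field \<Rightarrow> 'b \<Rightarrow> ('b^2) set"
  where "proj_pt x y = vec.span {vector [x, y]}"

text \<open>A field extension is given by an embedding \<open>\<iota>\<close> of the field \<open>'a\<close> into the field \<open>'b\<close>.\<close>

abbreviation field_embedding :: "('a::field \<Rightarrow> 'b::field) \<Rightarrow> bool"
  where "field_embedding \<iota> \<equiv> \<iota> \<in> ring_hom ring_of_type_algebra ring_of_type_algebra"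

definition P1_over :: "('a::field \<Rightarrow> 'b::field) \<Rightarrow> 'a set \<Rightarrow> ('b^2) set set"
  where "P1_over \<iota> E = {proj_pt (\<iota> x) 1 | x. x \<in> E} \<union> {proj_pt 1 0}"

text \<open>Elements of \<open>PGL2\<close> are cosets of matrices; all matrices in a coset map a given
  point to the same point, so the union is over equal sets (see \<open>P1_act_to_PGL2\<close>).\<close>

definition P1_act :: "('a::field \<Rightarrow> 'b::field) \<Rightarrow> ('b^2) set \<Rightarrow> ('a^2^2) set \<Rightarrow> ('b^2) set"
  where "P1_act \<iota> p g = (\<Union>A\<in>g. (\<lambda>v. v v* map_matrix \<iota> A) ` p)"


section \<open>Well-definedness\<close>

lemma GL2_simps [simp]:
  "carrier GL2 = {A. invertible A}" "x \<otimes>\<^bsub>GL2\<^esub> y = x ** y" "\<one>\<^bsub>GL2\<^esub> = mat 1"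
  by (simp_all add: GL2_def)

lemma group_GL2: "group (GL2 :: ('a::field^2^2) monoid)"
proof (rule groupI)
  fix x :: "'a^2^2" assume "x \<in> carrier GL2"
  then show "\<exists>y\<in>carrier GL2. y \<otimes>\<^bsub>GL2\<^esub> x = \<one>\<^bsub>GL2\<^esub>"
    by (auto simp: invertible_def)
next
  show "\<one>\<^bsub>GL2\<^esub> \<in> carrier (GL2 :: ('a::field^2^2) monoid)"
    by (auto simp: invertible_def intro!: exI[of _ "mat 1"])
qed (auto simp: invertible_mult matrix_mul_assoc)

lemma (in group) normal_group_center: "group_center G \<lhd> G"
proof -
  have closed: "x \<in> carrier G" if "x \<in> group_center G" for x
    using that by (simp add: group_center_def)
  have comm: "x \<otimes> y = y \<otimes> x" if "x \<in> group_center G" "y \<in> carrier G" for x y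
    using that unfolding group_center_def by blast
  have centerI: "x \<in> group_center G"
    if "x \<in> carrier G" "\<And>y. y \<in> carrier G \<Longrightarrow> x \<otimes> y = y \<otimes> x" for x
    using that unfolding group_center_def by blast
  have "subgroup (group_center G) G"
  proof
    show "group_center G \<subseteq> carrier G" using closed by blast
    show "\<one> \<in> group_center G" by (rule centerI) simp_all
  next
    fix x assume x: "x \<in> group_center G"
    show "inv x \<in> group_center G"
    proof (rule centerI)
      fix y assume y: "y \<in> carrier G"
      have "inv (x \<otimes> inv y) = inv (inv y \<otimes> x)"
        using comm[OF x, of "inv y"] y by simp
      then show "inv x \<otimes> y = y \<otimes> inv x"
        using closed[OF x] y by (simp add: inv_mult_group)
    qed (use closed[OF x] in simp)
  next
    fix x y assume x: "x \<in> group_center G" and y: "y \<in> group_center G"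
    show "x \<otimes> y \<in> group_center G"
    proof (rule centerI)
      fix z assume z: "z \<in> carrier G"
      have "x \<otimes> y \<otimes> z = x \<otimes> (z \<otimes> y)"
        using closed[OF x] closed[OF y] z by (simp only: m_assoc comm[OF y z])
      also have "\<dots> = x \<otimes> z \<otimes> y"
        using closed[OF x] closed[OF y] z by (simp only: m_assoc)
      also have "\<dots> = z \<otimes> (x \<otimes> y)"
        using closed[OF x] closed[OF y] z by (simp only: m_assoc comm[OF x z])
      finally show "x \<otimes> y \<otimes> z = z \<otimes> (x \<otimes> y)" .
    qed (use closed[OF x] closed[OF y] in simp)
  qed
  then show ?thesis
    unfolding normal_inv_iff
  proof (intro conjI ballI)
    fix x h assume x: "x \<in> carrier G" and h: "h \<in> group_center G"
    have "x \<otimes> h \<otimes> inv x = h"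
      using closed[OF h] x by (simp only: comm[OF h x, symmetric]) (simp add: m_assoc)
    then show "x \<otimes> h \<otimes> inv x \<in> group_center G" using h by simp
  qed
qed

lemma group_PGL2: "group PGL2"
  unfolding PGL2_def by (intro normal.factorgroup_is_group group.normal_group_center group_GL2)

lemma group_center_GL2:
  "group_center (GL2 :: ('a::field^2^2) monoid) = {mat c | c. c \<noteq> 0}"
proof (intro equalityI subsetI)
  fix z :: "'a^2^2" assume z: "z \<in> group_center GL2"
  define U :: "'a^2^2" where "U = vector [vector [1, 1], vector [0, 1]]"
  define L :: "'a^2^2" where "L = vector [vector [1, 0], vector [1, 1]]"
  have inv: "invertible U" "invertible L"
    by (simp_all add: invertible_det_nz U_def L_def det_2)
  with z have "z ** U = U ** z" "z ** L = L ** z" and iz: "invertible z"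
    by (auto simp: group_center_def)
  then have eq: "z $ 1 $ 2 = 0" "z $ 2 $ 1 = 0" "z $ 1 $ 1 = z $ 2 $ 2"
    by (auto simp: vec_eq_iff matrix_matrix_mult_def U_def L_def sum_2 forall_2)
  then have "z = mat (z $ 1 $ 1)" by (simp add: vec_eq_iff mat_def forall_2)
  moreover have "z $ 1 $ 1 \<noteq> 0" using iz eq by (auto simp: invertible_det_nz det_2)
  ultimately show "z \<in> {mat c | c. c \<noteq> 0}" by blast
next
  fix z :: "'a^2^2" assume "z \<in> {mat c | c. c \<noteq> 0}"
  then show "z \<in> group_center GL2"
    by (auto simp: group_center_def invertible_det_nz det_2 mat_def vec_eq_iff
        matrix_matrix_mult_def sum_2 forall_2)
qed

lemma carrier_PGL2: "carrier PGL2 = to_PGL2 ` {A. invertible A}"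
  by (auto simp: PGL2_def FactGroup_def RCOSETS_def to_PGL2_def)

lemma to_PGL2_mult:
  assumes "invertible A" "invertible B"
  shows "to_PGL2 (A ** B) = to_PGL2 A \<otimes>\<^bsub>PGL2\<^esub> to_PGL2 B"
  using normal.rcos_sum[OF group.normal_group_center[OF group_GL2], of A B] assms
  by (simp add: to_PGL2_def PGL2_def FactGroup_def)

lemma to_PGL2_one: "to_PGL2 (mat 1) = \<one>\<^bsub>PGL2\<^esub>"
  by (auto simp: to_PGL2_def PGL2_def FactGroup_def r_coset_def)

context
  fixes \<iota> :: "'a::field \<Rightarrow> 'b::field"
  assumes emb: "field_embedding \<iota>"
begin

lemma embedding_simps:
  "\<iota> (x + y) = \<iota> x + \<iota> y" "\<iota> (x * y) = \<iota> x * \<iota> y" "\<iota> 1 = 1" "\<iota> 0 = 0" "\<iota> x = 0 \<longleftrightarrow> x = 0"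
proof -
  show add: "\<iota> (x + y) = \<iota> x + \<iota> y" for x y
    using emb by (auto simp: ring_hom_def ring_of_type_algebra_def)
  show mult: "\<iota> (x * y) = \<iota> x * \<iota> y" for x y
    using emb by (auto simp: ring_hom_def ring_of_type_algebra_def)
  show one: "\<iota> 1 = 1"
    using emb by (auto simp: ring_hom_def ring_of_type_algebra_def)
  show zero: "\<iota> 0 = 0" using add[of 0 0] by (metis add_0 add_cancel_right_right)
  have "x = 0" if "\<iota> x = 0" for x
    using mult[of x "inverse x"] one that by (cases "x = 0") auto
  with zero show "\<iota> x = 0 \<longleftrightarrow> x = 0" by blast
qed

lemma map_matrix_mult: "map_matrix \<iota> (A ** B) = map_matrix \<iota> A ** map_matrix \<iota> (B :: 'a^2^2)"
  by (simp add: vec_eq_iff map_matrix_def matrix_matrix_mult_def sum_2 embedding_simps)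

lemma map_matrix_mat: "map_matrix \<iota> (mat c :: 'a^2^2) = mat (\<iota> c)"
  by (auto simp: vec_eq_iff map_matrix_def mat_def embedding_simps)

lemma P1_act_to_PGL2:
  assumes p: "p \<in> P1"
  shows "P1_act \<iota> p (to_PGL2 A) = (\<lambda>v. v v* map_matrix \<iota> A) ` p"
proof -
  have sub: "c *s v \<in> p" if "v \<in> p" for c v
    using p that by (auto simp: P1_def vec.subspace_def)
  have scale: "v v* map_matrix \<iota> (mat c ** A) = (\<iota> c *s v) v* map_matrix \<iota> A" for v c
    by (simp add: map_matrix_mult map_matrix_mat vec_eq_iff vector_matrix_mult_def
        matrix_matrix_mult_def mat_def sum_2 forall_2 embedding_simps algebra_simps)
  have one: "v v* map_matrix \<iota> A \<in> P1_act \<iota> p (to_PGL2 A)" if "v \<in> p" for v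
  proof -
    have "A \<in> to_PGL2 A"
      unfolding to_PGL2_def r_coset_def group_center_GL2
      by (intro UN_I[of "mat 1"]) (use zero_neq_one[where 'a='a] in auto)
    then show ?thesis using that by (auto simp: P1_act_def)
  qed
  show ?thesis
    using one sub
    by (auto simp: P1_act_def to_PGL2_def r_coset_def group_center_GL2 scale)
qed

lemma P1_image:
  assumes p: "p \<in> P1" and A: "invertible A"
  shows "(\<lambda>v. v v* map_matrix \<iota> A) ` p \<in> P1"
proof -
  let ?f = "\<lambda>v. v v* map_matrix \<iota> A"
  from A obtain B where B: "A ** B = mat 1" by (auto simp: invertible_def)
  have "?f v v* map_matrix \<iota> B = v" for v
    by (simp add: vector_matrix_mul_assoc flip: map_matrix_mult)
       (simp add: B map_matrix_mat embedding_simps)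
  then have inj: "inj ?f" by (metis injI)
  have lin: "Vector_Spaces.linear (*s) (*s) ?f"
    by unfold_locales (simp_all add: vec_eq_iff vector_matrix_mult_def sum_2 algebra_simps)
  have "vec.dim (?f ` p) = vec.dim p"
    by (rule vec.dim_image_eq[OF lin]) (use inj in \<open>auto intro: inj_on_subset\<close>)
  then show ?thesis
    using p vec.subspace_image[of p "transpose (map_matrix \<iota> A)"]
    by (auto simp: P1_def)
qed

lemma right_action_PGL2: "right_action PGL2 P1 (P1_act \<iota>)"
proof (intro right_action.intro right_action_axioms.intro group_PGL2)
  fix p :: "('b^2) set" and g assume "p \<in> P1" "g \<in> carrier (PGL2 :: ('a^2^2) set monoid)"
  then show "P1_act \<iota> p g \<in> P1"
    by (auto simp: carrier_PGL2 P1_act_to_PGL2 P1_image)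
next
  fix p :: "('b^2) set" assume "p \<in> P1"
  then show "P1_act \<iota> p \<one>\<^bsub>PGL2\<^esub> = p"
    by (simp add: P1_act_to_PGL2 map_matrix_mat embedding_simps flip: to_PGL2_one)
next
  fix p :: "('b^2) set" and g h
  assume "p \<in> P1" "g \<in> carrier (PGL2 :: ('a^2^2) set monoid)" "h \<in> carrier (PGL2 :: ('a^2^2) set monoid)"
  then show "P1_act \<iota> p (g \<otimes>\<^bsub>PGL2\<^esub> h) = P1_act \<iota> (P1_act \<iota> p g) h"
    by (auto simp: carrier_PGL2 P1_act_to_PGL2 P1_image map_matrix_mult image_image
        vector_matrix_mul_assoc simp flip: to_PGL2_mult)
qed

end

end

theory Submission
  imports Defs "HOL-Algebra.Sylow"
begin

text \<open>
  An element of \<open>G\<close> other than 1 fixes one or two points, and those fixing only \<open>x\<close> form, together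
  with 1, an abelian group \<open>U x\<close> whose nontrivial elements have order \<open>char F\<close>. Counting pairs of a
  nontrivial element and a fixed point gives \<open>\<Sum> (|G| - |Y|) = \<Sum> |Fix g|\<close>, summed over the nonregular
  orbits \<open>Y\<close> and over \<open>g \<noteq> 1\<close>.

  If all \<open>U x\<close> are trivial, this is Klein's equation, and the action on a small set (four points,
  four fixed point pairs, or five Klein four-groups) identifies \<open>G\<close>.

  Otherwise the points with nontrivial \<open>U x\<close> form one orbit \<open>\<Gamma>\<close> of length \<open>1 + m q\<close> with \<open>q = |U x|\<close>.
  The stabilizer of \<open>x\<close> has order \<open>q d\<close> with \<open>d\<close> dividing \<open>q - 1\<close>, as its orbits on \<open>U x - {1}\<close> have
  length \<open>d\<close>. The equation then leaves \<open>m = 1\<close> with \<open>d \<in> {q - 1, (q - 1) / 2}\<close>, or \<open>m = q = 3\<close> with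
  \<open>d = 2\<close>. With \<open>0, 1, \<infinity>\<close> in \<open>\<Gamma>\<close>, the translations in \<open>G\<close> are those by a subfield if \<open>m = 1\<close>, and \<open>G\<close> is
  determined by its stabilizer of \<open>\<infinity>\<close>. If \<open>m = 3\<close>, the group contains a map \<open>x \<mapsto> c / x\<close> whose fixed
  points lie in \<open>\<Gamma>\<close>, and this forces \<open>c\<^sup>2 = - 1\<close>.
\<close>

section \<open>Finite group actions\<close>

text \<open>Three obstacles shape the argument. The conjugating element must lie in PGL_2(F)
  although the action is on the line over the extension, so the points of \<Gamma> have to be
  rational over F. This is immediate except in characteristic two, where a fixed point may be
  inseparable over F; there the orbit count itself excludes it. Next, the actions on fixed point
  pairs and on Klein four-groups must be faithful. The last candidates for a kernel have order two
  or three, and they fail because a normal subgroup of prime order would have an invariant set of at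
  most two fixed points, hence a short orbit. Finally, the translations are at the outset only an
  additive group. They become a subfield because the multipliers of this group contain 0 and the d
  dilation factors, thus more than half of its q elements.\<close>

lemma (in group) inv_inv_mult:
  assumes "x \<in> carrier G" "y \<in> carrier G"
  shows "inv x \<otimes> (x \<otimes> y) = y" "x \<otimes> (inv x \<otimes> y) = y"
  using assms by (simp_all flip: m_assoc)

text \<open>The inverse stands on the left so that conjugation is a right action, in agreement with
  \<open>act\<close> and with the conjugate group in the conclusion.\<close>

definition (in group) conjg :: "'a \<Rightarrow> 'a \<Rightarrow> 'a"
  where "conjg x g = inv g \<otimes> x \<otimes> g"

lemma (in group) conjg_closed [simp]:
  "x \<in> carrier G \<Longrightarrow> g \<in> carrier G \<Longrightarrow> conjg x g \<in> carrier G"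
  by (simp add: conjg_def)

lemma (in group) conjg_one_left [simp]: "g \<in> carrier G \<Longrightarrow> conjg \<one> g = \<one>"
  by (simp add: conjg_def)

lemma (in group) conjg_one_right [simp]: "x \<in> carrier G \<Longrightarrow> conjg x \<one> = x"
  by (simp add: conjg_def)

lemma (in group) conjg_mult_left:
  "x \<in> carrier G \<Longrightarrow> y \<in> carrier G \<Longrightarrow> g \<in> carrier G \<Longrightarrow> conjg (x \<otimes> y) g = conjg x g \<otimes> conjg y g"
  by (simp add: conjg_def m_assoc inv_inv_mult)

lemma (in group) conjg_mult_right:
  "x \<in> carrier G \<Longrightarrow> g \<in> carrier G \<Longrightarrow> h \<in> carrier G \<Longrightarrow> conjg x (g \<otimes> h) = conjg (conjg x g) h"
  by (simp add: conjg_def m_assoc inv_mult_group)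

lemma (in group) conjg_inv [simp]:
  assumes "x \<in> carrier G" "g \<in> carrier G"
  shows "conjg (conjg x g) (inv g) = x" "conjg (conjg x (inv g)) g = x"
  using assms by (simp_all flip: conjg_mult_right)

lemma (in group) conjg_eq_one_iff [simp]:
  "x \<in> carrier G \<Longrightarrow> g \<in> carrier G \<Longrightarrow> conjg x g = \<one> \<longleftrightarrow> x = \<one>"
  by (metis conjg_inv(1) conjg_one_left inv_closed)

lemma (in group) conjg_eq_self_iff:
  assumes "x \<in> carrier G" "g \<in> carrier G"
  shows "conjg x g = x \<longleftrightarrow> x \<otimes> g = g \<otimes> x"
proof
  assume "conjg x g = x"
  then have "g \<otimes> (inv g \<otimes> x \<otimes> g) = g \<otimes> x" by (simp add: conjg_def)
  then show "x \<otimes> g = g \<otimes> x" using assms by (simp add: m_assoc inv_inv_mult)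
next
  assume "x \<otimes> g = g \<otimes> x"
  then show "conjg x g = x" using assms by (simp add: conjg_def m_assoc inv_inv_mult)
qed

lemma (in group) inj_on_conjg: "g \<in> carrier G \<Longrightarrow> inj_on (\<lambda>x. conjg x g) (carrier G)"
  by (rule inj_on_inverseI[where g = "\<lambda>x. conjg x (inv g)"]) simp

lemma (in group) conjg_action: "right_action G (carrier G) conjg"
  by unfold_locales (simp_all add: conjg_mult_right)

text \<open>Used for the permutation action on a family of subgroups, namely the Klein four-groups
  in a group of order 60.\<close>

lemma (in group) conjg_set_action:
  assumes "\<And>V g. V \<in> S \<Longrightarrow> g \<in> carrier G \<Longrightarrow> (\<lambda>x. conjg x g) ` V \<in> S" "\<And>V. V \<in> S \<Longrightarrow> V \<subseteq> carrier G"
  shows "right_action G S (\<lambda>V g. (\<lambda>x. conjg x g) ` V)"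
proof (unfold_locales, goal_cases)
  case (2 V) then show ?case using assms(2)[of V] by (force simp: image_iff)
next
  case (3 V g h)
  then show ?case using assms(2)[of V] by (force simp: image_image conjg_mult_right intro!: image_cong)
qed (use assms(1) in auto)

section \<open>Orders of subgroups and of their elements\<close>

lemma (in group) subgroup_card_dvd:
  assumes "subgroup H G" "subgroup K G" "H \<subseteq> K"
  shows "card H dvd card K"
proof -
  have "group (G\<lparr>carrier := K\<rparr>)" "subgroup H (G\<lparr>carrier := K\<rparr>)"
    using assms by (auto simp: subgroup_imp_group subgroup_incl)
  from group.lagrange[OF this] show ?thesis by (simp add: Coset.order_def) (metis dvd_triv_right)
qed

lemma (in group) subgroup_card_dvd_order: "subgroup H G \<Longrightarrow> card H dvd card (carrier G)"
  by (rule subgroup_card_dvd[OF _ subgroup_self]) (auto dest: subgroup.subset)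

lemma (in group) subgroup_pow_card:
  assumes H: "subgroup H G" and fin: "finite H" and x: "x \<in> H"
  shows "x [^] card H = \<one>"
proof -
  interpret H: group "G\<lparr>carrier := H\<rparr>" using H by (rule subgroup_imp_group)
  have "x [^]\<^bsub>G\<lparr>carrier := H\<rparr>\<^esub> Coset.order (G\<lparr>carrier := H\<rparr>) = \<one>\<^bsub>G\<lparr>carrier := H\<rparr>\<^esub>"
    by (intro H.pow_order_eq_1) (use fin x in auto)
  then show ?thesis by (simp add: Coset.order_def nat_pow_consistent[symmetric])
qed

text \<open>Sylow's theorem with exponent 1 yields a subgroup of order \<open>p\<close>, and any of
  its nontrivial elements serves.\<close>

lemma (in group) cauchy:
  assumes "finite (carrier G)" "prime p" "p dvd card (carrier G)"
  obtains g where "g \<in> carrier G" "g \<noteq> \<one>" "g [^] p = \<one>"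
proof -
  obtain m where "Coset.order G = p ^ 1 * m" using assms by (auto simp: Coset.order_def)
  with sylow_thm[OF assms(2) is_group this] assms obtain H where H: "subgroup H G" "card H = p" by auto
  have "\<exists>g\<in>H. g \<noteq> \<one>"
  proof (rule ccontr)
    assume "\<not> (\<exists>g\<in>H. g \<noteq> \<one>)"
    then have "H \<subseteq> {\<one>}" by blast
    then have "card H \<le> card {\<one>}" by (intro card_mono) auto
    with H(2) prime_gt_1_nat[OF assms(2)] show False by simp
  qed
  then obtain g where g: "g \<in> H" "g \<noteq> \<one>" by blast
  have "finite H" using H(2) prime_gt_0_nat[OF assms(2)] card_gt_0_iff by metis
  then have "g [^] p = \<one>" using subgroup_pow_card[OF H(1) _ g(1)] H(2) by simp
  then show ?thesis using that g H(1) subgroup.mem_carrier by metis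
qed

section \<open>Orbits, stabilizers and fixed points\<close>

context right_action
begin

abbreviation "orb x \<equiv> act x ` carrier G"
abbreviation "stab x \<equiv> pt_stabilizer G act x"

lemma act_inv_cancel [simp]:
  assumes "x \<in> \<Omega>" "g \<in> carrier G"
  shows "act (act x g) (inv g) = x" "act (act x (inv g)) g = x"
  using assms by (simp_all flip: act_mult add: act_one)

lemma act_inj: "g \<in> carrier G \<Longrightarrow> inj_on (\<lambda>x. act x g) \<Omega>"
  by (rule inj_on_inverseI[where g = "\<lambda>x. act x (inv g)"]) simp

lemma act_eq_iff:
  assumes "x \<in> \<Omega>" "y \<in> \<Omega>" "g \<in> carrier G"
  shows "act x g = act y g \<longleftrightarrow> x = y"
  using act_inj[OF assms(3)] assms by (auto dest: inj_onD)

lemma stab_iff: "g \<in> stab x \<longleftrightarrow> g \<in> carrier G \<and> act x g = x"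
  by (simp add: pt_stabilizer_def)

lemma stab_subgroup: "x \<in> \<Omega> \<Longrightarrow> subgroup (stab x) G"
proof
  fix g assume "x \<in> \<Omega>" "g \<in> stab x"
  then show "inv g \<in> stab x" using act_inv_cancel(1)[of x g] by (simp add: stab_iff)
qed (auto simp: stab_iff act_mult act_one)

lemma stab_subset: "stab x \<subseteq> carrier G"
  by (auto simp: stab_iff)

lemma one_in_stab: "x \<in> \<Omega> \<Longrightarrow> \<one> \<in> stab x"
  by (auto simp: stab_iff act_one)

lemma orb_self: "x \<in> \<Omega> \<Longrightarrow> x \<in> orb x"
  by (metis act_one image_eqI one_closed)

lemma orb_subset: "x \<in> \<Omega> \<Longrightarrow> orb x \<subseteq> \<Omega>"
  by (auto simp: act_closed)

lemma orb_eq: assumes "x \<in> \<Omega>" "y \<in> orb x" shows "orb y = orb x"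
proof -
  obtain g where g: "g \<in> carrier G" "y = act x g" using assms(2) by blast
  have "act x h \<in> orb y" if h: "h \<in> carrier G" for h
  proof (rule image_eqI)
    show "act x h = act y (inv g \<otimes> h)" using g h assms(1) by (simp add: act_mult act_closed)
  qed (use g h in simp)
  moreover have "act y h \<in> orb x" if h: "h \<in> carrier G" for h
  proof (rule image_eqI)
    show "act y h = act x (g \<otimes> h)" using g h assms(1) by (simp add: act_mult)
  qed (use g h in simp)
  ultimately show ?thesis by blast
qed

lemma orbit_set_disjoint:
  assumes "Y \<in> orbit_set G \<Omega> act" "Z \<in> orbit_set G \<Omega> act" "x \<in> Y" "x \<in> Z"
  shows "Y = Z"
  using assms orb_eq[of _ x] unfolding orbit_set_def by blast

lemma orbit_set_eq_orb: "Y \<in> orbit_set G \<Omega> act \<Longrightarrow> x \<in> Y \<Longrightarrow> Y = orb x \<and> x \<in> \<Omega>"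
  using orb_eq[of _ x] orb_subset unfolding orbit_set_def by blast

lemma orb_in_orbit_set: "x \<in> \<Omega> \<Longrightarrow> orb x \<in> orbit_set G \<Omega> act"
  unfolding orbit_set_def by blast

lemma orbit_stabilizer:
  assumes fin: "finite (carrier G)" and x: "x \<in> \<Omega>"
  shows "card (orb x) * card (stab x) = card (carrier G)"
proof -
  \<comment> \<open>The fibres of \<open>g \<mapsto> act x g\<close> over the orbit are the right
    cosets of the stabilizer.\<close>
  have fib: "card {g \<in> carrier G. act x g = y} = card (stab x)" if y: "y \<in> orb x" for y
  proof -
    obtain h where h: "h \<in> carrier G" "y = act x h" using y by blast
    have "bij_betw (\<lambda>s. s \<otimes> h) (stab x) {g \<in> carrier G. act x g = y}"
    proof (rule bij_betw_byWitness[where f' = "\<lambda>g. g \<otimes> inv h"])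
      show "\<forall>s\<in>stab x. s \<otimes> h \<otimes> inv h = s" "\<forall>g\<in>{g \<in> carrier G. act x g = y}. g \<otimes> inv h \<otimes> h = g"
        using h(1) by (simp_all add: stab_iff m_assoc)
      have "act x (g \<otimes> inv h) = x" if "g \<in> carrier G" "act x g = y" for g
        using act_mult[OF x that(1) inv_closed[OF h(1)]] that(2) h x by simp
      then show "(\<lambda>g. g \<otimes> inv h) ` {g \<in> carrier G. act x g = y} \<subseteq> stab x"
        using h(1) by (auto simp: stab_iff)
      have "act x (s \<otimes> h) = y" if "s \<in> stab x" for s
        using act_mult[OF x _ h(1), of s] that h(2) by (simp add: stab_iff)
      then show "(\<lambda>s. s \<otimes> h) ` stab x \<subseteq> {g \<in> carrier G. act x g = y}"
        using h(1) by (auto simp: stab_iff)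
    qed
    then show ?thesis by (simp add: bij_betw_same_card)
  qed
  have "card (carrier G) = (\<Sum>y\<in>orb x. card {g \<in> carrier G. act x g = y})"
    using sum.image_gen[OF fin, of "\<lambda>_. 1" "act x"] by (simp only: card_eq_sum)
  also have "\<dots> = card (orb x) * card (stab x)" using fib by simp
  finally show ?thesis by simp
qed

lemma stab_act:
  assumes "x \<in> \<Omega>" "g \<in> carrier G"
  shows "stab (act x g) = (\<lambda>s. conjg s g) ` stab x"
proof (intro equalityI subsetI)
  fix s assume s: "s \<in> stab (act x g)"
  have "act (act x g) (inv g) = x" using assms by simp
  then have "conjg s (inv g) \<in> stab x"
    using s assms by (simp add: conjg_def stab_iff act_mult act_closed)
  then show "s \<in> (\<lambda>s. conjg s g) ` stab x"
    using s assms by (intro image_eqI[of _ _ "conjg s (inv g)"]) (auto simp: stab_iff)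
next
  fix s assume "s \<in> (\<lambda>s. conjg s g) ` stab x"
  then show "s \<in> stab (act x g)"
    using assms by (auto simp: stab_iff conjg_def act_mult act_closed)
qed

lemma card_stab_act:
  assumes "x \<in> \<Omega>" "g \<in> carrier G" shows "card (stab (act x g)) = card (stab x)"
  unfolding stab_act[OF assms]
  by (rule card_image, rule inj_on_subset[OF inj_on_conjg[OF assms(2)] stab_subset])

lemma Fix_conjg:
  assumes "s \<in> carrier G" "g \<in> carrier G"
  shows "Fix \<Omega> act (conjg s g) = (\<lambda>x. act x g) ` Fix \<Omega> act s"
proof (intro equalityI subsetI)
  fix x assume x: "x \<in> Fix \<Omega> act (conjg s g)"
  then have x\<Omega>: "x \<in> \<Omega>" and "act x (conjg s g) = x" by (simp_all add: Fix_def)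
  then have "act (act (act x (inv g)) s) g = x"
    using assms by (simp add: conjg_def act_mult act_closed)
  with x\<Omega> have "act (act x (inv g)) s = act x (inv g)"
    using assms act_inv_cancel(1)[of "act (act x (inv g)) s" g] by (simp add: act_closed)
  then have "act x (inv g) \<in> Fix \<Omega> act s"
    using x assms by (simp add: Fix_def act_closed)
  then show "x \<in> (\<lambda>x. act x g) ` Fix \<Omega> act s"
    using x assms by (intro image_eqI[of _ _ "act x (inv g)"]) (auto simp: Fix_def)
next
  fix x assume "x \<in> (\<lambda>x. act x g) ` Fix \<Omega> act s"
  then show "x \<in> Fix \<Omega> act (conjg s g)"
    using assms by (auto simp: Fix_def conjg_def act_mult act_closed)
qed

lemma orbit_set_subset: "Y \<in> orbit_set G \<Omega> act \<Longrightarrow> Y \<subseteq> \<Omega>"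
  unfolding orbit_set_def by (auto simp: act_closed)

lemma Union_orbit_set: "\<Union> (orbit_set G \<Omega> act) = \<Omega>"
proof
  show "\<Omega> \<subseteq> \<Union> (orbit_set G \<Omega> act)"
  proof
    fix x assume "x \<in> \<Omega>"
    then show "x \<in> \<Union> (orbit_set G \<Omega> act)"
      by (intro UnionI[OF orb_in_orbit_set orb_self])
  qed
qed (simp add: Union_least orbit_set_subset)

lemma card_eq_sum_orbits:
  assumes fin: "finite \<Omega>"
  shows "card \<Omega> = (\<Sum>Y\<in>orbit_set G \<Omega> act. card Y)"
proof -
  have "card (\<Union> (orbit_set G \<Omega> act)) = (\<Sum>Y\<in>orbit_set G \<Omega> act. card Y)"
  proof (rule card_Union_disjoint)
    show "pairwise disjnt (orbit_set G \<Omega> act)"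
    proof (intro pairwiseI)
      fix Y Z assume "Y \<in> orbit_set G \<Omega> act" "Z \<in> orbit_set G \<Omega> act" "Y \<noteq> Z"
      then show "disjnt Y Z" using orbit_set_disjoint[of Y Z] unfolding disjnt_def by blast
    qed
    show "finite A" if "A \<in> orbit_set G \<Omega> act" for A
      using orbit_set_subset[OF that] fin by (rule finite_subset)
  qed
  then show ?thesis by (simp only: Union_orbit_set)
qed

text \<open>Every orbit has |G| / r points. This serves free actions with r = 1, and conjugation on
  the unipotent elements at x with r = |U x|.\<close>

lemma card_dvd_of_equal_stabs:
  assumes fin: "finite \<Omega>" "finite (carrier G)" and r: "\<And>x. x \<in> \<Omega> \<Longrightarrow> card (stab x) = r"
  shows "card (carrier G) dvd card \<Omega> * r"
proof -
  have "card (carrier G) = card Y * r" if Y: "Y \<in> orbit_set G \<Omega> act" for Y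
  proof -
    obtain x where "x \<in> \<Omega>" "Y = orb x" using Y unfolding orbit_set_def by blast
    then show ?thesis using orbit_stabilizer[OF fin(2), of x] r by simp
  qed
  then show ?thesis
    unfolding card_eq_sum_orbits[OF fin(1)] sum_distrib_right by (intro dvd_sum) simp
qed

lemma restrict_group: "subgroup H G \<Longrightarrow> right_action (G\<lparr>carrier := H\<rparr>) \<Omega> act"
  by (auto intro!: right_action.intro subgroup_imp_group right_action_axioms.intro
      simp: act_closed act_mult act_one subgroup.mem_carrier)

lemma restrict_set:
  assumes "S \<subseteq> \<Omega>" "\<And>x g. x \<in> S \<Longrightarrow> g \<in> carrier G \<Longrightarrow> act x g \<in> S"
  shows "right_action G S act"
  using assms by unfold_locales (auto simp: act_mult act_one subsetD)

lemma double_count: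
  assumes "finite A" "finite S" "A \<subseteq> carrier G" "S \<subseteq> \<Omega>"
  shows "(\<Sum>g\<in>A. card (Fix \<Omega> act g \<inter> S)) = (\<Sum>x\<in>S. card (stab x \<inter> A))"
proof -
  have "card (Fix \<Omega> act g \<inter> S) = (\<Sum>x\<in>S. if act x g = x then 1 else 0)" for g
  proof -
    have "Fix \<Omega> act g \<inter> S = {x \<in> S. act x g = x}" using assms(4) by (auto simp: Fix_def)
    then show ?thesis using sum.inter_filter[OF assms(2), of "\<lambda>_. 1 :: nat" "\<lambda>x. act x g = x"] by simp
  qed
  moreover have "card (stab x \<inter> A) = (\<Sum>g\<in>A. if act x g = x then 1 else 0)" for x
  proof -
    have "stab x \<inter> A = {g \<in> A. act x g = x}" using assms(3) by (auto simp: stab_iff)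
    then show ?thesis using sum.inter_filter[OF assms(1), of "\<lambda>_. 1 :: nat" "\<lambda>g. act x g = x"] by simp
  qed
  ultimately show ?thesis using sum.swap[of "\<lambda>g x. if act x g = x then 1 else 0" S A] by simp
qed

section \<open>Permutation representations\<close>

lemma exists_perm_hom:
  assumes fin: "finite \<Omega>" and faith: "faithful_on G \<Omega> act"
  obtains \<psi> where "\<psi> \<in> hom G (sym_group (card \<Omega>))" "inj_on \<psi> (carrier G)"
proof -
  let ?I = "{1..card \<Omega>}"
  obtain f where f: "bij_betw f ?I \<Omega>"
    using fin by (metis ex_bij_betw_nat_finite_1)
  define f' where "f' = inv_into ?I f"
  have f'f: "f' (f i) = i" if "i \<in> ?I" for i
    using f that by (simp add: f'_def bij_betw_inv_into_left)
  have ff': "f (f' x) = x" "f' x \<in> ?I" if "x \<in> \<Omega>" for x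
    using f that bij_betw_inv_into_right[OF f] inv_into_into[of x f ?I]
    unfolding f'_def by (auto simp del: atLeastAtMost_iff simp: bij_betw_def)
  have fI: "f i \<in> \<Omega>" if "i \<in> ?I" for i using f that by (auto simp: bij_betw_def)
  \<comment> \<open>Composition of permutations is a left action, so the inverse of \<open>g\<close>
    turns the right action into a homomorphism. Outside the index set \<open>permutes\<close>
    demands the identity.\<close>
  define \<psi> where "\<psi> g i = (if i \<in> ?I then f' (act (f i) (inv g)) else i)" for g i
  have \<psi>I: "\<psi> g i \<in> ?I" if "g \<in> carrier G" "i \<in> ?I" for g i
    using that ff' fI unfolding \<psi>_def by (simp del: atLeastAtMost_iff add: act_closed)
  have mult: "\<psi> (g \<otimes> h) = \<psi> g \<circ> \<psi> h" if gh: "g \<in> carrier G" "h \<in> carrier G" for g h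
  proof
    fix i show "\<psi> (g \<otimes> h) i = (\<psi> g \<circ> \<psi> h) i"
    proof (cases "i \<in> ?I")
      case True
      have "f' (act (f i) (inv h)) \<in> ?I" using \<psi>I[OF gh(2) True] True unfolding \<psi>_def by simp
      then show ?thesis
        using True gh fI[OF True] ff'(1)[of "act (f i) (inv h)"]
        by (simp del: atLeastAtMost_iff add: \<psi>_def inv_mult_group act_mult act_closed)
    qed (simp del: atLeastAtMost_iff add: \<psi>_def)
  qed
  have one: "\<psi> \<one> = id"
    using f'f fI by (auto simp del: atLeastAtMost_iff simp: \<psi>_def act_one fun_eq_iff)
  have perm: "\<psi> g permutes ?I" if "g \<in> carrier G" for g
  proof (rule bij_imp_permutes)
    show "bij_betw (\<psi> g) ?I ?I"
    proof (rule bij_betw_byWitness[where f' = "\<psi> (inv g)"])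
      have "\<psi> g \<circ> \<psi> (inv g) = id" "\<psi> (inv g) \<circ> \<psi> g = id"
        using that by (simp_all flip: mult add: one)
      then show "\<forall>i\<in>?I. \<psi> (inv g) (\<psi> g i) = i" "\<forall>i\<in>?I. \<psi> g (\<psi> (inv g) i) = i"
        by (simp_all add: fun_eq_iff)
      show "\<psi> g ` ?I \<subseteq> ?I" "\<psi> (inv g) ` ?I \<subseteq> ?I" using \<psi>I that by blast+
    qed
    show "\<psi> g i = i" if "i \<notin> ?I" for i using that by (simp del: atLeastAtMost_iff add: \<psi>_def)
  qed
  have hom: "\<psi> \<in> hom G (sym_group (card \<Omega>))"
    using perm mult by (auto simp: hom_def sym_group_def)
  interpret h: group_hom G "sym_group (card \<Omega>)" \<psi>
    by (rule group_hom.intro) (use hom sym_group_is_group in \<open>auto simp: group_hom_axioms_def\<close>)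
  have "inj_on \<psi> (carrier G)"
  proof (rule h.trivial_ker_imp_inj, intro equalityI subsetI)
    fix g assume "g \<in> kernel G (sym_group (card \<Omega>)) \<psi>"
    then have g: "g \<in> carrier G" "\<psi> g = \<one>\<^bsub>sym_group (card \<Omega>)\<^esub>" by (simp_all add: kernel_def)
    have "act x (inv g) = x" if x: "x \<in> \<Omega>" for x
    proof -
      have "\<psi> g (f' x) = f' x" using g(2) by (simp add: sym_group_def)
      then have "f' (act x (inv g)) = f' x" using ff'[OF x] by (simp del: atLeastAtMost_iff add: \<psi>_def)
      then have "f (f' (act x (inv g))) = f (f' x)" by simp
      then show ?thesis using g(1) x by (simp only: ff'(1) act_closed inv_closed)
    qed
    then have "inv g = \<one>" using faith g(1) unfolding faithful_on_def by simp
    then show "g \<in> {\<one>}" using g(1) by simp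
  qed (auto simp: kernel_def)
  with hom that show ?thesis by blast
qed

lemma iso_sym_group:
  assumes "finite \<Omega>" "faithful_on G \<Omega> act" "card (carrier G) = fact (card \<Omega>)"
  shows "G \<cong> sym_group (card \<Omega>)"
proof -
  obtain \<psi> where \<psi>: "\<psi> \<in> hom G (sym_group (card \<Omega>))" "inj_on \<psi> (carrier G)"
    by (rule exists_perm_hom[OF assms(1,2)])
  have "\<psi> ` carrier G = carrier (sym_group (card \<Omega>))"
  proof (rule card_subset_eq)
    show "card (\<psi> ` carrier G) = card (carrier (sym_group (card \<Omega>)))"
      using assms(3) by (simp add: card_image[OF \<psi>(2)] sym_group_card_carrier)
    show "finite (carrier (sym_group (card \<Omega>)))" by (simp add: sym_group_def finite_permutations)
  qed (use \<psi>(1) in \<open>auto simp: hom_def\<close>)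
  then have "\<psi> \<in> iso G (sym_group (card \<Omega>))" using \<psi> by (simp add: iso_def bij_betw_def)
  then show ?thesis by (auto simp: is_iso_def)
qed

end

section \<open>Subgroups of index two and the alternating group\<close>

lemma (in group) square_in_index_two:
  assumes "subgroup H G" "finite (carrier G)" "2 * card H = card (carrier G)" "x \<in> carrier G"
  shows "x \<otimes> x \<in> H"
proof (cases "x \<in> H")
  case True
  then show ?thesis using assms(1) by (simp add: subgroup.m_closed)
next
  case False
  have HG: "H \<subseteq> carrier G" using assms(1) by (rule subgroup.subset)
  have fin: "finite H" using HG assms(2) by (rule finite_subset)
  let ?Hx = "(\<lambda>h. h \<otimes> x) ` H"
  have inj: "inj_on (\<lambda>h. h \<otimes> x) H" using HG assms(4) by (auto intro!: inj_onI simp: subset_iff)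
  have disj: "H \<inter> ?Hx = {}"
  proof -
    have "x \<in> H" if "h \<in> H" "h \<otimes> x \<in> H" for h
    proof -
      have "inv h \<otimes> (h \<otimes> x) \<in> H"
        using that assms(1) by (meson subgroup.m_closed subgroup.m_inv_closed)
      then show ?thesis using that HG assms(4) by (auto simp: inv_inv_mult subset_iff)
    qed
    then show ?thesis using False by blast
  qed
  have "H \<union> ?Hx = carrier G"
  proof (rule card_subset_eq[OF assms(2)])
    show "card (H \<union> ?Hx) = card (carrier G)"
      using fin disj assms(3) by (simp add: card_Un_disjoint card_image[OF inj])
  qed (use HG assms(4) in auto)
  \<comment> \<open>Cancelling \<open>x\<close> in \<open>x \<otimes> x = h \<otimes> x\<close>
    would put \<open>x\<close> into \<open>H\<close>.\<close>
  moreover have "x \<otimes> x \<notin> ?Hx" using False HG assms(4) by auto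
  ultimately show ?thesis using assms(4) by blast
qed

text \<open>A 3-cycle \<open>p\<close> is the square of \<open>p \<circ> p\<close>, so it lies in
  every subgroup of index two. The 3-cycles generate the alternating group, and equality follows
  from the orders.\<close>

lemma index_two_sym_group:
  assumes H: "subgroup H (sym_group n)" and card: "2 * card H = fact n" and n: "2 \<le> n"
  shows "H = carrier (alt_group n)"
proof -
  interpret S: group "sym_group n" by (rule sym_group_is_group)
  have fin: "finite (carrier (sym_group n))" by (simp add: sym_group_def finite_permutations)
  have sq: "p \<circ> p \<in> H" if "p \<in> carrier (sym_group n)" for p
    using S.square_in_index_two[OF H fin _ that] card by (simp add: sym_group_card_carrier sym_group_mult)
  have three: "three_cycles n \<subseteq> H"
  proof
    fix p assume p: "p \<in> three_cycles n"
    then obtain cs where cs: "p = cycle_of_list cs" "cycle cs" "length cs = 3"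
      by blast
    have "p \<in> carrier (sym_group n)" using subsetD[OF three_cycles_incl p] by (simp add: alt_group_carrier sym_group_carrier)
    then have "p \<circ> p \<in> carrier (sym_group n)" by (simp add: sym_group_def permutes_compose)
    from sq[OF this] have "(p \<circ> p) \<circ> (p \<circ> p) \<in> H" .
    moreover obtain a b c where abc: "cs = [a, b, c]"
      using cs(3) by (auto simp: numeral_3_eq_3 length_Suc_conv)
    then have p: "p = Transposition.transpose a b \<circ> Transposition.transpose b c" and dist: "a \<noteq> b" "b \<noteq> c" "a \<noteq> c"
      using cs(1,2) by auto
    have abc': "p a = b" "p b = c" "p c = a" using dist by (auto simp: p)
    have out: "p x = x" if "x \<notin> {a, b, c}" for x using that by (auto simp: p)
    have "(p \<circ> p \<circ> p) x = id x" for x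
    proof (cases "x \<in> {a, b, c}")
      case True
      then show ?thesis using abc' by auto
    qed (simp add: out)
    then have "p \<circ> p \<circ> p = id" by blast
    then have "(p \<circ> p) \<circ> (p \<circ> p) = p" by (metis comp_assoc comp_id)
    ultimately show "p \<in> H" by simp
  qed
  have "carrier (alt_group n) \<subseteq> H"
  proof
    fix p assume "p \<in> carrier (alt_group n)"
    then have "p \<in> generate (alt_group n) (three_cycles n)" by (simp add: alt_group_carrier_as_three_cycles)
    then show "p \<in> H"
    proof induction
      case one then show ?case using subgroup.one_closed[OF H] by (simp only: sym_group_one alt_group_one)
    next
      case (inv p)
      then have "p \<in> carrier (alt_group n)" using three_cycles_incl by blast
      moreover from this have "p \<in> carrier (sym_group n)" by (simp add: alt_group_carrier sym_group_carrier)
      ultimately show ?case using subgroup.m_inv_closed[OF H subsetD[OF three inv]]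
        by (simp add: alt_group_inv_equality)
    next
      case (eng p q)
      then show ?case using subgroup.m_closed[OF H] by (simp only: sym_group_mult alt_group_mult)
    qed (use three in auto)
  qed
  then show ?thesis
    using card alt_group_card_carrier[OF n] subgroup.subset[OF H] fin
    by (intro card_subset_eq[symmetric]) (simp_all add: finite_subset[OF subgroup.subset[OF H] fin])
qed

lemma (in right_action) iso_alt_group:
  assumes "finite \<Omega>" "faithful_on G \<Omega> act" "2 * card (carrier G) = fact (card \<Omega>)" "2 \<le> card \<Omega>"
  shows "G \<cong> alt_group (card \<Omega>)"
proof -
  obtain \<psi> where \<psi>: "\<psi> \<in> hom G (sym_group (card \<Omega>))" "inj_on \<psi> (carrier G)"
    by (rule exists_perm_hom[OF assms(1,2)])
  interpret h: group_hom G "sym_group (card \<Omega>)" \<psi>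
    by (rule group_hom.intro) (use \<psi>(1) sym_group_is_group in \<open>auto simp: group_hom_axioms_def\<close>)
  have "\<psi> ` carrier G = carrier (alt_group (card \<Omega>))"
    using assms(3,4) by (intro index_two_sym_group h.img_is_subgroup) (auto simp: card_image[OF \<psi>(2)])
  then have "\<psi> \<in> iso G (alt_group (card \<Omega>))" using \<psi> by (auto simp: iso_def bij_betw_def hom_def alt_group_def)
  then show ?thesis by (auto simp: is_iso_def)
qed

text \<open>A recognition criterion by involutions. The centralizers of the 15 involutions have
  order 60 / 15 = 4 and, without elements of order 4, are Klein four-groups. Distinct ones meet
  trivially, so there are five, and \<open>G\<close> permutes them. The kernel has order dividing
  12. It contains no involution, since otherwise it would contain all 15, and order 3 is excluded by
  \<open>no3\<close>.\<close>

lemma (in group) iso_alt_group_5: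
  fixes T :: "'a set"
  defines "T \<equiv> {t \<in> carrier G. t \<noteq> \<one> \<and> t \<otimes> t = \<one>}"
  assumes card_G: "card (carrier G) = 60" and card_T: "card T = 15"
    and conj_T: "\<And>s t. s \<in> T \<Longrightarrow> t \<in> T \<Longrightarrow> \<exists>g\<in>carrier G. conjg s g = t"
    and no4: "\<And>g. g \<in> carrier G \<Longrightarrow> g [^] (4::nat) = \<one> \<Longrightarrow> g \<otimes> g = \<one>"
    and no3: "\<And>N. subgroup N G \<Longrightarrow> card N = 3 \<Longrightarrow> \<exists>x\<in>N. \<exists>g\<in>carrier G. conjg x g \<notin> N"
  shows "G \<cong> alt_group 5"
proof -
  have fin: "finite (carrier G)" using card_G card.infinite by fastforce
  interpret conj: right_action G "carrier G" conjg by (rule conjg_action)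
  define C where "C t = conj.stab t" for t
  have C_iff: "g \<in> C t \<longleftrightarrow> g \<in> carrier G \<and> t \<otimes> g = g \<otimes> t" if "t \<in> carrier G" for g t
    using that conjg_eq_self_iff[of t g] by (auto simp: C_def conj.stab_iff)
  have T_sub: "t \<in> carrier G" "t \<noteq> \<one>" "t \<otimes> t = \<one>" if "t \<in> T" for t using that by (auto simp: T_def)
  have conjg_T: "conjg t g \<in> T" if t: "t \<in> T" and g: "g \<in> carrier G" for t g
    using T_sub[OF t] g by (simp add: T_def flip: conjg_mult_left)
  have orbT: "conj.orb t = T" if t: "t \<in> T" for t
    using conj_T[OF t] conjg_T[OF t] by blast
  have sub_C: "subgroup (C t) G" if "t \<in> T" for t
    unfolding C_def by (rule conj.stab_subgroup) (use T_sub that in auto)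
  have C_sub: "C t \<subseteq> carrier G" for t unfolding C_def by (rule conj.stab_subset)
  have finC: "finite (C t)" for t using C_sub fin by (rule finite_subset)
  have card_C: "card (C t) = 4" if t: "t \<in> T" for t
    using conj.orbit_stabilizer[OF fin T_sub(1)[OF t]] orbT[OF t] card_T card_G by (simp add: C_def)
  have C_sq: "x \<otimes> x = \<one>" if t: "t \<in> T" and x: "x \<in> C t" for t x
    using subgroup_pow_card[OF sub_C[OF t] finC x] card_C[OF t] x C_sub by (intro no4) auto
  have C_comm: "x \<otimes> y = y \<otimes> x" if t: "t \<in> T" and x: "x \<in> C t" and y: "y \<in> C t" for t x y
  proof -
    have xy: "x \<otimes> y \<in> C t" using subgroup.m_closed[OF sub_C[OF t] x y] .
    have car: "x \<in> carrier G" "y \<in> carrier G" using x y C_sub by auto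
    have "inv x = x" "inv y = y" "inv (x \<otimes> y) = x \<otimes> y"
      using C_sq[OF t x] C_sq[OF t y] C_sq[OF t xy] car by (simp_all add: inv_equality)
    then show ?thesis using inv_mult_group[OF car] by simp
  qed
  \<comment> \<open>The centralizer of \<open>t\<close> is abelian, so it lies in the centralizer of
    each of its nontrivial elements \<open>s\<close>; both have order 4.\<close>
  have C_eq: "C s = C t" if t: "t \<in> T" and s: "s \<in> C t" "s \<noteq> \<one>" for s t
  proof -
    have car: "s \<in> carrier G" using s C_sub by auto
    have sT: "s \<in> T" using car s C_sq[OF t s(1)] by (simp add: T_def)
    have "C t \<subseteq> C s"
    proof
      fix x assume x: "x \<in> C t"
      then show "x \<in> C s" using C_comm[OF t s(1) x] C_sub by (auto simp: C_iff[OF car])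
    qed
    then have "C t = C s" by (rule card_subset_eq[OF finC]) (simp add: card_C t sT)
    then show ?thesis by simp
  qed
  have self_C: "t \<in> C t" if "t \<in> T" for t using T_sub[OF that] by (simp add: C_iff)
  define S where "S = C ` T"
  have finT: "finite T" using card_T card.infinite by fastforce
  have finS: "finite S" by (simp add: S_def finT)
  \<comment> \<open>Each of the four-groups contributes three of the 15 involutions.\<close>
  have card_S: "card S = 5"
  proof -
    have "T = (\<Union>V\<in>S. V - {\<one>})"
    proof (intro equalityI subsetI)
      fix t assume "t \<in> T"
      then show "t \<in> (\<Union>V\<in>S. V - {\<one>})" using self_C T_sub by (auto simp: S_def)
    next
      fix x assume "x \<in> (\<Union>V\<in>S. V - {\<one>})"
      then obtain t where t: "t \<in> T" "x \<in> C t" "x \<noteq> \<one>" by (auto simp: S_def)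
      then show "x \<in> T" using C_sq[OF t(1,2)] C_sub by (auto simp: T_def)
    qed
    also have "card \<dots> = (\<Sum>V\<in>S. card (V - {\<one>}))"
    proof (rule card_UN_disjoint[OF finS])
      show "\<forall>V\<in>S. finite (V - {\<one>})" using finC by (auto simp: S_def)
      show "\<forall>V\<in>S. \<forall>W\<in>S. V \<noteq> W \<longrightarrow> (V - {\<one>}) \<inter> (W - {\<one>}) = {}"
      proof (intro ballI impI)
        fix V W assume VW: "V \<in> S" "W \<in> S" "V \<noteq> W"
        show "(V - {\<one>}) \<inter> (W - {\<one>}) = {}"
        proof (rule ccontr)
          assume "(V - {\<one>}) \<inter> (W - {\<one>}) \<noteq> {}"
          then obtain x where "x \<in> V" "x \<in> W" "x \<noteq> \<one>" by blast
          then show False using VW C_eq unfolding S_def by blast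
        qed
      qed
    qed
    also have "\<dots> = (\<Sum>V\<in>S. 3)"
    proof (rule sum.cong[OF refl])
      fix V assume "V \<in> S"
      then obtain t where t: "t \<in> T" "V = C t" by (auto simp: S_def)
      then show "card (V - {\<one>}) = 3"
        using card_C[OF t(1)] subgroup.one_closed[OF sub_C[OF t(1)]] by (simp add: card_Diff_singleton)
    qed
    finally show ?thesis using card_T by simp
  qed
  have C_conj: "(\<lambda>x. conjg x g) ` C t = C (conjg t g)" if "t \<in> T" "g \<in> carrier G" for t g
    unfolding C_def using conj.stab_act T_sub(1) that by simp
  interpret S: right_action G S "\<lambda>V g. (\<lambda>x. conjg x g) ` V"
  proof (rule conjg_set_action)
    fix V g assume "V \<in> S" "g \<in> carrier G"
    then show "(\<lambda>x. conjg x g) ` V \<in> S" by (auto simp: S_def C_conj conjg_T)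
  qed (use C_sub in \<open>auto simp: S_def\<close>)
  obtain t0 where t0: "t0 \<in> T" using card_T by fastforce
  define N where "N = (\<Inter>V\<in>S. S.stab V)"
  have C_in: "C t \<in> S" if "t \<in> T" for t using that by (simp add: S_def)
  have N_sub: "subgroup N G" unfolding N_def
    using S.stab_subgroup C_in[OF t0] by (intro subgroups_Inter) auto
  have Nc: "N \<subseteq> carrier G" using N_sub by (rule subgroup.subset)
  have N_norm: "conjg x g \<in> N" if x: "x \<in> N" and g: "g \<in> carrier G" for x g
  proof -
    have "conjg x g \<in> S.stab V" if V: "V \<in> S" for V
    proof -
      let ?W = "(\<lambda>x. conjg x (inv g)) ` V"
      have W: "?W \<in> S" using S.act_closed[OF V inv_closed[OF g]] .
      have "x \<in> S.stab ?W" using x W unfolding N_def by blast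
      then have "conjg x g \<in> S.stab ((\<lambda>x. conjg x g) ` ?W)" unfolding S.stab_act[OF W g] by blast
      then show ?thesis using S.act_inv_cancel(2)[OF V g] by simp
    qed
    then show ?thesis unfolding N_def by blast
  qed
  have "card (S.stab (C t0)) = 12"
  proof -
    have "S.orb (C t0) = S"
    proof
      show "S.orb (C t0) \<subseteq> S" using S.orb_subset[OF C_in[OF t0]] .
      show "S \<subseteq> S.orb (C t0)"
      proof
        fix V assume "V \<in> S"
        then obtain t where t: "t \<in> T" "V = C t" by (auto simp: S_def)
        then obtain g where "g \<in> carrier G" "conjg t0 g = t" using conj_T[OF t0] by blast
        then show "V \<in> S.orb (C t0)" using C_conj[OF t0] t by auto
      qed
    qed
    then show ?thesis using S.orbit_stabilizer[OF fin C_in[OF t0]] card_S card_G by simp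
  qed
  moreover have "card N dvd card (S.stab (C t0))"
    by (rule subgroup_card_dvd[OF N_sub S.stab_subgroup[OF C_in[OF t0]]]) (use C_in[OF t0] in \<open>auto simp: N_def\<close>)
  ultimately have N12: "card N dvd 12" by simp
  have finN: "finite N" using Nc fin by (rule finite_subset)
  have NT: "N \<inter> T = {}"
  proof (rule ccontr)
    assume "N \<inter> T \<noteq> {}"
    then obtain t where t: "t \<in> N" "t \<in> T" by blast
    have "T \<subseteq> N"
    proof
      fix s assume "s \<in> T"
      then obtain g where "g \<in> carrier G" "conjg t g = s" using conj_T[OF t(2)] by blast
      then show "s \<in> N" using N_norm[OF t(1)] by auto
    qed
    then have "15 \<le> card N" using card_mono[OF finN] card_T by metis
    then show False using N12 by (auto dest: dvd_imp_le)
  qed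
  have "\<not> 2 dvd card N"
  proof
    assume "2 dvd card N"
    interpret N: group "G\<lparr>carrier := N\<rparr>" using N_sub by (rule subgroup_imp_group)
    obtain g where "g \<in> N" "g \<noteq> \<one>" "g [^]\<^bsub>G\<lparr>carrier := N\<rparr>\<^esub> (2::nat) = \<one>"
      by (rule N.cauchy[of 2]) (use finN \<open>2 dvd card N\<close> in auto)
    then have "g \<in> N \<inter> T" using Nc by (auto simp: T_def nat_pow_consistent[symmetric] numeral_2_eq_2)
    then show False using NT by blast
  qed
  moreover have "card N \<noteq> 3" using no3[OF N_sub] N_norm by blast
  \<comment> \<open>An odd divisor of 12 divides 3.\<close>
  ultimately have "card N = 1"
  proof -
    have "coprime (card N) (2 ^ 2)"
      using \<open>\<not> 2 dvd card N\<close> by (subst coprime_power_right_iff) simp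
    then have "card N dvd 3" using N12 coprime_dvd_mult_right_iff[of "card N" "2 ^ 2" 3] by simp
    then show ?thesis using \<open>card N \<noteq> 3\<close> prime_nat_iff[of 3] by auto
  qed
  then have N1: "N = {\<one>}" using subgroup.one_closed[OF N_sub] by (metis card_1_singletonE singletonD)
  have "faithful_on G S (\<lambda>V g. (\<lambda>x. conjg x g) ` V)"
    unfolding faithful_on_def
  proof (intro ballI impI)
    fix g assume "g \<in> carrier G" "\<forall>V\<in>S. (\<lambda>x. conjg x g) ` V = V"
    then have "g \<in> N" by (simp add: N_def S.stab_iff)
    then show "g = \<one>" using N1 by simp
  qed
  from S.iso_alt_group[OF finS this] show ?thesis using card_S card_G by (simp add: fact_numeral)
qed

section \<open>Counting fixed points\<close>

text \<open>
  In the application \<open>p\<close> is the characteristic, possibly 0, and the elements with exactly one fixed point are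
  the unipotent ones.
\<close>

locale fp_action = right_action G \<Omega> act for G (structure) and \<Omega> and act +
  fixes p :: nat
  assumes finite_G: "finite (carrier G)"
    and nonempty: "\<Omega> \<noteq> {}"
    and fix12: "g \<in> carrier G \<Longrightarrow> g \<noteq> \<one> \<Longrightarrow> card (Fix \<Omega> act g) = 1 \<or> card (Fix \<Omega> act g) = 2"
    and U_subgroup': "x \<in> \<Omega> \<Longrightarrow> subgroup {g \<in> carrier G. g = \<one> \<or> Fix \<Omega> act g = {x}} G"
    and U_comm': "g \<in> carrier G \<Longrightarrow> h \<in> carrier G \<Longrightarrow> g \<noteq> \<one> \<Longrightarrow> h \<noteq> \<one> \<Longrightarrow>
      Fix \<Omega> act g = {x} \<Longrightarrow> Fix \<Omega> act h = {x} \<Longrightarrow> g \<otimes> h = h \<otimes> g"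
    and unip_prime: "g \<in> carrier G \<Longrightarrow> g \<noteq> \<one> \<Longrightarrow> card (Fix \<Omega> act g) = 1 \<Longrightarrow> prime p \<and> g [^] p = \<one>"
    and prime_unip: "prime p \<Longrightarrow> g \<in> carrier G \<Longrightarrow> g \<noteq> \<one> \<Longrightarrow> g [^] p = \<one> \<Longrightarrow> card (Fix \<Omega> act g) = 1"
    and large_orbits: "x \<in> \<Omega> \<Longrightarrow> 2 < card (orb x)"
begin

definition U where "U x = {g \<in> carrier G. g = \<one> \<or> Fix \<Omega> act g = {x}}"
definition \<Gamma> where "\<Gamma> = {x \<in> \<Omega>. \<exists>g\<in>carrier G - {\<one>}. {x} = Fix \<Omega> act g}"
text \<open>The union of the nonregular orbits. It is finite even if \<open>\<Omega>\<close> is not,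
  so the pairs of elements and fixed points are counted on it.\<close>

definition N where "N = {x \<in> \<Omega>. stab x \<noteq> {\<one>}}"

abbreviation "NR \<equiv> nonregular_orbits G \<Omega> act"

lemma finite_Fix: "g \<in> carrier G \<Longrightarrow> g \<noteq> \<one> \<Longrightarrow> finite (Fix \<Omega> act g)"
  using fix12[of g] by (intro card_ge_0_finite) linarith

lemma finite_stab: "finite (stab x)"
  using stab_subset finite_G by (rule finite_subset)

lemma finite_orb: "finite (orb x)"
  using finite_G by simp

lemma N_eq: "N = (\<Union>g\<in>carrier G - {\<one>}. Fix \<Omega> act g)"
proof (intro equalityI subsetI)
  fix x assume x: "x \<in> N"
  then have "x \<in> \<Omega>" "stab x \<noteq> {\<one>}" by (auto simp: N_def)
  then obtain g where "g \<in> stab x" "g \<noteq> \<one>" using one_in_stab[of x] by blast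
  then show "x \<in> (\<Union>g\<in>carrier G - {\<one>}. Fix \<Omega> act g)" using \<open>x \<in> \<Omega>\<close> by (auto simp: stab_iff Fix_def)
next
  fix x assume "x \<in> (\<Union>g\<in>carrier G - {\<one>}. Fix \<Omega> act g)"
  then show "x \<in> N" by (auto simp: N_def Fix_def pt_stabilizer_def)
qed

lemma finite_N: "finite N"
  unfolding N_eq using finite_G finite_Fix by auto

lemma N_act: assumes x: "x \<in> N" and g: "g \<in> carrier G" shows "act x g \<in> N"
proof -
  have xO: "x \<in> \<Omega>" and nt: "stab x \<noteq> {\<one>}" using x by (auto simp: N_def)
  have "card (stab x) \<noteq> 1"
  proof
    assume "card (stab x) = 1"
    then obtain s where "stab x = {s}" by (rule card_1_singletonE)
    then show False using nt one_in_stab[OF xO] by simp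
  qed
  then have "stab (act x g) \<noteq> {\<one>}" using card_stab_act[OF xO g] by auto
  then show ?thesis using xO g by (simp add: N_def act_closed)
qed

lemma N_action: "right_action G N act"
proof (rule restrict_set)
  show "N \<subseteq> \<Omega>" unfolding N_def by blast
qed (rule N_act)

lemma NR_eq: "NR = orbit_set G N act"
proof (intro equalityI subsetI)
  fix Y assume "Y \<in> NR"
  then obtain x where "x \<in> Y" "stab x \<noteq> {\<one>}" "Y \<in> orbit_set G \<Omega> act"
    unfolding nonregular_orbits_def by blast
  then have "Y = orb x" "x \<in> N" using orbit_set_eq_orb[of Y x] by (auto simp: N_def)
  then show "Y \<in> orbit_set G N act" by (simp add: orbit_set_def)
next
  fix Y assume "Y \<in> orbit_set G N act"
  then obtain x where x: "Y = orb x" "x \<in> N" unfolding orbit_set_def by blast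
  then have "x \<in> \<Omega>" "stab x \<noteq> {\<one>}" by (auto simp: N_def)
  then show "Y \<in> NR" using orb_in_orbit_set[of x] orb_self[of x] x(1)
    unfolding nonregular_orbits_def by blast
qed

lemma finite_NR: "finite NR"
  unfolding NR_eq orbit_set_def using finite_N by simp

lemma NR_orb: "Y \<in> NR \<Longrightarrow> x \<in> Y \<Longrightarrow> Y = orb x \<and> x \<in> N \<and> x \<in> \<Omega>"
  using right_action.orbit_set_eq_orb[OF N_action, of Y x] unfolding NR_eq by (simp add: N_def)

lemma NR_I: "x \<in> N \<Longrightarrow> orb x \<in> NR"
  unfolding NR_eq orbit_set_def by blast

lemma NR_nonempty: assumes "Y \<in> NR" obtains x where "x \<in> Y" "x \<in> N" "x \<in> \<Omega>" "Y = orb x"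
proof -
  obtain x where "Y = orb x" "x \<in> N" using assms unfolding NR_eq orbit_set_def by blast
  moreover from this have "x \<in> \<Omega>" by (simp add: N_def)
  ultimately show ?thesis using orb_self[of x] by (intro that[of x]) simp_all
qed

lemma finite_NR_elem: assumes "Y \<in> NR" shows "finite Y"
proof -
  obtain x where "Y = orb x" using assms by (rule NR_nonempty)
  then show ?thesis by (simp add: finite_orb)
qed

lemma stab_ge_2: assumes "x \<in> N" shows "2 \<le> card (stab x)"
proof -
  have x: "x \<in> \<Omega>" "stab x \<noteq> {\<one>}" using assms by (simp_all add: N_def)
  then obtain g where g: "g \<in> stab x" "g \<noteq> \<one>" using one_in_stab[of x] by blast
  then have "card {g, \<one>} \<le> card (stab x)" using one_in_stab[OF x(1)]
    by (intro card_mono finite_stab) simp_all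
  then show ?thesis using g by simp
qed

lemma NR_card:
  assumes "Y \<in> NR" "x \<in> Y"
  shows "card Y * card (stab x) = card (carrier G)" "2 * card Y \<le> card (carrier G)" "2 < card Y"
proof -
  show 1: "card Y * card (stab x) = card (carrier G)"
    using NR_orb[OF assms] orbit_stabilizer[OF finite_G, of x] by simp
  show "2 * card Y \<le> card (carrier G)"
    using stab_ge_2[of x] NR_orb[OF assms] unfolding 1[symmetric] by simp
  show "2 < card Y" using NR_orb[OF assms] large_orbits[of x] by simp
qed

text \<open>An orbit \<open>Y\<close> contributes |Y| points with |G| / |Y| - 1 nontrivial
  stabilizer elements each, hence |G| - |Y| pairs.\<close>

lemma sum_fixed_points:
  "(\<Sum>Y\<in>NR. card (carrier G) - card Y) = (\<Sum>g\<in>carrier G - {\<one>}. card (Fix \<Omega> act g))"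
proof -
  interpret NA: right_action G N act by (rule N_action)
  have "(\<Sum>g\<in>carrier G - {\<one>}. card (Fix \<Omega> act g)) = (\<Sum>g\<in>carrier G - {\<one>}. card (Fix \<Omega> act g \<inter> N))"
    by (intro sum.cong refl arg_cong[where f = card]) (auto simp: N_eq)
  also have "\<dots> = (\<Sum>x\<in>N. card (stab x \<inter> (carrier G - {\<one>})))"
    by (rule double_count) (use finite_G finite_N in \<open>auto simp: N_def\<close>)
  also have "\<dots> = (\<Sum>x\<in>N. card (stab x) - 1)"
  proof (rule sum.cong[OF refl])
    fix x assume "x \<in> N"
    moreover have "stab x \<inter> (carrier G - {\<one>}) = stab x - {\<one>}" using stab_subset by blast
    ultimately show "card (stab x \<inter> (carrier G - {\<one>})) = card (stab x) - 1"
      using one_in_stab[of x] finite_stab by (simp add: N_def)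
  qed
  also have "\<dots> = (\<Sum>Y\<in>NR. \<Sum>x\<in>Y. card (stab x) - 1)"
  proof -
    have "N = \<Union> NR" unfolding NR_eq by (simp add: NA.Union_orbit_set)
    then have "(\<Sum>x\<in>N. card (stab x) - 1) = (\<Sum>x\<in>\<Union> NR. card (stab x) - 1)" by simp
    also have "\<dots> = (\<Sum>Y\<in>NR. \<Sum>x\<in>Y. card (stab x) - 1)"
    proof (subst sum.Union_disjoint)
      show "\<forall>Y\<in>NR. \<forall>Z\<in>NR. Y \<noteq> Z \<longrightarrow> Y \<inter> Z = {}"
        using NA.orbit_set_disjoint unfolding NR_eq by (meson disjoint_iff)
    qed (simp_all add: finite_NR_elem)
    finally show ?thesis .
  qed
  also have "\<dots> = (\<Sum>Y\<in>NR. card (carrier G) - card Y)"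
  proof (rule sum.cong[OF refl])
    fix Y assume Y: "Y \<in> NR"
    obtain x where x: "x \<in> Y" using Y by (rule NR_nonempty)
    have "card (stab y) = card (stab x)" if "y \<in> Y" for y
    proof -
      have "card Y * card (stab y) = card Y * card (stab x)"
        using NR_card(1)[OF Y that] NR_card(1)[OF Y x] by simp
      then show ?thesis using NR_card(3)[OF Y x] by simp
    qed
    then have "(\<Sum>x\<in>Y. card (stab x) - 1) = card Y * (card (stab x) - 1)" by simp
    also have "\<dots> = card (carrier G) - card Y"
      using NR_card(1)[OF Y x] by (simp add: diff_mult_distrib2)
    finally show "(\<Sum>x\<in>Y. card (stab x) - 1) = card (carrier G) - card Y" .
  qed
  finally show ?thesis by simp
qed

end

text \<open>Klein's equation 1/e1 + 1/e2 + 1/e3 = 1 + 2/n with the stabilizer orders in increasing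
  order. Comparing the sum of the lengths with multiples of the largest one forces e1 = 2, and then
  e2 = 3; here e2 = 2 would be the dihedral case with c = 2, ruled out by \<open>2 < c\<close>. What
  remains is 6 c = n + 12, so e3 is 3, 4 or 5.\<close>

lemma platonic_arith:
  fixes a b c n :: nat
  assumes "a * e1 = n" "b * e2 = n" "c * e3 = n" "a + b + c = n + 2" "2 < c" "c \<le> b" "b \<le> a" "2 * a \<le> n"
  shows "(n, a, b, c) \<in> {(12, 6, 4, 4), (24, 12, 8, 6), (60, 30, 20, 12)}"
proof -
  have e1: "e1 = 2"
  proof -
    have "e1 < 3"
    proof (rule ccontr)
      assume "\<not> e1 < 3"
      then have "a * 3 \<le> n" using assms(1) by (metis mult_le_mono2 not_less)
      then show False using assms by linarith
    qed
    moreover have "e1 \<noteq> 0" "e1 \<noteq> 1" using assms(1,5-8) by auto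
    ultimately show ?thesis by linarith
  qed
  have an: "2 * a = n" using assms(1) e1 by simp
  have bc: "b + c = a + 2" using assms an by linarith
  have e2: "e2 = 3"
  proof -
    have "e2 < 4"
    proof (rule ccontr)
      assume "\<not> e2 < 4"
      then have "b * 4 \<le> n" using assms(2) by (metis mult_le_mono2 not_less)
      then show False using assms an bc by linarith
    qed
    moreover have "0 < n" using an assms(5-7) by linarith
    moreover have "e2 \<noteq> 0" using assms(2) \<open>0 < n\<close> by (cases e2) auto
    moreover have "e2 \<noteq> 1" using assms(2,7) an \<open>0 < n\<close> by auto
    moreover have "e2 \<noteq> 2" using assms(2,5) bc an by auto
    ultimately show ?thesis by linarith
  qed
  have bn: "3 * b = n" using assms(2) e2 by simp
  have c6: "6 * c = n + 12" using an bn bc by linarith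
  have "e3 < 6"
  proof (rule ccontr)
    assume "\<not> e3 < 6"
    then have "c * 6 \<le> n" using assms(3) by (metis mult_le_mono2 not_less)
    then show False using c6 by linarith
  qed
  moreover have "2 < e3"
  proof (rule ccontr)
    assume "\<not> 2 < e3"
    then have "n \<le> c * 2" using assms(3) by (metis mult_le_mono2 not_less)
    then show False using assms an bn c6 by linarith
  qed
  ultimately consider "e3 = 3" | "e3 = 4" | "e3 = 5" by linarith
  then show ?thesis
    by cases (use assms(3) an bn c6 in auto)
qed

section \<open>Orbit lengths in the absence of unipotent elements\<close>

context fp_action
begin

lemma NR_stab_mult: assumes Y: "Y \<in> NR" shows "\<exists>e. card Y * e = card (carrier G)"
proof -
  obtain x where "x \<in> Y" using Y by (rule NR_nonempty)
  then show ?thesis using NR_card(1)[OF Y] by blast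
qed

lemma card_G_ge: "2 < card (carrier G)"
proof -
  obtain x where "x \<in> \<Omega>" using nonempty by blast
  then have "2 < card (orb x)" by (rule large_orbits)
  also have "\<dots> \<le> card (carrier G)" using finite_G by (rule card_image_le)
  finally show ?thesis .
qed

lemma card_Fix_no_unipotents:
  assumes "\<Gamma> = {}" "g \<in> carrier G" "g \<noteq> \<one>"
  shows "card (Fix \<Omega> act g) = 2"
proof (rule ccontr)
  assume "card (Fix \<Omega> act g) \<noteq> 2"
  then have "card (Fix \<Omega> act g) = 1" using fix12[OF assms(2,3)] by simp
  then obtain x where "Fix \<Omega> act g = {x}" by (rule card_1_singletonE)
  then have "x \<in> \<Gamma>" using assms by (auto simp: \<Gamma>_def Fix_def)
  then show False using assms by simp
qed

theorem orbits_no_unipotents: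
  assumes "\<Gamma> = {}"
  shows "\<exists>A B C. NR = {A, B, C} \<and> A \<noteq> B \<and> A \<noteq> C \<and> B \<noteq> C \<and>
    (card (carrier G), card A, card B, card C) \<in> {(12, 6, 4, 4), (24, 12, 8, 6), (60, 30, 20, 12)}"
proof -
  let ?n = "card (carrier G)"
  note two = card_Fix_no_unipotents[OF assms]
  have sum: "(\<Sum>Y\<in>NR. ?n - card Y) = 2 * (?n - 1)"
    unfolding sum_fixed_points using two finite_G by simp
  \<comment> \<open>With n = |G|, a nonregular orbit has at least 3 and at most n / 2 points, so
    each term of the sum lies between n / 2 and n - 3. The total 2 (n - 1) then leaves exactly three
    orbits.\<close>
  have half: "?n \<le> 2 * (?n - card Y)" and le: "?n - card Y \<le> ?n - 3" if Y: "Y \<in> NR" for Y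
  proof -
    obtain x where x: "x \<in> Y" using Y by (rule NR_nonempty)
    show "?n \<le> 2 * (?n - card Y)" "?n - card Y \<le> ?n - 3"
      using NR_card(2,3)[OF Y x] by linarith+
  qed
  have "card NR * ?n \<le> (\<Sum>Y\<in>NR. 2 * (?n - card Y))"
    using sum_mono[of NR "\<lambda>_. ?n", OF half] by simp
  also have "\<dots> = 4 * (?n - 1)" using sum by (simp flip: sum_distrib_left)
  also have "\<dots> < 4 * ?n" using card_G_ge by simp
  finally have "card NR < 4" by simp
  moreover have "\<not> card NR \<le> 2"
  proof
    assume c: "card NR \<le> 2"
    have "2 * (?n - 1) \<le> (\<Sum>Y\<in>NR. ?n - 3)" unfolding sum[symmetric] by (rule sum_mono) (rule le)
    also have "\<dots> = card NR * (?n - 3)" by simp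
    also have "\<dots> \<le> 2 * (?n - 3)" using c by simp
    finally show False using card_G_ge by simp
  qed
  ultimately have "card NR = 3" by simp
  then obtain A B C where ABC: "NR = {A, B, C}" "A \<noteq> B" "A \<noteq> C" "B \<noteq> C"
    by (auto simp: card_3_iff)
  have sum3: "card D + card Y + card Z = ?n + 2"
    if "NR = {D, Y, Z}" "D \<noteq> Y" "D \<noteq> Z" "Y \<noteq> Z" for D Y Z
  proof -
    have "2 * card V \<le> ?n" if V: "V \<in> NR" for V
    proof -
      obtain x where "x \<in> V" using V by (rule NR_nonempty)
      then show ?thesis by (rule NR_card(2)[OF V])
    qed
    then have "2 * card D \<le> ?n" "2 * card Y \<le> ?n" "2 * card Z \<le> ?n" using that(1) by simp_all
    then show ?thesis using sum that card_G_ge by simp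
  qed
  have main: ?thesis
    if XYZ: "NR = {D, Y, Z}" "D \<noteq> Y" "D \<noteq> Z" "Y \<noteq> Z" and ord: "card Z \<le> card Y" "card Y \<le> card D" for D Y Z
  proof -
    have D: "D \<in> NR" and Y: "Y \<in> NR" and Z: "Z \<in> NR" using XYZ by auto
    obtain e1 e2 e3 where e: "card D * e1 = ?n" "card Y * e2 = ?n" "card Z * e3 = ?n"
      using NR_stab_mult[OF D] NR_stab_mult[OF Y] NR_stab_mult[OF Z] by blast
    obtain x where x: "x \<in> D" using D by (rule NR_nonempty)
    obtain z where z: "z \<in> Z" using Z by (rule NR_nonempty)
    from platonic_arith[OF e sum3[OF XYZ] NR_card(3)[OF Z z] ord NR_card(2)[OF D x]] XYZ
    show ?thesis by blast
  qed
  have sw: "{A, B, C} = {A, C, B}" "{A, B, C} = {B, A, C}" "{A, B, C} = {B, C, A}" "{A, B, C} = {C, A, B}" "{A, B, C} = {C, B, A}"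
    by auto
  consider "card C \<le> card B" "card B \<le> card A" | "card B \<le> card C" "card C \<le> card A"
    | "card C \<le> card A" "card A \<le> card B" | "card A \<le> card C" "card C \<le> card B"
    | "card B \<le> card A" "card A \<le> card C" | "card A \<le> card B" "card B \<le> card C" by linarith
  then show ?thesis
  proof cases
    case 1 then show ?thesis by (intro main[of A B C]) (use ABC in auto)
  next
    case 2 then show ?thesis by (intro main[of A C B]) (use ABC in auto)
  next
    case 3 then show ?thesis by (intro main[of B A C]) (use ABC in auto)
  next
    case 4 then show ?thesis by (intro main[of B C A]) (use ABC in auto)
  next
    case 5 then show ?thesis by (intro main[of C A B]) (use ABC in auto)
  next
    case 6 then show ?thesis by (intro main[of C B A]) (use ABC in auto)
  qed
qed

end

text \<open>
  Here \<open>q = |U x|\<close>, \<open>|\<Gamma>| = 1 + m q\<close>, \<open>d\<close> is the index of \<open>U x\<close> in the stabilizer of \<open>x \<in> \<Gamma>\<close>, and \<open>e\<close> is the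
  order of the stabilizers on the other nonregular orbit, of length \<open>q (m (q - 2) + 1)\<close>.
\<close>

lemma modular_arith:
  fixes q m d e :: nat
  assumes q: "2 \<le> q" and m: "1 \<le> m" and d: "1 \<le> d" "d dvd q - 1"
    and e: "(m * (q - 2) + 1) * e = d * (1 + m * q)" and large: "2 < q * (m * (q - 2) + 1)"
  shows "3 \<le> q \<and> m = 1 \<and> (d = q - 1 \<or> 2 * d = q - 1) \<or> q = 3 \<and> m = 3 \<and> d = 2"
proof -
  have q3: "3 \<le> q"
  proof (rule ccontr)
    assume "\<not> 3 \<le> q"
    then have "q = 2" using q by simp
    then show False using large by simp
  qed
  define D where "D = m * (q - 2) + 1"
  \<comment> \<open>Modulo \<open>D\<close> the number 1 + m q is 2 m, and \<open>D\<close> is prime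
    to \<open>m\<close>, so \<open>D\<close> divides 2 d. Since d is at most q - 1, this bounds
    \<open>m\<close>.\<close>
  have "1 + m * q = D + 2 * m" using q unfolding D_def by (simp add: diff_mult_distrib2)
  then have "D dvd d * (D + 2 * m)" using e unfolding D_def by (metis dvd_triv_left)
  then have "D dvd d * (2 * m)" by (simp add: distrib_left dvd_add_right_iff)
  moreover have "coprime D m"
  proof (rule coprimeI)
    fix c assume "c dvd D" "c dvd m"
    then show "is_unit c" unfolding D_def by (metis dvd_add_right_iff dvd_mult2)
  qed
  ultimately have "D dvd 2 * d" by (simp add: coprime_dvd_mult_left_iff mult.assoc[symmetric] mult.commute[of d])
  then obtain s where s: "2 * d = D * s" by (elim dvdE)
  have dq: "d \<le> q - 1" using d(2) q3 by (intro dvd_imp_le) auto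
  have s0: "s \<noteq> 0" using s d(1) by (intro notI) simp
  have mq: "m * (q - 2) \<ge> q - 2" using m by simp
  have Ds: "D * s \<le> 2 * (q - 1)" using s dq by simp
  show ?thesis
  proof (cases "m = 1")
    case True
    then have D: "D = q - 1" using q3 by (simp add: D_def)
    have "(q - 1) * s \<le> (q - 1) * 2" using Ds D by simp
    then have "s \<le> 2" using q3 by simp
    then consider "s = 1" | "s = 2" using s0 by linarith
    then show ?thesis by cases (use s D q3 True in auto)
  next
    case False
    then have m2: "2 * (q - 2) \<le> m * (q - 2)" using m by (intro mult_right_mono) auto
    have "s < 2"
    proof (rule ccontr)
      assume "\<not> s < 2"
      then have "D * 2 \<le> D * s" by simp
      then have "D * 2 \<le> 2 * (q - 1)" using Ds by (rule order_trans)
      moreover have "2 * (q - 2) + 1 \<le> D" using m2 by (simp add: D_def)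
      ultimately show False using q3 by linarith
    qed
    then have "s = 1" using s0 by simp
    then have D2: "2 * d = m * (q - 2) + 1" using s by (simp add: D_def)
    then have up: "m * (q - 2) + 1 \<le> 2 * (q - 2) + 2" using dq q3 by linarith
    \<comment> \<open>For m = 2 the number \<open>D\<close> is odd, whereas 2 d = D.\<close>
    have "m \<noteq> 2"
    proof
      assume "m = 2"
      then have "2 * d = 2 * (q - 2) + 1" using D2 by simp
      then show False by presburger
    qed
    then have m3: "3 \<le> m" using False m by simp
    then have "3 * (q - 2) \<le> m * (q - 2)" by (intro mult_right_mono) auto
    then have "q = 3" using up q3 by linarith
    then have "m = 3" "d = 2" using up m3 D2 by auto
    then show ?thesis using \<open>q = 3\<close> by simp
  qed
qed

section \<open>Unipotent subgroups and the orbit lengths that they force\<close>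

context fp_action
begin

lemma U_subgroup: "x \<in> \<Omega> \<Longrightarrow> subgroup (U x) G"
  unfolding U_def by (rule U_subgroup')

lemma U_subset: "U x \<subseteq> carrier G"
  by (auto simp: U_def)

lemma finite_U: "finite (U x)"
  using U_subset finite_G by (rule finite_subset)

lemma U_stab: "x \<in> \<Omega> \<Longrightarrow> U x \<subseteq> stab x"
  by (auto simp: U_def stab_iff act_one Fix_def)

lemma U_free: "g \<in> U x \<Longrightarrow> g \<noteq> \<one> \<Longrightarrow> y \<in> \<Omega> \<Longrightarrow> act y g = y \<Longrightarrow> y = x"
  by (auto simp: U_def Fix_def)

text \<open>A nontrivial element of \<open>U x\<close> fixes no point besides \<open>x\<close>, so
  \<open>U x\<close> acts freely on \<open>S\<close>.\<close>

lemma card_U_dvd: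
  assumes x: "x \<in> \<Omega>" and S: "finite S" "S \<subseteq> \<Omega>" "x \<notin> S"
    and inv: "\<And>y g. y \<in> S \<Longrightarrow> g \<in> U x \<Longrightarrow> act y g \<in> S"
  shows "card (U x) dvd card S"
proof -
  have "right_action (G\<lparr>carrier := U x\<rparr>) \<Omega> act" by (rule restrict_group[OF U_subgroup[OF x]])
  then interpret R: right_action "G\<lparr>carrier := U x\<rparr>" S act
    by (rule right_action.restrict_set) (use S inv in auto)
  have "R.stab y = {\<one>}" if y: "y \<in> S" for y
  proof -
    have "g = \<one>" if "g \<in> R.stab y" for g
    proof (rule ccontr)
      assume "g \<noteq> \<one>"
      then have "y = x" using that y S(2) by (intro U_free[of g x y]) (auto simp: R.stab_iff)
      then show False using y S(3) by simp
    qed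
    moreover have "\<one> \<in> R.stab y" using R.one_in_stab[OF y] by simp
    ultimately show ?thesis by blast
  qed
  then have "card (carrier (G\<lparr>carrier := U x\<rparr>)) dvd card S * 1"
    by (intro R.card_dvd_of_equal_stabs) (simp_all add: S finite_U)
  then show ?thesis by simp
qed

lemma Gamma_iff: "x \<in> \<Gamma> \<longleftrightarrow> x \<in> \<Omega> \<and> U x \<noteq> {\<one>}"
  by (auto simp: \<Gamma>_def U_def)

lemma U_act:
  assumes x: "x \<in> \<Omega>" and g: "g \<in> carrier G"
  shows "U (act x g) = (\<lambda>u. conjg u g) ` U x"
proof -
  have sub: "conjg u g \<in> U (act x g)" if u: "u \<in> U x" and x: "x \<in> \<Omega>" and g: "g \<in> carrier G" for u x g
    using u g Fix_conjg[of u g] by (auto simp: U_def)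
  show ?thesis
  proof (intro equalityI subsetI)
    fix u assume u: "u \<in> U (act x g)"
    have "conjg u (inv g) \<in> U (act (act x g) (inv g))"
      by (rule sub[OF u]) (use x g in \<open>auto simp: act_closed\<close>)
    then have "conjg u (inv g) \<in> U x" using x g by simp
    moreover have "u = conjg (conjg u (inv g)) g" using u g U_subset[of "act x g"] by auto
    ultimately show "u \<in> (\<lambda>u. conjg u g) ` U x" by blast
  qed (use sub x g in auto)
qed

lemma card_U_act:
  assumes "x \<in> \<Omega>" "g \<in> carrier G" shows "card (U (act x g)) = card (U x)"
  unfolding U_act[OF assms]
  by (rule card_image, rule inj_on_subset[OF inj_on_conjg[OF assms(2)] U_subset])

lemma Gamma_act: assumes x: "x \<in> \<Gamma>" and g: "g \<in> carrier G" shows "act x g \<in> \<Gamma>"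
proof -
  have xO: "x \<in> \<Omega>" using x by (simp add: Gamma_iff)
  obtain u where "u \<in> U x" "u \<noteq> \<one>" using x subgroup.one_closed[OF U_subgroup[OF xO]] by (auto simp: Gamma_iff)
  then have "conjg u g \<in> U (act x g)" "conjg u g \<noteq> \<one>" using U_act[OF xO g] U_subset[of x] g by auto
  then show ?thesis using xO g by (auto simp: Gamma_iff act_closed)
qed

lemma Gamma_N: "\<Gamma> \<subseteq> N"
  using U_stab U_subgroup subgroup.one_closed by (fastforce simp: Gamma_iff N_def)

lemma prime_dvd_card_subgroup:
  fixes r :: nat
  assumes "subgroup H G" "g \<in> H" "g \<noteq> \<one>" "prime r" "g [^] r = \<one>"
  shows "r dvd card H"
proof -
  have H: "H \<subseteq> carrier G" using assms(1) by (rule subgroup.subset)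
  then have fin: "finite H" and g: "g \<in> carrier G" using finite_G assms(2) by (auto dest: finite_subset)
  have "ord g dvd r" using assms(5) g pow_eq_id by blast
  moreover have "ord g \<noteq> 1" using assms(3) g ord_eq_1 by blast
  ultimately have "ord g = r" using assms(4) by (auto simp: prime_nat_iff)
  moreover have "ord g dvd card H" using subgroup_pow_card[OF assms(1) fin assms(2)] g pow_eq_id by blast
  ultimately show ?thesis by simp
qed

lemma Gamma_unipotent:
  assumes "x \<in> \<Gamma>" obtains g where "g \<in> U x" "g \<noteq> \<one>" "prime p" "g [^] p = \<one>"
proof -
  obtain g where g: "g \<in> carrier G" "g \<noteq> \<one>" "Fix \<Omega> act g = {x}" using assms by (auto simp: \<Gamma>_def)
  then have "prime p \<and> g [^] p = \<one>" by (intro unip_prime) simp_all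
  then show ?thesis using g by (intro that[of g]) (simp_all add: U_def)
qed

lemma p_dvd_U: assumes "x \<in> \<Gamma>" shows "p dvd card (U x)"
proof -
  have "x \<in> \<Omega>" using assms by (simp add: Gamma_iff)
  obtain g where "g \<in> U x" "g \<noteq> \<one>" "prime p" "g [^] p = \<one>" using assms by (rule Gamma_unipotent)
  then show ?thesis by (rule prime_dvd_card_subgroup[OF U_subgroup[OF \<open>x \<in> \<Omega>\<close>]])
qed

lemma card_U_dvd_orb:
  assumes x: "x \<in> \<Omega>"
  shows "card (U x) dvd card (orb x) - 1"
proof -
  have "card (U x) dvd card (orb x - {x})"
  proof (rule card_U_dvd[OF x])
    show "finite (orb x - {x})" "x \<notin> orb x - {x}" by (simp_all add: finite_orb)
    show "orb x - {x} \<subseteq> \<Omega>" using orb_subset[OF x] by blast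
    fix y g assume y: "y \<in> orb x - {x}" and g: "g \<in> U x"
    have yO: "y \<in> \<Omega>" using y orb_subset[OF x] by blast
    have gc: "g \<in> carrier G" using g U_subset by blast
    have "act x g = x" using g U_stab[OF x] by (auto simp: stab_iff)
    then have "act y g \<noteq> x" using act_eq_iff[OF yO x gc] y by auto
    moreover have "act y g \<in> orb y" using gc by blast
    ultimately show "act y g \<in> orb x - {x}" using orb_eq[OF x, of y] y by blast
  qed
  then show ?thesis using orb_self[OF x] finite_orb by simp
qed

text \<open>As in the proof of Sylow's theorem: a group \<open>U y\<close> with y in \<Gamma>
  outside the orbit of x acts freely on that orbit, so p divides its length. But the free action of
  \<open>U x\<close> on the rest of the orbit makes the length congruent to 1 modulo p.\<close>

lemma Gamma_orbit: assumes x: "x \<in> \<Gamma>" shows "\<Gamma> = orb x"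
proof
  have xO: "x \<in> \<Omega>" using x by (simp add: Gamma_iff)
  show "orb x \<subseteq> \<Gamma>" using Gamma_act[OF x] by blast
  show "\<Gamma> \<subseteq> orb x"
  proof
    fix y assume y: "y \<in> \<Gamma>"
    then have yO: "y \<in> \<Omega>" by (simp add: Gamma_iff)
    show "y \<in> orb x"
    proof (rule ccontr)
      assume ny: "y \<notin> orb x"
      have "card (U y) dvd card (orb x)"
      proof (rule card_U_dvd[OF yO finite_orb orb_subset[OF xO] ny])
        fix z g assume z: "z \<in> orb x" and g: "g \<in> U y"
        then have "act z g \<in> orb z" using U_subset by blast
        then show "act z g \<in> orb x" using orb_eq[OF xO z] by simp
      qed
      then have "p dvd card (orb x)" using p_dvd_U[OF y] dvd_trans by blast
      moreover have "p dvd card (orb x) - 1" using p_dvd_U[OF x] card_U_dvd_orb[OF xO] dvd_trans by blast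
      ultimately have "p dvd 1" using large_orbits[OF xO]
        by (metis One_nat_def diff_diff_cancel dvd_diff_nat less_imp_le_nat less_trans one_less_numeral_iff semiring_norm(76))
      then show False using Gamma_unipotent[OF x] by (metis not_prime_unit)
    qed
  qed
qed

lemma p_dvd_card_G: assumes x: "x \<in> \<Gamma>" shows "p dvd card (carrier G)"
proof -
  have "x \<in> \<Omega>" using x by (simp add: Gamma_iff)
  from subgroup_card_dvd_order[OF U_subgroup[OF this]] p_dvd_U[OF x] show ?thesis by (rule dvd_trans[rotated])
qed

text \<open>By Cauchy's theorem there would be an element of order p, and such an element has a
  single fixed point.\<close>

lemma coprime_card_G: assumes "\<Gamma> = {}" "prime p" shows "\<not> p dvd card (carrier G)"
proof
  assume "p dvd card (carrier G)"
  then obtain g where g: "g \<in> carrier G" "g \<noteq> \<one>" "g [^] p = \<one>" using cauchy[OF finite_G assms(2)] by blast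
  then have "card (Fix \<Omega> act g) = 1" using prime_unip assms(2) by blast
  then obtain x where "Fix \<Omega> act g = {x}" by (rule card_1_singletonE)
  then have "x \<in> \<Gamma>" using g by (auto simp: \<Gamma>_def Fix_def)
  then show False using assms by simp
qed

text \<open>The element \<open>u\<close> permutes the fixed points of \<open>s\<close>. It fixes
  \<open>x\<close>, so a second fixed point of \<open>s\<close>, being the only one left, would be
  fixed by \<open>u\<close> as well.\<close>

lemma centralizer_unipotent:
  assumes x: "x \<in> \<Omega>" and u: "u \<in> U x" "u \<noteq> \<one>" and s: "s \<in> stab x" "u \<otimes> s = s \<otimes> u"
  shows "s \<in> U x"
proof (cases "s = \<one>")
  case True
  then show ?thesis by (simp add: U_def)
next
  case False
  have sc: "s \<in> carrier G" and uc: "u \<in> carrier G" using s u by (auto simp: stab_iff U_def)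
  have xs: "x \<in> Fix \<Omega> act s" using s x by (simp add: Fix_def stab_iff)
  have "conjg s u = s" using s(2) conjg_eq_self_iff[OF sc uc] by simp
  then have inv: "(\<lambda>y. act y u) ` Fix \<Omega> act s = Fix \<Omega> act s" using Fix_conjg[OF sc uc] by simp
  have "Fix \<Omega> act s = {x}"
  proof (rule ccontr)
    assume "Fix \<Omega> act s \<noteq> {x}"
    then have "card (Fix \<Omega> act s) \<noteq> 1" using xs by (auto simp: card_1_singleton_iff)
    then have "card (Fix \<Omega> act s) = 2" using fix12[OF sc False] by simp
    then obtain a b where ab: "Fix \<Omega> act s = {a, b}" "a \<noteq> b" by (meson card_2_iff)
    then obtain y where y: "Fix \<Omega> act s = {x, y}" "y \<noteq> x" using xs by fastforce
    then have yO: "y \<in> \<Omega>" by (auto simp: Fix_def)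
    have "act x u = x" using u U_stab[OF x] by (auto simp: stab_iff)
    moreover have "act y u \<in> {x, y}" using inv y(1) by auto
    ultimately have "act y u = y" using act_eq_iff[OF yO x uc] y(2) by auto
    then show False using U_free[OF u yO] y(2) by simp
  qed
  then show ?thesis using sc by (simp add: U_def)
qed

text \<open>The stabilizer of \<open>x\<close> acts by conjugation on the nontrivial elements of
  \<open>U x\<close>. The centralizer of each of them in the stabilizer is exactly
  \<open>U x\<close>, because \<open>U x\<close> is abelian and by
  \<open>centralizer_unipotent\<close>. Hence all orbits have length \<open>d\<close>.\<close>

lemma index_dvd:
  assumes x: "x \<in> \<Gamma>" and d: "card (stab x) = card (U x) * d"
  shows "d dvd card (U x) - 1"
proof -
  have xO: "x \<in> \<Omega>" using x by (simp add: Gamma_iff)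
  interpret St: group "G\<lparr>carrier := stab x\<rparr>" by (rule subgroup_imp_group[OF stab_subgroup[OF xO]])
  have act: "right_action (G\<lparr>carrier := stab x\<rparr>) (carrier G) conjg"
    by (rule right_action.restrict_group[OF conjg_action stab_subgroup[OF xO]])
  interpret R: right_action "G\<lparr>carrier := stab x\<rparr>" "U x - {\<one>}" conjg
  proof (rule right_action.restrict_set[OF act])
    show "U x - {\<one>} \<subseteq> carrier G" using U_subset by blast
    fix u s assume u: "u \<in> U x - {\<one>}" and s: "s \<in> carrier (G\<lparr>carrier := stab x\<rparr>)"
    then have sc: "s \<in> carrier G" "act x s = x" by (simp_all add: stab_iff)
    then have "conjg u s \<in> U x" using U_act[OF xO sc(1)] u by auto
    moreover have "conjg u s \<noteq> \<one>" using u U_subset[of x] sc by auto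
    ultimately show "conjg u s \<in> U x - {\<one>}" by simp
  qed
  have "R.stab u = U x" if u: "u \<in> U x - {\<one>}" for u
  proof -
    have uc: "u \<in> carrier G" using u U_subset by blast
    have "s \<in> U x" if "s \<in> R.stab u" for s
    proof (rule centralizer_unipotent[OF xO])
      have "s \<in> stab x" "conjg u s = u" using that by (simp_all add: R.stab_iff)
      then show "s \<in> stab x" "u \<otimes> s = s \<otimes> u" using conjg_eq_self_iff[OF uc] by (simp_all add: stab_iff)
    qed (use u in auto)
    moreover have "s \<in> R.stab u" if s: "s \<in> U x" for s
    proof -
      have sc: "s \<in> carrier G" using s U_subset by blast
      have "u \<otimes> s = s \<otimes> u"
        using U_comm'[of u s x] u s uc sc by (cases "s = \<one>") (auto simp: U_def)
      then show ?thesis using conjg_eq_self_iff[OF uc sc] s U_stab[OF xO] by (auto simp: R.stab_iff)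
    qed
    ultimately show ?thesis by blast
  qed
  then have "card (carrier (G\<lparr>carrier := stab x\<rparr>)) dvd card (U x - {\<one>}) * card (U x)"
    by (intro R.card_dvd_of_equal_stabs) (simp_all add: finite_U finite_stab)
  then have "card (U x) * d dvd (card (U x) - 1) * card (U x)"
    using d subgroup.one_closed[OF U_subgroup[OF xO]] finite_U by simp
  moreover have "card (U x) \<noteq> 0" using subgroup.one_closed[OF U_subgroup[OF xO]] finite_U[of x] by auto
  ultimately show ?thesis by (simp add: mult.commute)
qed

theorem orbits_unipotents:
  assumes "\<Gamma> \<noteq> {}"
  obtains q d \<Delta> where "\<Gamma> \<in> NR" "NR - {\<Gamma>} = {\<Delta>}"
    "\<And>x. x \<in> \<Gamma> \<Longrightarrow> card (U x) = q" "\<And>x. x \<in> \<Gamma> \<Longrightarrow> card (stab x) = q * d"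
    "card (carrier G) = card \<Gamma> * (q * d)" "p dvd q"
    "3 \<le> q \<and> card \<Gamma> = q + 1 \<and> card \<Delta> = q * (q - 1) \<and> (d = q - 1 \<or> 2 * d = q - 1) \<or>
     q = 3 \<and> d = 2 \<and> card \<Gamma> = 10 \<and> card \<Delta> = 12"
proof -
  let ?n = "card (carrier G)"
  obtain x0 where x0: "x0 \<in> \<Gamma>" using assms by blast
  then have x0O: "x0 \<in> \<Omega>" by (simp add: Gamma_iff)
  have Gorb: "\<Gamma> = orb x0" by (rule Gamma_orbit[OF x0])
  have GNR: "\<Gamma> \<in> NR" unfolding Gorb using x0 Gamma_N by (intro NR_I) blast
  define q where "q = card (U x0)"
  obtain d where d: "card (stab x0) = q * d"
    using subgroup_card_dvd[OF U_subgroup[OF x0O] stab_subgroup[OF x0O] U_stab[OF x0O]] unfolding q_def by (elim dvdE)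
  have Uq: "card (U x) = q" if x: "x \<in> \<Gamma>" for x
    using x card_U_act[OF x0O] unfolding Gorb q_def by auto
  have stabq: "card (stab x) = q * d" if x: "x \<in> \<Gamma>" for x
    using x card_stab_act[OF x0O] unfolding Gorb d[symmetric] by auto
  have n: "?n = card \<Gamma> * (q * d)" using NR_card(1)[OF GNR x0] stabq[OF x0] by simp
  have G2: "2 < card \<Gamma>" using NR_card(3)[OF GNR x0] .
  have npos: "0 < ?n" using card_G_ge by simp
  have d1: "1 \<le> d" using n npos by (cases d) auto
  have q2: "2 \<le> q"
  proof -
    obtain g where g: "g \<in> U x0" "g \<noteq> \<one>" using x0 by (rule Gamma_unipotent)
    have "card {g, \<one>} \<le> card (U x0)"
      using g subgroup.one_closed[OF U_subgroup[OF x0O]] by (intro card_mono finite_U) auto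
    then show ?thesis using g by (simp add: q_def)
  qed
  have "q dvd card \<Gamma> - 1" using card_U_dvd_orb[OF x0O] unfolding q_def Gorb .
  then obtain m where "card \<Gamma> - 1 = q * m" by (elim dvdE)
  then have m: "card \<Gamma> = 1 + m * q" using G2 by (simp add: mult.commute)
  have m1: "1 \<le> m" using m G2 by (cases m) auto
  have finG: "finite \<Gamma>" unfolding Gorb by (rule finite_orb)
  \<comment> \<open>All nontrivial elements have two fixed points except the |\<Gamma>| (q - 1)
    unipotent ones, which have one; adding their number to the sum makes every summand 2.\<close>
  have sum1: "(\<Sum>g\<in>carrier G - {\<one>}. card (Fix \<Omega> act g)) + card \<Gamma> * (q - 1) = 2 * (?n - 1)"
  proof -
    let ?A = "{g \<in> carrier G - {\<one>}. card (Fix \<Omega> act g) = 1}"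
    have "?A = (\<Union>x\<in>\<Gamma>. U x - {\<one>})"
    proof (intro equalityI subsetI)
      fix g assume g: "g \<in> ?A"
      then obtain x where x: "Fix \<Omega> act g = {x}" by (auto simp: card_1_singleton_iff)
      then have "x \<in> \<Gamma>" "g \<in> U x - {\<one>}" using g by (auto simp: \<Gamma>_def Fix_def U_def)
      then show "g \<in> (\<Union>x\<in>\<Gamma>. U x - {\<one>})" by blast
    qed (auto simp: U_def)
    then have "card ?A = card (\<Union>x\<in>\<Gamma>. U x - {\<one>})" by simp
    also have "\<dots> = (\<Sum>x\<in>\<Gamma>. card (U x - {\<one>}))"
      by (rule card_UN_disjoint[OF finG]) (simp add: finite_U, auto simp: U_def)
    also have "\<dots> = (\<Sum>x\<in>\<Gamma>. q - 1)"
    proof (rule sum.cong[OF refl])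
      fix x assume "x \<in> \<Gamma>"
      then show "card (U x - {\<one>}) = q - 1"
        using Uq[of x] finite_U subgroup.one_closed[OF U_subgroup] by (simp add: Gamma_iff)
    qed
    finally have A: "card ?A = card \<Gamma> * (q - 1)" by simp
    have "card ?A = (\<Sum>g\<in>carrier G - {\<one>}. if card (Fix \<Omega> act g) = 1 then 1 else 0)"
      using sum.inter_filter[of "carrier G - {\<one>}" "\<lambda>_. 1 :: nat" "\<lambda>g. card (Fix \<Omega> act g) = 1"] finite_G by simp
    then have "(\<Sum>g\<in>carrier G - {\<one>}. card (Fix \<Omega> act g)) + card ?A =
        (\<Sum>g\<in>carrier G - {\<one>}. card (Fix \<Omega> act g) + (if card (Fix \<Omega> act g) = 1 then 1 else 0))"
      by (simp only: sum.distrib)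
    also have "\<dots> = (\<Sum>g\<in>carrier G - {\<one>}. 2)"
      by (rule sum.cong[OF refl]) (use fix12 in force)
    finally show ?thesis using A finite_G by simp
  qed
  \<comment> \<open>The contribution of the nonregular orbits other than \<Gamma>. The fixed point
    equation gives s = n - |\<Gamma>| (q - 2) - 2 < n with n = |G|. As each orbit contributes at
    least n / 2, there is at most one of them.\<close>
  define s where "s = (\<Sum>Y\<in>NR - {\<Gamma>}. ?n - card Y)"
  have "(\<Sum>Y\<in>NR. ?n - card Y) = (?n - card \<Gamma>) + s"
    unfolding s_def by (rule sum.remove[OF finite_NR GNR])
  then have s1: "?n - card \<Gamma> + s + card \<Gamma> * (q - 1) = 2 * (?n - 1)"
    using sum1 by (simp only: sum_fixed_points)
  have Gle: "2 * card \<Gamma> \<le> ?n" by (rule NR_card(2)[OF GNR x0])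
  have "card \<Gamma> * (q - 1) = card \<Gamma> * (q - 2) + card \<Gamma>"
  proof -
    have "q - 1 = (q - 2) + 1" using q2 by simp
    then show ?thesis by (simp only: distrib_left mult_1_right)
  qed
  then have s2: "s + card \<Gamma> * (q - 2) + 2 = ?n" using s1 Gle G2 by linarith
  have "card (NR - {\<Gamma>}) * ?n \<le> (\<Sum>Y\<in>NR - {\<Gamma>}. 2 * (?n - card Y))"
  proof -
    have "?n \<le> 2 * (?n - card Y)" if Y: "Y \<in> NR - {\<Gamma>}" for Y
    proof -
      have YN: "Y \<in> NR" using Y by blast
      then obtain y where y: "y \<in> Y" by (rule NR_nonempty)
      then show ?thesis using NR_card(2)[OF YN y] by linarith
    qed
    then show ?thesis using sum_mono[of "NR - {\<Gamma>}" "\<lambda>_. ?n" "\<lambda>Y. 2 * (?n - card Y)"] by simp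
  qed
  also have "\<dots> = 2 * s" by (simp add: s_def sum_distrib_left)
  also have "\<dots> < 2 * ?n" using s2 by linarith
  finally have k: "card (NR - {\<Gamma>}) < 2" by simp
  \<comment> \<open>Without another orbit the group order would be |\<Gamma>| (q - 2) + 2. This is
    less than |\<Gamma>| q, although the order is |\<Gamma>| q d.\<close>
  have "card (NR - {\<Gamma>}) \<noteq> 0"
  proof
    assume "card (NR - {\<Gamma>}) = 0"
    then have "NR - {\<Gamma>} = {}" using finite_NR by simp
    then have "s = 0" unfolding s_def by (simp only: sum.empty)
    then have "?n = card \<Gamma> * (q - 2) + 2" using s2 by simp
    moreover have "card \<Gamma> * q \<le> ?n" unfolding n using d1 by simp
    moreover have "card \<Gamma> * q = card \<Gamma> * (q - 2) + card \<Gamma> * 2"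
      using q2 by (simp add: diff_mult_distrib2)
    ultimately show False using G2 by linarith
  qed
  then have "card (NR - {\<Gamma>}) = 1" using k by linarith
  then obtain \<Delta> where \<Delta>: "NR - {\<Gamma>} = {\<Delta>}" by (rule card_1_singletonE)
  then have DNR: "\<Delta> \<in> NR" by blast
  obtain y where y: "y \<in> \<Delta>" using DNR by (rule NR_nonempty)
  have "s = ?n - card \<Delta>" unfolding s_def \<Delta> by simp
  then have Dcard: "card \<Delta> = card \<Gamma> * (q - 2) + 2" using s2 NR_card(2)[OF DNR y] by linarith
  also have "\<dots> = q * (m * (q - 2) + 1)"
  proof -
    obtain r where "q = r + 2" using q2 by (metis add.commute le_add_diff_inverse)
    then show ?thesis by (simp add: m algebra_simps)
  qed
  finally have Dcard: "card \<Delta> = q * (m * (q - 2) + 1)" .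
  obtain e where "card \<Delta> * e = ?n" using NR_stab_mult[OF DNR] by blast
  then have "q * ((m * (q - 2) + 1) * e) = q * (d * (1 + m * q))"
    unfolding Dcard n m by (simp only: mult_ac)
  then have e: "(m * (q - 2) + 1) * e = d * (1 + m * q)" using q2 by simp
  have dq: "d dvd q - 1" using index_dvd[OF x0] d unfolding q_def by simp
  have "3 \<le> q \<and> m = 1 \<and> (d = q - 1 \<or> 2 * d = q - 1) \<or> q = 3 \<and> m = 3 \<and> d = 2"
    by (rule modular_arith[OF q2 m1 d1 dq e]) (use NR_card(3)[OF DNR y] Dcard in simp)
  then have "3 \<le> q \<and> card \<Gamma> = q + 1 \<and> card \<Delta> = q * (q - 1) \<and> (d = q - 1 \<or> 2 * d = q - 1) \<or>
     q = 3 \<and> d = 2 \<and> card \<Gamma> = 10 \<and> card \<Delta> = 12"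
  proof
    assume c: "3 \<le> q \<and> m = 1 \<and> (d = q - 1 \<or> 2 * d = q - 1)"
    moreover from this have "q - 2 + 1 = q - 1" by linarith
    ultimately have "card \<Gamma> = q + 1" "card \<Delta> = q * (q - 1)" using m Dcard by simp_all
    then show ?thesis using c by simp
  qed (use m Dcard in simp)
  moreover have "p dvd q" using p_dvd_U[OF x0] by (simp add: q_def)
  ultimately show ?thesis by (intro that[OF GNR \<Delta> Uq stabq n])
qed

end

section \<open>Isomorphism types\<close>

context fp_action
begin

text \<open>The form in which the absence of orbits of length one and two is used below.\<close>

lemma no_small_invariant_set:
  assumes "S \<subseteq> \<Omega>" "S \<noteq> {}" "finite S" "card S \<le> 2" "\<And>x g. x \<in> S \<Longrightarrow> g \<in> carrier G \<Longrightarrow> act x g \<in> S"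
  shows False
proof -
  obtain x where x: "x \<in> S" using assms(2) by blast
  then have "orb x \<subseteq> S" using assms(5) by blast
  then have "card (orb x) \<le> card S" using assms(3) by (intro card_mono)
  then show False using large_orbits[of x] x assms(1,4) by auto
qed

lemma Fix_nonempty: "g \<in> carrier G \<Longrightarrow> g \<noteq> \<one> \<Longrightarrow> Fix \<Omega> act g \<noteq> {}"
  using fix12[of g] by auto

lemma card_Fix_le: "g \<in> carrier G \<Longrightarrow> g \<noteq> \<one> \<Longrightarrow> card (Fix \<Omega> act g) \<le> 2"
  using fix12[of g] by auto

text \<open>Otherwise the fixed point set of \<open>g\<close>, of one or two points, would be
  invariant under the whole group.\<close>

lemma Fix_not_normal:
  assumes g: "g \<in> carrier G" "g \<noteq> \<one>"
  shows "\<exists>h\<in>carrier G. Fix \<Omega> act (conjg g h) \<noteq> Fix \<Omega> act g"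
proof (rule ccontr)
  assume "\<not> ?thesis"
  then have inv: "Fix \<Omega> act (conjg g h) = Fix \<Omega> act g" if "h \<in> carrier G" for h using that by blast
  show False
  proof (rule no_small_invariant_set)
    fix x h assume "x \<in> Fix \<Omega> act g" "h \<in> carrier G"
    then show "act x h \<in> Fix \<Omega> act g" using Fix_conjg[OF g(1), of h] inv[of h] by blast
  qed (use g Fix_nonempty finite_Fix card_Fix_le in \<open>auto simp: Fix_def\<close>)
qed

lemma eq_one_of_many_fixed:
  assumes "g \<in> carrier G" "S \<subseteq> Fix \<Omega> act g" "2 < card S"
  shows "g = \<one>"
proof (rule ccontr)
  assume g: "g \<noteq> \<one>"
  then have "card S \<le> card (Fix \<Omega> act g)" using assms by (intro card_mono finite_Fix)
  then show False using card_Fix_le[OF assms(1) g] assms(3) by simp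
qed

lemma NR_subset: assumes "Y \<in> NR" shows "Y \<subseteq> \<Omega>"
  using NR_orb[OF assms] by blast

lemma NR_act: assumes Y: "Y \<in> NR" and y: "y \<in> Y" and g: "g \<in> carrier G" shows "act y g \<in> Y"
proof -
  have "Y = orb y" using NR_orb[OF Y y] by blast
  then show ?thesis using g by simp
qed

lemma prime_subgroup_subset:
  assumes H: "subgroup H G" "prime (card H)" and K: "subgroup K G" and g: "g \<in> H" "g \<in> K" "g \<noteq> \<one>"
  shows "H \<subseteq> K"
proof -
  have HK: "subgroup (H \<inter> K) G" using H(1) K by (rule subgroups_Inter_pair)
  have "finite H" using subgroup.subset[OF H(1)] finite_G by (rule finite_subset)
  then have fin: "finite (H \<inter> K)" by simp
  have "card {g, \<one>} \<le> card (H \<inter> K)"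
    using g subgroup.one_closed[OF HK] by (intro card_mono fin) simp
  then have "card (H \<inter> K) \<noteq> 1" using g by simp
  moreover have "card (H \<inter> K) dvd card H" by (rule subgroup_card_dvd[OF HK H(1)]) simp
  ultimately have "card (H \<inter> K) = card H" using H(2) by (auto simp: prime_nat_iff)
  then have "H \<inter> K = H" using \<open>finite H\<close> by (intro card_subset_eq) auto
  then show ?thesis by blast
qed

text \<open>A subgroup of prime order is contained in the stabilizer of any point that one of its
  nontrivial elements fixes.\<close>

lemma Fix_prime_subgroup:
  assumes H: "subgroup H G" "prime (card H)" and g: "g \<in> H" "g \<noteq> \<one>" and h: "h \<in> H" "h \<noteq> \<one>"
  shows "Fix \<Omega> act g = Fix \<Omega> act h"
proof -
  have "Fix \<Omega> act a \<subseteq> Fix \<Omega> act b" if a: "a \<in> H" "a \<noteq> \<one>" and b: "b \<in> H" for a b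
  proof
    fix x assume x: "x \<in> Fix \<Omega> act a"
    then have xO: "x \<in> \<Omega>" and "a \<in> stab x" using subgroup.subset[OF H(1)] a by (auto simp: Fix_def stab_iff)
    then have "H \<subseteq> stab x" using prime_subgroup_subset[OF H stab_subgroup[OF xO] a(1) _ a(2)] by simp
    then show "x \<in> Fix \<Omega> act b" using b xO by (auto simp: Fix_def stab_iff)
  qed
  then show ?thesis using g h by (intro equalityI)
qed

text \<open>The nontrivial elements share one fixed point set, which would be invariant if the
  subgroup were normal.\<close>

lemma no_normal_prime_subgroup:
  assumes H: "subgroup H G" "prime (card H)"
  shows "\<exists>x\<in>H. \<exists>g\<in>carrier G. conjg x g \<notin> H"
proof (rule ccontr)
  assume "\<not> ?thesis"
  then have norm: "conjg x g \<in> H" if "x \<in> H" "g \<in> carrier G" for x g using that by blast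
  have "\<not> H \<subseteq> {\<one>}"
  proof
    assume "H \<subseteq> {\<one>}"
    then have "card H \<le> card {\<one>}" by (intro card_mono) auto
    then show False using prime_gt_1_nat[OF H(2)] by simp
  qed
  then obtain g where g: "g \<in> H" "g \<noteq> \<one>" by blast
  then have gc: "g \<in> carrier G" using subgroup.subset[OF H(1)] by blast
  obtain h where h: "h \<in> carrier G" "Fix \<Omega> act (conjg g h) \<noteq> Fix \<Omega> act g" using Fix_not_normal[OF gc g(2)] by blast
  moreover have "conjg g h \<noteq> \<one>" using gc g h by simp
  ultimately show False using Fix_prime_subgroup[OF H g norm[OF g(1) h(1)]] by simp
qed

lemma orbit_action: "Y \<in> NR \<Longrightarrow> right_action G Y act"
  by (rule restrict_set[OF NR_subset NR_act])

text \<open>A nontrivial element fixes at most two of the four points, so the action on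
  \<open>Y\<close> embeds the group into Sym(4), with index two by its order.\<close>

lemma iso_alt_group_4:
  assumes n: "card (carrier G) = 12" and Y: "Y \<in> NR" "card Y = 4"
  shows "G \<cong> alt_group 4"
proof -
  interpret Y: right_action G Y act by (rule orbit_action[OF Y(1)])
  have "faithful_on G Y act"
    unfolding faithful_on_def
  proof (intro ballI impI)
    fix g assume g: "g \<in> carrier G" "\<forall>x\<in>Y. act x g = x"
    show "g = \<one>"
      by (rule eq_one_of_many_fixed[OF g(1), of Y]) (use g Y NR_subset[OF Y(1)] in \<open>auto simp: Fix_def\<close>)
  qed
  from Y.iso_alt_group[OF finite_NR_elem[OF Y(1)] this] show ?thesis using n Y by (simp add: fact_numeral)
qed

text \<open>On the orbit of length 8 the stabilizers have order 3, and both fixed points of their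
  nontrivial elements lie in that orbit. These pairs partition it into four, and the group acts on
  the set of pairs. A nontrivial kernel element interchanges the points of every pair, so there is
  at most one such element; it would be central, against \<open>Fix_not_normal\<close>.\<close>

lemma iso_sym_group_4:
  assumes n: "card (carrier G) = 24" and Y: "Y \<in> NR" "card Y = 8" and Gam: "\<Gamma> = {}"
    and other: "\<And>Z. Z \<in> NR \<Longrightarrow> Z \<noteq> Y \<Longrightarrow> card Z = 12 \<or> card Z = 6"
  shows "G \<cong> sym_group 4"
proof -
  have YO: "Y \<subseteq> \<Omega>" by (rule NR_subset[OF Y(1)])
  have st: "card (stab z) = 3" if "z \<in> Y" for z using NR_card(1)[OF Y(1) that] n Y by simp
  have three: "prime (3::nat)" by simp
  note two = card_Fix_no_unipotents[OF Gam]
  have cube: "g [^] (3::nat) = \<one>" if z: "z \<in> Y" and g: "g \<in> stab z" for g z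
    using subgroup_pow_card[OF stab_subgroup finite_stab g] z YO st[OF z] by auto
  \<comment> \<open>The stabilizer of a fixed point of an element of order 3 has order divisible by
    3, so the orbit length divides 24 / 3 = 8. This excludes 12 and 6.\<close>
  have Fix_Y: "Fix \<Omega> act g \<subseteq> Y" if z: "z \<in> Y" and g: "g \<in> stab z" "g \<noteq> \<one>" for g z
  proof
    fix x assume x: "x \<in> Fix \<Omega> act g"
    have gc: "g \<in> carrier G" using g by (simp add: stab_iff)
    have xO: "x \<in> \<Omega>" and gx: "g \<in> stab x" using x gc by (auto simp: Fix_def stab_iff)
    have xN: "x \<in> N" using xO gx g by (auto simp: N_def)
    have "3 dvd card (stab x)" by (rule prime_dvd_card_subgroup[OF stab_subgroup[OF xO] gx g(2) three cube[OF z g(1)]])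
    then obtain k where k: "card (stab x) = 3 * k" by (elim dvdE)
    have ox: "orb x \<in> NR" by (rule NR_I[OF xN])
    have "card (orb x) * (3 * k) = 24" using NR_card(1)[OF ox orb_self[OF xO]] n k by simp
    then have "8 = card (orb x) * k" by (simp add: mult.commute)
    then have "card (orb x) dvd 8" by (rule dvdI)
    then have "card (orb x) \<noteq> 12" "card (orb x) \<noteq> 6" by (auto intro!: notI)
    then have "orb x = Y" using other[OF ox] by blast
    then show "x \<in> Y" using orb_self[OF xO] by simp
  qed
  define S where "S = {Fix \<Omega> act g | g. g \<in> carrier G \<and> g \<noteq> \<one> \<and> Fix \<Omega> act g \<inter> Y \<noteq> {}}"
  have SE: "\<exists>g z. A = Fix \<Omega> act g \<and> g \<in> carrier G \<and> g \<noteq> \<one> \<and> z \<in> A \<and> z \<in> Y \<and> g \<in> stab z" if "A \<in> S" for A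
    using that unfolding S_def by (auto simp: Fix_def stab_iff)
  have S_Y: "A \<subseteq> Y" if "A \<in> S" for A using SE[OF that] Fix_Y by blast
  have S_two: "card A = 2" if "A \<in> S" for A using SE[OF that] two by blast
  \<comment> \<open>Both elements lie in the stabilizer of \<open>z\<close>, of prime order 3, so
    they have the same fixed points.\<close>
  have S_disj: "A = B" if A: "A \<in> S" and B: "B \<in> S" and z: "z \<in> A" "z \<in> B" for A B z
  proof -
    obtain g where g: "A = Fix \<Omega> act g" "g \<in> carrier G" "g \<noteq> \<one>" using SE[OF A] by blast
    obtain h where h: "B = Fix \<Omega> act h" "h \<in> carrier G" "h \<noteq> \<one>" using SE[OF B] by blast
    have zY: "z \<in> Y" using S_Y[OF A] z by blast
    then have zO: "z \<in> \<Omega>" using YO by blast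
    have "g \<in> stab z" "h \<in> stab z" using g h z by (auto simp: stab_iff Fix_def)
    then show ?thesis unfolding g(1) h(1) using g h st[OF zY] three
      by (intro Fix_prime_subgroup[OF stab_subgroup[OF zO]]) auto
  qed
  have S_cover: "\<exists>A\<in>S. z \<in> A" if z: "z \<in> Y" for z
  proof -
    have "z \<in> N" using NR_orb[OF Y(1) z] by blast
    then have zO: "z \<in> \<Omega>" "stab z \<noteq> {\<one>}" by (auto simp: N_def)
    then obtain g where "g \<in> stab z" "g \<noteq> \<one>" using one_in_stab[OF zO(1)] by blast
    then show ?thesis using z zO by (intro bexI[of _ "Fix \<Omega> act g"]) (auto simp: S_def Fix_def stab_iff)
  qed
  have finY: "finite Y" by (rule finite_NR_elem[OF Y(1)])
  have "S \<subseteq> Pow Y" using S_Y by blast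
  then have finS: "finite S" using finY by (simp add: finite_subset)
  have card_S: "card S = 4"
  proof -
    have "Y = (\<Union>A\<in>S. A)" using S_Y S_cover by blast
    also have "card \<dots> = (\<Sum>A\<in>S. card A)"
    proof (rule card_UN_disjoint[OF finS])
      show "\<forall>A\<in>S. finite A" using S_Y finY finite_subset by blast
      show "\<forall>A\<in>S. \<forall>B\<in>S. A \<noteq> B \<longrightarrow> A \<inter> B = {}" using S_disj by (meson disjoint_iff)
    qed
    also have "\<dots> = (\<Sum>A\<in>S. 2)" using S_two by (intro sum.cong) auto
    finally show ?thesis using Y(2) by simp
  qed
  let ?sact = "\<lambda>A h. (\<lambda>x. act x h) ` A"
  have S_act: "?sact A h \<in> S" if A: "A \<in> S" and h: "h \<in> carrier G" for A h
  proof -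
    obtain g z where g: "A = Fix \<Omega> act g" "g \<in> carrier G" "g \<noteq> \<one>" "z \<in> A" "z \<in> Y" using SE[OF A] by blast
    have "?sact A h = Fix \<Omega> act (conjg g h)" using Fix_conjg[OF g(2) h] g(1) by simp
    moreover have "act z h \<in> ?sact A h" "act z h \<in> Y" using g(4,5) NR_act[OF Y(1) _ h] by auto
    moreover have "conjg g h \<in> carrier G" "conjg g h \<noteq> \<one>" using g(2,3) h by simp_all
    ultimately show ?thesis unfolding S_def
      by (intro CollectI exI[of _ "conjg g h"] conjI) auto
  qed
  interpret S: right_action G S ?sact
  proof (unfold_locales)
    fix A assume A: "A \<in> S"
    have AO: "A \<subseteq> \<Omega>" using S_Y[OF A] YO by blast
    then show "?sact A \<one> = A" by (force simp: act_one image_iff)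
    fix g h assume "g \<in> carrier G" "h \<in> carrier G"
    then show "?sact A (g \<otimes> h) = ?sact (?sact A g) h"
      using AO by (force simp: image_image act_mult intro!: image_cong)
  qed (rule S_act)
  define K where "K = {g \<in> carrier G. \<forall>A\<in>S. ?sact A g = A}"
  have K_mem: "act x g \<in> A" if "g \<in> K" "A \<in> S" "x \<in> A" for g A x
  proof -
    have "?sact A g = A" using that(1,2) by (simp add: K_def)
    then show ?thesis using imageI[OF that(3), of "\<lambda>x. act x g"] by simp
  qed
  have K_sq: "act (act z g) h = z" if g: "g \<in> K" "g \<noteq> \<one>" and h: "h \<in> K" "h \<noteq> \<one>"
    and gh: "\<And>y. y \<in> Y \<Longrightarrow> act y g \<noteq> y" "\<And>y. y \<in> Y \<Longrightarrow> act y h \<noteq> y" and z: "z \<in> Y" for z g h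
  proof -
    obtain A where A: "A \<in> S" "z \<in> A" using S_cover[OF z] by blast
    obtain a b where "A = {a, b}" using S_two[OF A(1)] by (auto simp: card_2_iff)
    then obtain y where y: "A = {z, y}" using A(2) by blast
    have yY: "y \<in> Y" using S_Y[OF A(1)] y by blast
    have "act z g \<in> {z, y}" using K_mem[OF g(1) A] y by simp
    then have "act z g = y" using gh(1)[OF z] by simp
    moreover have "act y h \<in> {z, y}" using K_mem[OF h(1) A(1), of y] y by simp
    then have "act y h = z" using gh(2)[OF yY] by simp
    ultimately show ?thesis by simp
  qed
  \<comment> \<open>A kernel element that fixes a point of \<open>Y\<close> has trivial cube, while
    its square fixes both points of every pair; hence it is trivial.\<close>
  have K_fpf: "act z g \<noteq> z" if g: "g \<in> K" "g \<noteq> \<one>" and z: "z \<in> Y" for g z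
  proof
    assume fx: "act z g = z"
    have gc: "g \<in> carrier G" using g by (simp add: K_def)
    have "g \<in> stab z" using fx gc by (simp add: stab_iff)
    then have cub: "g [^] (3::nat) = \<one>" by (rule cube[OF z])
    have "act (act y g) g = y" if y: "y \<in> Y" for y
    proof -
      obtain A where A: "A \<in> S" "y \<in> A" using S_cover[OF y] by blast
      obtain a b where ab: "A = {a, b}" using S_two[OF A(1)] by (auto simp: card_2_iff)
      then obtain x where x: "A = {y, x}" using A(2) by blast
      then have xY: "x \<in> Y" using S_Y[OF A(1)] by blast
      have "act y g \<in> {y, x}" "act x g \<in> {y, x}" using K_mem[OF g(1) A(1)] x by simp_all
      moreover have "act y g = act x g \<longleftrightarrow> y = x" using act_eq_iff[of y x g] xY y YO gc by auto
      ultimately show ?thesis by auto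
    qed
    then have "Y \<subseteq> Fix \<Omega> act (g \<otimes> g)" using gc YO by (auto simp: Fix_def act_mult)
    then have "g \<otimes> g = \<one>" using gc Y(2) by (intro eq_one_of_many_fixed[of _ Y]) auto
    then have "g = \<one>" using cub gc by (simp add: numeral_3_eq_3)
    then show False using g by simp
  qed
  \<comment> \<open>The product of two nontrivial kernel elements, possibly equal, fixes all of
    \<open>Y\<close> and is trivial; so both are the inverse of \<open>g\<close>.\<close>
  have K_uniq: "g = h" if g: "g \<in> K" "g \<noteq> \<one>" and h: "h \<in> K" "h \<noteq> \<one>" for g h
  proof -
    have c: "g \<in> carrier G" "h \<in> carrier G" using g h by (auto simp: K_def)
    have "g \<otimes> k = \<one>" if k: "k \<in> K" "k \<noteq> \<one>" for k
    proof (rule eq_one_of_many_fixed[of _ Y])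
      have kc: "k \<in> carrier G" using k by (simp add: K_def)
      show "Y \<subseteq> Fix \<Omega> act (g \<otimes> k)"
        using K_sq[OF g k K_fpf[OF g] K_fpf[OF k]] YO c kc by (auto simp: Fix_def act_mult)
      show "g \<otimes> k \<in> carrier G" using c kc by simp
    qed (use Y in simp)
    from this[OF g] this[OF h] have "g \<otimes> g = g \<otimes> h" by simp
    then show ?thesis using c by simp
  qed
  have K_conj: "conjg g h \<in> K" if g: "g \<in> K" and h: "h \<in> carrier G" for g h
  proof -
    have gc: "g \<in> carrier G" using g by (simp add: K_def)
    have "conjg g h \<in> S.stab A" if A: "A \<in> S" for A
    proof -
      have B: "?sact A (inv h) \<in> S" using A h by (intro S_act) simp_all
      then have "g \<in> S.stab (?sact A (inv h))" using g gc by (simp add: S.stab_iff K_def)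
      then have "conjg g h \<in> S.stab (?sact (?sact A (inv h)) h)" unfolding S.stab_act[OF B h] by blast
      then show ?thesis using S.act_inv_cancel(2)[OF A h] by simp
    qed
    then show ?thesis using gc h by (simp add: K_def S.stab_iff)
  qed
  have "faithful_on G S ?sact"
    unfolding faithful_on_def
  proof (intro ballI impI, rule ccontr)
    fix g assume g: "g \<in> carrier G" "\<forall>A\<in>S. ?sact A g = A" "g \<noteq> \<one>"
    then have gK: "g \<in> K" by (simp add: K_def)
    obtain h where h: "h \<in> carrier G" "Fix \<Omega> act (conjg g h) \<noteq> Fix \<Omega> act g"
      using Fix_not_normal[OF g(1,3)] by blast
    have "conjg g h = g" by (rule K_uniq[OF K_conj[OF gK h(1)] _ gK g(3)]) (use g h in simp)
    then show False using h by simp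
  qed
  from S.iso_sym_group[OF finS this] show ?thesis using card_S n by (simp add: fact_numeral)
qed

text \<open>An element of order 4 fixes some point, and its order divides that of the
  stabilizer.\<close>

lemma no_order_4:
  assumes no4: "\<And>x. x \<in> N \<Longrightarrow> \<not> 4 dvd card (stab x)"
    and g: "g \<in> carrier G" "g [^] (4::nat) = \<one>"
  shows "g \<otimes> g = \<one>"
proof (rule ccontr)
  assume gg: "g \<otimes> g \<noteq> \<one>"
  then have g1: "g \<noteq> \<one>" by auto
  obtain x where x: "x \<in> Fix \<Omega> act g" using Fix_nonempty[OF g(1) g1] by blast
  then have xO: "x \<in> \<Omega>" and gx: "g \<in> stab x" using g by (auto simp: Fix_def stab_iff)
  have xN: "x \<in> N" using xO gx g1 by (auto simp: N_def)
  have "ord g dvd 4" using g pow_eq_id by blast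
  moreover have "\<not> ord g dvd 2" using g gg pow_eq_id[of g 2] by (simp add: numeral_2_eq_2)
  ultimately have "ord g = 4"
  proof -
    have "ord g dvd 2 ^ 2" using \<open>ord g dvd 4\<close> by simp
    then obtain i where "i \<le> 2" "ord g = 2 ^ i" using divides_primepow_nat[of 2 "ord g" 2] by auto
    moreover have "i \<noteq> 0" using \<open>\<not> ord g dvd 2\<close> \<open>ord g = 2 ^ i\<close> by (intro notI) simp
    moreover have "i \<noteq> 1" using \<open>\<not> ord g dvd 2\<close> \<open>ord g = 2 ^ i\<close> by (intro notI) simp
    ultimately have "i = 2" by linarith
    then show ?thesis using \<open>ord g = 2 ^ i\<close> by simp
  qed
  moreover have "g [^] card (stab x) = \<one>"
    by (rule subgroup_pow_card[OF stab_subgroup[OF xO] finite_stab gx])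
  ultimately have "4 dvd card (stab x)" using pow_eq_id[OF g(1), of "card (stab x)"] by simp
  then show False using no4[OF xN] by simp
qed

text \<open>By \<open>cT\<close> there are 30 pairs of an involution and a point of \<open>Y\<close>
  fixed by it. Each involution has two fixed points, both in \<open>Y\<close>, so there are 15
  involutions. They are conjugate because a fixed point of one can be moved to a fixed point of the
  other, where \<open>conj\<close> applies.\<close>

lemma iso_alt_group_5_criterion:
  fixes T
  defines "T \<equiv> {t \<in> carrier G. t \<noteq> \<one> \<and> t \<otimes> t = \<one>}"
  assumes n: "card (carrier G) = 60" and Y: "Y \<in> NR"
    and cT: "\<And>z. z \<in> Y \<Longrightarrow> card Y * card (stab z \<inter> T) = 30"
    and FixT: "\<And>t. t \<in> T \<Longrightarrow> card (Fix \<Omega> act t) = 2 \<and> Fix \<Omega> act t \<subseteq> Y"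
    and conj: "\<And>z s t. z \<in> Y \<Longrightarrow> s \<in> stab z \<inter> T \<Longrightarrow> t \<in> stab z \<inter> T \<Longrightarrow> \<exists>g\<in>carrier G. conjg s g = t"
    and no4: "\<And>x. x \<in> N \<Longrightarrow> \<not> 4 dvd card (stab x)"
  shows "G \<cong> alt_group 5"
proof (rule iso_alt_group_5[folded T_def])
  have finT: "finite T" using finite_G by (simp add: T_def)
  have finY: "finite Y" by (rule finite_NR_elem[OF Y])
  have YO: "Y \<subseteq> \<Omega>" by (rule NR_subset[OF Y])
  have "(\<Sum>t\<in>T. card (Fix \<Omega> act t \<inter> Y)) = (\<Sum>z\<in>Y. card (stab z \<inter> T))"
    by (rule double_count[OF finT finY _ YO]) (simp add: T_def)
  moreover have "(\<Sum>t\<in>T. card (Fix \<Omega> act t \<inter> Y)) = (\<Sum>t\<in>T. 2)"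
    using FixT by (intro sum.cong refl) (simp add: Int_absorb2)
  moreover have "(\<Sum>z\<in>Y. card (stab z \<inter> T)) = 30"
  proof -
    obtain y where y: "y \<in> Y" using Y by (rule NR_nonempty)
    have "card Y \<noteq> 0" using cT[OF y] by (intro notI) simp
    then have "card (stab z \<inter> T) = card (stab y \<inter> T)" if "z \<in> Y" for z
    proof -
      have "card Y * card (stab z \<inter> T) = card Y * card (stab y \<inter> T)" using cT[OF that] cT[OF y] by simp
      then show ?thesis using \<open>card Y \<noteq> 0\<close> by simp
    qed
    then show ?thesis using cT[OF y] by simp
  qed
  ultimately show "card T = 15" by simp
  show "card (carrier G) = 60" by (rule n)
  show "\<exists>g\<in>carrier G. conjg s g = t" if s: "s \<in> T" and t: "t \<in> T" for s t
  proof -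
    have c: "s \<in> carrier G" "t \<in> carrier G" using s t by (simp_all add: T_def)
    have "Fix \<Omega> act s \<noteq> {}" "Fix \<Omega> act t \<noteq> {}" using FixT[OF s] FixT[OF t] by auto
    then obtain x y where x: "x \<in> Fix \<Omega> act s" and y: "y \<in> Fix \<Omega> act t" by blast
    have xY: "x \<in> Y" and yY: "y \<in> Y" using FixT[OF s] FixT[OF t] x y by auto
    have "Y = orb x" using NR_orb[OF Y xY] by blast
    then obtain g where g: "g \<in> carrier G" "y = act x g" using yY by blast
    have "conjg s g \<in> stab y" using x c unfolding g(2) stab_act[OF subsetD[OF YO xY] g(1)]
      by (auto simp: Fix_def stab_iff)
    moreover have "conjg s g \<in> T" using s g(1) by (simp add: T_def flip: conjg_mult_left)
    moreover have "t \<in> stab y" using y c by (simp add: Fix_def stab_iff)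
    ultimately obtain h where h: "h \<in> carrier G" "conjg (conjg s g) h = t" using conj[OF yY, of "conjg s g" t] t by blast
    then show ?thesis using g c by (intro bexI[of _ "g \<otimes> h"]) (simp_all add: conjg_mult_right)
  qed
  show "g \<otimes> g = \<one>" if "g \<in> carrier G" "g [^] (4::nat) = \<one>" for g
    by (rule no_order_4[OF no4 that])
  show "\<exists>x\<in>H. \<exists>g\<in>carrier G. conjg x g \<notin> H" if "subgroup H G" "card H = 3" for H
    using that by (intro no_normal_prime_subgroup) simp_all
qed

lemma faithful: "faithful_on G \<Omega> act"
  unfolding faithful_on_def
proof (intro ballI impI)
  fix g assume g: "g \<in> carrier G" "\<forall>x\<in>\<Omega>. act x g = x"
  obtain x where x: "x \<in> \<Omega>" using nonempty by blast
  have "\<Omega> \<subseteq> Fix \<Omega> act g" using g(2) by (auto simp: Fix_def)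
  then have "orb x \<subseteq> Fix \<Omega> act g" using orb_subset[OF x] by blast
  then show "g = \<one>" by (rule eq_one_of_many_fixed[OF g(1) _ large_orbits[OF x]])
qed

text \<open>The stabilizers have order 2 on \<open>Y\<close> and order 3 or 5 on the other
  nonregular orbits. So each point of \<open>Y\<close> is fixed by a single involution, and
  involutions fix no other points.\<close>

lemma iso_alt_group_5_no_unipotents:
  assumes Gam: "\<Gamma> = {}" and n: "card (carrier G) = 60" and Y: "Y \<in> NR" "card Y = 30"
    and other: "\<And>Z. Z \<in> NR \<Longrightarrow> Z \<noteq> Y \<Longrightarrow> card Z = 20 \<or> card Z = 12"
  shows "G \<cong> alt_group 5"
proof (rule iso_alt_group_5_criterion[OF n Y(1)])
  let ?T = "{t \<in> carrier G. t \<noteq> \<one> \<and> t \<otimes> t = \<one>}"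
  have YO: "Y \<subseteq> \<Omega>" by (rule NR_subset[OF Y(1)])
  have st: "x \<in> Y \<Longrightarrow> card (stab x) = 2" "x \<notin> Y \<Longrightarrow> card (stab x) = 3 \<or> card (stab x) = 5"
    if x: "x \<in> N" for x
  proof -
    have xO: "x \<in> \<Omega>" using x by (simp add: N_def)
    have c: "card (orb x) * card (stab x) = 60" using NR_card(1)[OF NR_I[OF x] orb_self[OF xO]] n by simp
    show "card (stab x) = 2" if "x \<in> Y" using NR_orb[OF Y(1) that] c Y(2) by simp
    assume "x \<notin> Y"
    then have "orb x \<noteq> Y" using orb_self[OF xO] by blast
    then show "card (stab x) = 3 \<or> card (stab x) = 5" using other[OF NR_I[OF x]] c by auto
  qed
  have YN: "Y \<subseteq> N" using NR_orb[OF Y(1)] by blast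
  have stY: "card (stab z) = 2" if z: "z \<in> Y" for z using st(1)[OF subsetD[OF YN z] z] .
  have stY1: "card (stab z - {\<one>}) = 1" if z: "z \<in> Y" for z
    using stY[OF z] one_in_stab[OF subsetD[OF YO z]] finite_stab by simp
  have T_stab: "stab z \<inter> ?T = stab z - {\<one>}" if z: "z \<in> Y" for z
  proof -
    have zO: "z \<in> \<Omega>" using z YO by blast
    have "g \<otimes> g = \<one>" if g: "g \<in> stab z" for g
    proof -
      have "g \<in> carrier G" using g by (simp add: stab_iff)
      then show ?thesis using subgroup_pow_card[OF stab_subgroup[OF zO] finite_stab g] stY[OF z]
        by (simp add: numeral_2_eq_2)
    qed
    then show ?thesis by (auto simp: stab_iff)
  qed
  show "card Y * card (stab z \<inter> ?T) = 30" if z: "z \<in> Y" for z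
    unfolding T_stab[OF z] stY1[OF z] Y(2) by simp
  show "\<exists>g\<in>carrier G. conjg s g = t" if z: "z \<in> Y" and "s \<in> stab z \<inter> ?T" "t \<in> stab z \<inter> ?T" for z s t
  proof -
    obtain r where "stab z - {\<one>} = {r}" using stY1[OF z] by (rule card_1_singletonE)
    then have "s = t" using that(2,3) T_stab[OF z] by simp
    then show ?thesis using that(2) by (intro bexI[of _ "\<one>"]) auto
  qed
  show "card (Fix \<Omega> act t) = 2 \<and> Fix \<Omega> act t \<subseteq> Y" if t: "t \<in> ?T" for t
  proof
    have tc: "t \<in> carrier G" "t \<noteq> \<one>" using t by simp_all
    show "card (Fix \<Omega> act t) = 2" by (rule card_Fix_no_unipotents[OF Gam tc])
    show "Fix \<Omega> act t \<subseteq> Y"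
    proof (rule subsetI, rule ccontr)
      fix x assume x: "x \<in> Fix \<Omega> act t" "x \<notin> Y"
      then have xO: "x \<in> \<Omega>" and tx: "t \<in> stab x" using tc by (auto simp: Fix_def stab_iff)
      then have xN: "x \<in> N" using tc by (auto simp: N_def)
      have "2 dvd card (stab x)"
        by (rule prime_dvd_card_subgroup[OF stab_subgroup[OF xO] tx tc(2) two_is_prime_nat])
          (use t in \<open>auto simp: numeral_2_eq_2\<close>)
      then show False using st(2)[OF xN x(2)] by auto
    qed
  qed
  show "\<not> 4 dvd card (stab x)" if x: "x \<in> N" for x
    using st[OF x] by (cases "x \<in> Y") auto
qed

theorem platonic_no_unipotents:
  assumes "\<Gamma> = {}"
  shows "platonic G \<Omega> act"
proof -
  obtain A B C where NR: "NR = {A, B, C}" "A \<noteq> B" "A \<noteq> C" "B \<noteq> C"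
    and c: "(card (carrier G), card A, card B, card C) \<in> {(12, 6, 4, 4), (24, 12, 8, 6), (60, 30, 20, 12)}"
    using orbits_no_unipotents[OF assms] by blast
  have mset: "image_mset card (mset_set NR) = {#card A, card B, card C#}" "card NR = 3"
    using NR by (simp_all add: numeral_3_eq_3)
  from c consider "card (carrier G) = 12" "card A = 6" "card B = 4" "card C = 4"
    | "card (carrier G) = 24" "card A = 12" "card B = 8" "card C = 6"
    | "card (carrier G) = 60" "card A = 30" "card B = 20" "card C = 12" by auto
  then show ?thesis
  proof cases
    case 1
    then have "G \<cong> alt_group 4" using NR by (intro iso_alt_group_4[of B]) auto
    then show ?thesis using 1 mset faithful right_action_axioms by (simp add: platonic_def)
  next
    case 2
    then have "G \<cong> sym_group 4" using NR assms by (intro iso_sym_group_4[of B]) auto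
    then show ?thesis using 2 mset faithful right_action_axioms by (simp add: platonic_def)
  next
    case 3
    then have "G \<cong> alt_group 5" using NR assms by (intro iso_alt_group_5_no_unipotents[of A]) auto
    then show ?thesis using 3 mset faithful right_action_axioms by (simp add: platonic_def)
  qed
qed

text \<open>A point of \<Gamma> has a stabilizer of order 6, made up of \<open>U\<close> of order 3
  and three involutions, and 10 times 3 is the required count of 30. On \<Delta> the stabilizers
  have order 60 / 12 = 5. The last three claims feed the coordinate computation for the exceptional
  group.\<close>

theorem iso_alt_group_5_exceptional:
  assumes G: "\<Gamma> \<in> NR" "NR - {\<Gamma>} = {\<Delta>}" "card (carrier G) = 60" "card \<Gamma> = 10" "card \<Delta> = 12"
    and Ux: "\<And>x. x \<in> \<Gamma> \<Longrightarrow> card (U x) = 3" and Sx: "\<And>x. x \<in> \<Gamma> \<Longrightarrow> card (stab x) = 6"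
  shows "G \<cong> alt_group 5"
    and "\<And>z t. z \<in> \<Gamma> \<Longrightarrow> t \<in> stab z - U z \<Longrightarrow> t \<otimes> t = \<one>"
    and "\<And>t. t \<in> carrier G \<Longrightarrow> t \<noteq> \<one> \<Longrightarrow> t \<otimes> t = \<one> \<Longrightarrow> card (Fix \<Omega> act t) = 2 \<and> Fix \<Omega> act t \<subseteq> \<Gamma>"
    and "\<And>g. g \<in> carrier G \<Longrightarrow> g [^] (4::nat) = \<one> \<Longrightarrow> g \<otimes> g = \<one>"
proof -
  let ?T = "{t \<in> carrier G. t \<noteq> \<one> \<and> t \<otimes> t = \<one>}"
  have GO: "\<Gamma> \<subseteq> \<Omega>" by (rule NR_subset[OF G(1)])
  have st: "card (stab x) = 5" if x: "x \<in> N" "x \<notin> \<Gamma>" for x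
  proof -
    have xO: "x \<in> \<Omega>" using x by (simp add: N_def)
    have "orb x \<noteq> \<Gamma>" using orb_self[OF xO] x by blast
    then have "orb x \<in> {\<Delta>}" using NR_I[OF x(1)] unfolding G(2)[symmetric] by blast
    then show ?thesis using NR_card(1)[OF NR_I[OF x(1)] orb_self[OF xO]] G(3,5) by simp
  qed
  have U_cube: "g \<otimes> (g \<otimes> g) = \<one>" if z: "z \<in> \<Gamma>" and g: "g \<in> U z" for g z
  proof -
    have zO: "z \<in> \<Omega>" using z GO by blast
    have gc: "g \<in> carrier G" using g U_subset by blast
    have "g [^] (3::nat) = \<one>" using subgroup_pow_card[OF U_subgroup[OF zO] finite_U g] unfolding Ux[OF z] .
    then show ?thesis using gc by (simp add: numeral_3_eq_3 m_assoc)
  qed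
  have FixT: "card (Fix \<Omega> act t) = 2 \<and> Fix \<Omega> act t \<subseteq> \<Gamma>" if t: "t \<in> ?T" for t
  proof
    have tc: "t \<in> carrier G" "t \<noteq> \<one>" using t by simp_all
    show "card (Fix \<Omega> act t) = 2"
    proof (rule ccontr)
      assume "card (Fix \<Omega> act t) \<noteq> 2"
      then have "card (Fix \<Omega> act t) = 1" using fix12[OF tc] by blast
      then obtain x where x: "Fix \<Omega> act t = {x}" by (rule card_1_singletonE)
      then have "x \<in> \<Gamma>" "t \<in> U x" using tc by (auto simp: \<Gamma>_def Fix_def U_def)
      then have "t \<otimes> (t \<otimes> t) = \<one>" by (rule U_cube)
      then show False using t by simp
    qed
    show "Fix \<Omega> act t \<subseteq> \<Gamma>"
    proof (rule subsetI, rule ccontr)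
      fix x assume x: "x \<in> Fix \<Omega> act t" "x \<notin> \<Gamma>"
      then have xO: "x \<in> \<Omega>" and tx: "t \<in> stab x" using tc by (auto simp: Fix_def stab_iff)
      then have xN: "x \<in> N" using tc by (auto simp: N_def)
      have "2 dvd card (stab x)"
        by (rule prime_dvd_card_subgroup[OF stab_subgroup[OF xO] tx tc(2) two_is_prime_nat])
          (use t in \<open>auto simp: numeral_2_eq_2\<close>)
      then show False using st[OF xN x(2)] by simp
    qed
  qed
  \<comment> \<open>As \<open>U z\<close> has index two in the stabilizer, the square of
    \<open>t\<close> lies in it. But \<open>t\<close> has a second fixed point, which its square
    also fixes, so the square is trivial.\<close>
  have sq: "t \<otimes> t = \<one>" if z: "z \<in> \<Gamma>" and t: "t \<in> stab z - U z" for z t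
  proof -
    have zO: "z \<in> \<Omega>" using z GO by blast
    have tc: "t \<in> carrier G" "t \<noteq> \<one>" using t by (auto simp: stab_iff U_def)
    interpret St: group "G\<lparr>carrier := stab z\<rparr>" by (rule subgroup_imp_group[OF stab_subgroup[OF zO]])
    have "subgroup (U z) (G\<lparr>carrier := stab z\<rparr>)"
      by (rule subgroup_incl[OF U_subgroup[OF zO] stab_subgroup[OF zO] U_stab[OF zO]])
    then have tt: "t \<otimes> t \<in> U z"
      using St.square_in_index_two[of "U z" t] t Ux[OF z] Sx[OF z] finite_stab by simp
    have zF: "z \<in> Fix \<Omega> act t" using t zO by (auto simp: stab_iff Fix_def)
    have "Fix \<Omega> act t \<noteq> {z}" using t tc by (auto simp: U_def)
    then obtain y where y: "y \<in> Fix \<Omega> act t" "y \<noteq> z" using zF by blast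
    then have yO: "y \<in> \<Omega>" and "act y t = y" by (auto simp: Fix_def)
    then have "act y (t \<otimes> t) = y" using tc by (simp add: act_mult)
    then show ?thesis using U_free[OF tt _ yO] y(2) by blast
  qed
  have T_stab: "stab z \<inter> ?T = stab z - U z" if z: "z \<in> \<Gamma>" for z
  proof -
    have zO: "z \<in> \<Omega>" using z GO by blast
    have "t \<notin> U z" if t: "t \<in> ?T" for t
    proof
      assume "t \<in> U z"
      then have "t \<otimes> (t \<otimes> t) = \<one>" by (rule U_cube[OF z])
      then show False using t by simp
    qed
    moreover have "\<one> \<in> U z" by (simp add: U_def)
    ultimately show ?thesis using sq[OF z] by (auto simp: stab_iff)
  qed
  have card_T_stab: "card (stab z \<inter> ?T) = 3" if z: "z \<in> \<Gamma>" for z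
  proof -
    have "z \<in> \<Omega>" using z GO by blast
    then show ?thesis unfolding T_stab[OF z]
      using card_Diff_subset[OF finite_U U_stab] Sx[OF z] Ux[OF z] by simp
  qed
  show "t \<otimes> t = \<one>" if "z \<in> \<Gamma>" "t \<in> stab z - U z" for z t
    by (rule sq[OF that])
  show "card (Fix \<Omega> act t) = 2 \<and> Fix \<Omega> act t \<subseteq> \<Gamma>" if "t \<in> carrier G" "t \<noteq> \<one>" "t \<otimes> t = \<one>" for t
    by (rule FixT) (use that in simp)
  have no4: "\<not> 4 dvd card (stab x)" if x: "x \<in> N" for x
    using st[OF x] Sx[of x] by (cases "x \<in> \<Gamma>") auto
  show "g \<otimes> g = \<one>" if g: "g \<in> carrier G" "g [^] (4::nat) = \<one>" for g
    by (rule no_order_4[OF no4 g])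
  show "G \<cong> alt_group 5"
  proof (rule iso_alt_group_5_criterion[OF G(3,1)])
    show "card \<Gamma> * card (stab z \<inter> ?T) = 30" if "z \<in> \<Gamma>" for z
      using card_T_stab[OF that] G(4) by simp
    fix z s t assume z: "z \<in> \<Gamma>" and s: "s \<in> stab z \<inter> ?T" and t: "t \<in> stab z \<inter> ?T"
    have zO: "z \<in> \<Omega>" using z GO by blast
    have sc: "s \<in> carrier G" using s by simp
    \<comment> \<open>Within the stabilizer only elements of \<open>U z\<close> commute with a
      nontrivial element of \<open>U z\<close>, so the three elements of \<open>U z\<close> give
      three different conjugates of \<open>s\<close>. These are all involutions of the
      stabilizer.\<close>
    have inj: "inj_on (conjg s) (U z)"
    proof (rule inj_onI)
      fix u v assume u: "u \<in> U z" and v: "v \<in> U z" and eq: "conjg s u = conjg s v"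
      have c: "u \<in> carrier G" "v \<in> carrier G" using u v U_subset by auto
      let ?w = "u \<otimes> inv v"
      have w: "?w \<in> U z" using u v U_subgroup[OF zO] by (simp add: subgroup.m_closed subgroup.m_inv_closed)
      have "conjg s ?w = s" using eq c sc by (simp add: conjg_mult_right)
      then have com: "?w \<otimes> s = s \<otimes> ?w" using conjg_eq_self_iff[OF sc, of ?w] c by simp
      have "?w = \<one>"
      proof (rule ccontr)
        assume "?w \<noteq> \<one>"
        then have "s \<in> U z" using centralizer_unipotent[OF zO w _ _ com] s by blast
        then show False using s T_stab[OF z] by blast
      qed
      then show "u = v" using inv_equality[of u "inv v"] c by simp
    qed
    have "conjg s ` U z \<subseteq> stab z \<inter> ?T"
    proof
      fix r assume "r \<in> conjg s ` U z"
      then obtain u where u: "u \<in> U z" "r = conjg s u" by blast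
      then have us: "u \<in> stab z" using U_stab[OF zO] by blast
      have uc: "u \<in> carrier G" using u U_subset by blast
      have "r \<in> stab z" unfolding u(2) conjg_def using s us stab_subgroup[OF zO]
        by (simp add: subgroup.m_closed subgroup.m_inv_closed)
      moreover have "r \<in> ?T" unfolding u(2) using s uc by (simp flip: conjg_mult_left)
      ultimately show "r \<in> stab z \<inter> ?T" by blast
    qed
    then have "conjg s ` U z = stab z \<inter> ?T"
      by (rule card_subset_eq[rotated]) (simp_all add: finite_stab card_image[OF inj] card_T_stab[OF z] Ux[OF z])
    then have "t \<in> conjg s ` U z" using t by simp
    then obtain u where u: "u \<in> U z" "t = conjg s u" by blast
    then have "u \<in> carrier G" using U_subset by blast
    then show "\<exists>g\<in>carrier G. conjg s g = t" using u(2) by blast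
  next
    show "card (Fix \<Omega> act t) = 2 \<and> Fix \<Omega> act t \<subseteq> \<Gamma>" if "t \<in> ?T" for t by (rule FixT[OF that])
    show "\<not> 4 dvd card (stab x)" if "x \<in> N" for x by (rule no4[OF that])
  qed
qed

end

section \<open>Coordinates on the projective line\<close>

definition mat2 :: "'a::field \<Rightarrow> 'a \<Rightarrow> 'a \<Rightarrow> 'a \<Rightarrow> 'a^2^2"
  where "mat2 a b c d = vector [vector [a, b], vector [c, d]]"

lemma mat2_nth [simp]:
  "mat2 a b c d $ 1 $ 1 = a" "mat2 a b c d $ 1 $ 2 = b" "mat2 a b c d $ 2 $ 1 = c" "mat2 a b c d $ 2 $ 2 = d"
  by (simp_all add: mat2_def)

lemma mat2_eq_iff [simp]: "mat2 a b c d = mat2 a' b' c' d' \<longleftrightarrow> a = a' \<and> b = b' \<and> c = c' \<and> d = d'"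
  by (auto simp: vec_eq_iff forall_2)

lemma mat2_exhaust: obtains a b c d where "A = mat2 a b c d"
  by (rule that[of "A $ 1 $ 1" "A $ 1 $ 2" "A $ 2 $ 1" "A $ 2 $ 2"]) (simp add: vec_eq_iff forall_2)

lemma mat2_mult [simp]:
  "mat2 a b c d ** mat2 a' b' c' d' = mat2 (a * a' + b * c') (a * b' + b * d') (c * a' + d * c') (c * b' + d * d')"
  by (simp add: vec_eq_iff forall_2 matrix_matrix_mult_def sum_2)

lemma mat_eq_mat2: "mat k = mat2 k 0 0 k"
  by (simp add: vec_eq_iff forall_2 mat_def)

lemma det_mat2 [simp]: "det (mat2 a b c d) = a * d - b * c"
  by (simp add: det_2)

lemma invertible_mat2 [simp]: "invertible (mat2 a b c d) \<longleftrightarrow> a * d - b * c \<noteq> 0"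
  by (simp add: invertible_det_nz)

lemma vec2_eq_iff [simp]: "(vector [x, y] :: 'b::field^2) = vector [x', y'] \<longleftrightarrow> x = x' \<and> y = y'"
  by (auto simp: vec_eq_iff forall_2)

lemma vec2_exhaust: obtains x y where "(v :: 'b::field^2) = vector [x, y]"
  by (rule that[of "v $ 1" "v $ 2"]) (simp add: vec_eq_iff forall_2)

lemma zero_vec2: "(0 :: 'b::field^2) = vector [0, 0]"
  by (simp add: vec_eq_iff forall_2)

lemma scale_vec2: "c *s (vector [x, y] :: 'b::field^2) = vector [c * x, c * y]"
  by (simp add: vec_eq_iff forall_2)

lemma vec2_mat2: "(vector [x, y] :: 'b::field^2) v* mat2 a b c d = vector [x * a + y * c, x * b + y * d]"
  by (simp add: vec_eq_iff forall_2 vector_matrix_mult_def sum_2)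

section \<open>Moebius maps as classes of matrices\<close>

abbreviation PGL2_mult :: "('a::field^2^2) set \<Rightarrow> ('a^2^2) set \<Rightarrow> ('a^2^2) set" (infixl \<open>\<cdot>\<close> 70)
  where "g \<cdot> h \<equiv> g \<otimes>\<^bsub>PGL2\<^esub> h"

text \<open>As row vectors are multiplied from the right, this is the map x \<mapsto> (a x + c) / (b
  x + d): the translation part is \<open>c\<close>, and \<open>b = 0\<close> means that infinity is
  fixed.\<close>

definition mob :: "'a::field \<Rightarrow> 'a \<Rightarrow> 'a \<Rightarrow> 'a \<Rightarrow> ('a^2^2) set"
  where "mob a b c d = to_PGL2 (mat2 a b c d)"

lemma to_PGL2_mat2: "to_PGL2 (mat2 a b c d) = {mat2 (k * a) (k * b) (k * c) (k * d) | k. k \<noteq> 0}"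
  by (auto simp: to_PGL2_def r_coset_def group_center_GL2 mat_eq_mat2)

lemma mob_eq_iff: "mob a b c d = mob a' b' c' d' \<longleftrightarrow> (\<exists>k. k \<noteq> 0 \<and> a' = k * a \<and> b' = k * b \<and> c' = k * c \<and> d' = k * d)"
proof
  assume "mob a b c d = mob a' b' c' d'"
  moreover have "mat2 a' b' c' d' \<in> mob a' b' c' d'"
    unfolding mob_def to_PGL2_mat2 by (intro CollectI exI[of _ 1]) simp
  ultimately have "mat2 a' b' c' d' \<in> mob a b c d" by simp
  then show "\<exists>k. k \<noteq> 0 \<and> a' = k * a \<and> b' = k * b \<and> c' = k * c \<and> d' = k * d"
    unfolding mob_def to_PGL2_mat2 by auto
next
  assume "\<exists>k. k \<noteq> 0 \<and> a' = k * a \<and> b' = k * b \<and> c' = k * c \<and> d' = k * d"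
  then obtain k where k: "k \<noteq> 0" "a' = k * a" "b' = k * b" "c' = k * c" "d' = k * d" by blast
  have "\<exists>j'. j' \<noteq> 0 \<and> mat2 (j * a) (j * b) (j * c) (j * d) = mat2 (j' * (k * a)) (j' * (k * b)) (j' * (k * c)) (j' * (k * d))"
    if "j \<noteq> 0" for j
    using that k(1) by (intro exI[of _ "j / k"]) simp
  moreover have "\<exists>j'. j' \<noteq> 0 \<and> mat2 (j * (k * a)) (j * (k * b)) (j * (k * c)) (j * (k * d)) = mat2 (j' * a) (j' * b) (j' * c) (j' * d)"
    if "j \<noteq> 0" for j
    using that k(1) by (intro exI[of _ "j * k"]) simp
  ultimately show "mob a b c d = mob a' b' c' d'"
    unfolding mob_def to_PGL2_mat2 k(2-) by blast
qed

lemma mob_in_PGL2: "a * d - b * c \<noteq> 0 \<Longrightarrow> mob a b c d \<in> carrier PGL2"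
  by (simp add: mob_def carrier_PGL2)

lemma PGL2_exhaust:
  assumes "g \<in> carrier PGL2" obtains a b c d where "g = mob a b c d" "a * d - b * c \<noteq> 0"
proof -
  obtain A where A: "g = to_PGL2 A" "invertible A" using assms by (auto simp: carrier_PGL2)
  obtain a b c d where "A = mat2 a b c d" by (rule mat2_exhaust)
  then show ?thesis using A by (intro that[of a b c d]) (simp_all add: mob_def)
qed

lemma mob_mult:
  assumes "a * d - b * c \<noteq> 0" "a' * d' - b' * c' \<noteq> 0"
  shows "mob a b c d \<cdot> mob a' b' c' d' = mob (a * a' + b * c') (a * b' + b * d') (c * a' + d * c') (c * b' + d * d')"
  using to_PGL2_mult[of "mat2 a b c d" "mat2 a' b' c' d'"] assms by (simp add: mob_def)

lemma det_mult_nz: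
  fixes a b c d :: "'a::field"
  assumes "a * d - b * c \<noteq> 0" "a' * d' - b' * c' \<noteq> 0"
  shows "(a * a' + b * c') * (c * b' + d * d') - (a * b' + b * d') * (c * a' + d * c') \<noteq> 0"
proof -
  have "(a * a' + b * c') * (c * b' + d * d') - (a * b' + b * d') * (c * a' + d * c') = (a * d - b * c) * (a' * d' - b' * c')"
    by (simp add: algebra_simps)
  then show ?thesis using assms by simp
qed

lemma one_PGL2: "\<one>\<^bsub>PGL2\<^esub> = mob 1 0 0 1"
  by (simp add: mob_def mat_eq_mat2 flip: to_PGL2_one)

lemma mob_eq_one_iff: assumes "a * d - b * c \<noteq> 0" shows "mob a b c d = \<one>\<^bsub>PGL2\<^esub> \<longleftrightarrow> b = 0 \<and> c = 0 \<and> a = d"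
proof
  assume "b = 0 \<and> c = 0 \<and> a = d"
  then show "mob a b c d = \<one>\<^bsub>PGL2\<^esub>" using assms unfolding one_PGL2 mob_eq_iff
    by (intro exI[of _ "inverse a"]) auto
next
  assume "mob a b c d = \<one>\<^bsub>PGL2\<^esub>"
  then obtain k where "k \<noteq> 0" "1 = k * a" "0 = k * b" "0 = k * c" "1 = k * d"
    unfolding one_PGL2 mob_eq_iff by blast
  then show "b = 0 \<and> c = 0 \<and> a = d" by (metis mult_cancel_left no_zero_divisors)
qed

section \<open>Points of the projective line\<close>

abbreviation (input) pt :: "'b::field \<Rightarrow> ('b^2) set" where "pt s \<equiv> proj_pt s 1"
abbreviation (input) infpt :: "('b::field^2) set" where "infpt \<equiv> proj_pt 1 0"

lemma proj_pt_eq: "proj_pt x y = {vector [c * x, c * y] | c. True}"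
  by (auto simp: proj_pt_def vec.span_singleton scale_vec2)

lemma proj_pt_in_P1: assumes "x \<noteq> 0 \<or> y \<noteq> 0" shows "proj_pt x y \<in> P1"
proof -
  have "vector [x, y] \<noteq> (0 :: 'a^2)" using assms by (auto simp: zero_vec2)
  then have "vec.dim (proj_pt x y) = 1" unfolding proj_pt_def by (simp add: vec.dim_span_eq_card_independent)
  then show ?thesis by (simp add: P1_def proj_pt_def)
qed

lemma proj_pt_eq_iff:
  assumes "x \<noteq> 0 \<or> y \<noteq> 0" "x' \<noteq> 0 \<or> y' \<noteq> 0"
  shows "proj_pt x y = proj_pt x' y' \<longleftrightarrow> x * y' = x' * y"
proof
  assume "proj_pt x y = proj_pt x' y'"
  moreover have "vector [x', y'] \<in> proj_pt x' y'" unfolding proj_pt_eq by (intro CollectI exI[of _ 1]) simp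
  ultimately have "vector [x', y'] \<in> proj_pt x y" by simp
  then obtain c where "x' = c * x" "y' = c * y" unfolding proj_pt_eq by auto
  then show "x * y' = x' * y" by simp
next
  assume eq: "x * y' = x' * y"
  have "\<exists>k. k \<noteq> 0 \<and> x' = k * x \<and> y' = k * y"
  proof (cases "x = 0")
    case True
    then show ?thesis using assms eq by (intro exI[of _ "y' / y"]) auto
  next
    case False
    then show ?thesis using assms eq by (intro exI[of _ "x' / x"]) (auto simp: field_simps)
  qed
  then obtain k where k: "k \<noteq> 0" "x' = k * x" "y' = k * y" by blast
  have "\<exists>c'. vector [c * x, c * y] = (vector [c' * (k * x), c' * (k * y)] :: 'a^2)" for c
    using k(1) by (intro exI[of _ "c / k"]) simp
  moreover have "\<exists>c'. vector [c * (k * x), c * (k * y)] = (vector [c' * x, c' * y] :: 'a^2)" for c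
    by (intro exI[of _ "c * k"]) simp
  ultimately show "proj_pt x y = proj_pt x' y'" unfolding proj_pt_eq k(2,3) by blast
qed

lemma P1_exhaust_proj: assumes "p \<in> P1" obtains x y where "p = proj_pt x y" "x \<noteq> 0 \<or> y \<noteq> 0"
proof -
  have p: "vec.subspace p" "vec.dim p = 1" using assms by (auto simp: P1_def)
  obtain B where B: "B \<subseteq> p" "vec.independent B" "p \<subseteq> vec.span B" "card B = vec.dim p"
    using vec.basis_exists by blast
  then obtain v where v: "B = {v}" using p(2) by (metis card_1_singletonE)
  then have "p = vec.span {v}" using B p(1) by (metis vec.span_minimal subset_antisym)
  moreover have "v \<noteq> 0" using B(2) v by auto
  moreover obtain x y where "v = vector [x, y]" by (rule vec2_exhaust)
  ultimately show ?thesis by (intro that[of x y]) (auto simp: proj_pt_def zero_vec2)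
qed

lemma P1_cases [consumes 1]:
  assumes "p \<in> P1" obtains "p = infpt" | s where "p = pt s"
proof -
  obtain x y where xy: "p = proj_pt x y" "x \<noteq> 0 \<or> y \<noteq> 0" using assms by (rule P1_exhaust_proj)
  show ?thesis
  proof (cases "y = 0")
    case True
    then have "p = infpt" using xy by (simp add: proj_pt_eq_iff)
    then show ?thesis by (rule that(1))
  next
    case False
    then have "p = pt (x / y)" using xy by (simp add: proj_pt_eq_iff)
    then show ?thesis by (rule that(2))
  qed
qed

lemma pt_in_P1 [simp]: "pt s \<in> P1" "infpt \<in> P1"
  by (simp_all add: proj_pt_in_P1)

lemma pt_eq_iff [simp]: "pt s = pt t \<longleftrightarrow> s = t" "pt s \<noteq> infpt" "infpt \<noteq> pt s"
  by (simp_all add: proj_pt_eq_iff)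

lemma proj_pt_normal: "x \<noteq> 0 \<Longrightarrow> proj_pt x 0 = infpt" "y \<noteq> 0 \<Longrightarrow> proj_pt x y = pt (x / y)"
  by (simp_all add: proj_pt_eq_iff)

section \<open>The action on the line over the extension field\<close>

locale emb =
  fixes \<iota> :: "'a::field \<Rightarrow> 'b::field"
  assumes emb: "field_embedding \<iota>"
begin

lemmas emb_simps [simp] = embedding_simps[OF emb]

lemma emb_minus [simp]: "\<iota> (- x) = - \<iota> x"
  using emb_simps(1)[of x "- x"] by (simp add: eq_neg_iff_add_eq_0 add.commute)

lemma emb_diff [simp]: "\<iota> (x - y) = \<iota> x - \<iota> y"
  using emb_simps(1)[of x "- y"] by simp

lemma emb_eq_iff [simp]: "\<iota> x = \<iota> y \<longleftrightarrow> x = y"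
  using emb_simps(5)[of "x - y"] by simp

lemma emb_inverse [simp]: "\<iota> (inverse x) = inverse (\<iota> x)"
proof (cases "x = 0")
  case False
  then have "\<iota> x * \<iota> (inverse x) = 1" by (simp flip: emb_simps(2))
  then show ?thesis by (metis inverse_unique)
qed simp

lemma emb_divide [simp]: "\<iota> (x / y) = \<iota> x / \<iota> y"
  by (simp add: divide_inverse)

lemma emb_of_nat [simp]: "\<iota> (of_nat n) = of_nat n"
  by (induction n) simp_all

lemma emb_numeral [simp]: "\<iota> (numeral n) = numeral n"
  using emb_of_nat[of "numeral n"] by simp

lemma CHAR_eq: "CHAR('b) = CHAR('a)"
proof (rule CHAR_eqI)
  show "of_nat CHAR('a) = (0 :: 'b)" by (simp flip: emb_of_nat)
  show "CHAR('a) dvd n" if "of_nat n = (0 :: 'b)" for n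
    using that by (simp add: of_nat_eq_0_iff_char_dvd flip: emb_of_nat)
qed

abbreviation "pact \<equiv> P1_act \<iota>"

lemma det_nz: "a * d - b * c \<noteq> 0 \<Longrightarrow> \<iota> a * \<iota> d - \<iota> b * \<iota> c \<noteq> 0"
  by (simp flip: emb_simps(2) emb_diff)

lemma map_mat2: "map_matrix \<iota> (mat2 a b c d) = mat2 (\<iota> a) (\<iota> b) (\<iota> c) (\<iota> d)"
  by (simp add: vec_eq_iff forall_2 map_matrix_def)

lemma act_proj:
  assumes "x \<noteq> 0 \<or> y \<noteq> 0"
  shows "pact (proj_pt x y) (mob a b c d) = proj_pt (x * \<iota> a + y * \<iota> c) (x * \<iota> b + y * \<iota> d)"
  unfolding mob_def P1_act_to_PGL2[OF emb proj_pt_in_P1[OF assms]] map_mat2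
proof -
  have "(\<lambda>v. v v* mat2 (\<iota> a) (\<iota> b) (\<iota> c) (\<iota> d)) ` proj_pt x y =
      (\<lambda>k. vector [k * x, k * y] v* mat2 (\<iota> a) (\<iota> b) (\<iota> c) (\<iota> d)) ` UNIV"
    unfolding proj_pt_eq by blast
  also have "\<dots> = (\<lambda>k. vector [k * (x * \<iota> a + y * \<iota> c), k * (x * \<iota> b + y * \<iota> d)]) ` UNIV"
    by (simp add: vec2_mat2 algebra_simps)
  finally show "(\<lambda>v. v v* mat2 (\<iota> a) (\<iota> b) (\<iota> c) (\<iota> d)) ` proj_pt x y =
      proj_pt (x * \<iota> a + y * \<iota> c) (x * \<iota> b + y * \<iota> d)"
    unfolding proj_pt_eq by blast
qed

lemma act_nz:
  assumes xy: "x \<noteq> 0 \<or> y \<noteq> 0" and det: "a * d - b * c \<noteq> (0::'b)"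
  shows "x * a + y * c \<noteq> 0 \<or> x * b + y * d \<noteq> 0"
proof (rule ccontr)
  assume "\<not> ?thesis"
  then have 0: "x * a + y * c = 0" "x * b + y * d = 0" by auto
  have "x * (a * d - b * c) = (x * a + y * c) * d - (x * b + y * d) * c" by (simp add: algebra_simps)
  moreover have "y * (a * d - b * c) = (x * b + y * d) * a - (x * a + y * c) * b" by (simp add: algebra_simps)
  ultimately show False using 0 xy det by simp
qed

text \<open>The finite fixed points are the roots of b s^2 + (d - a) s - c; the form without
  division avoids a case distinction on the denominator.\<close>

lemma fix_pt_iff:
  assumes "a * d - b * c \<noteq> 0"
  shows "pact (pt s) (mob a b c d) = pt s \<longleftrightarrow> s * \<iota> a + \<iota> c = s * (s * \<iota> b + \<iota> d)"
  using act_nz[of s 1, OF _ det_nz[OF assms]] by (simp add: act_proj proj_pt_eq_iff)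

lemma fix_inf_iff:
  assumes "a * d - b * c \<noteq> 0"
  shows "pact infpt (mob a b c d) = infpt \<longleftrightarrow> b = 0"
  using act_nz[of 1 0, OF _ det_nz[OF assms]] by (auto simp: act_proj proj_pt_eq_iff)

lemma act_pt:
  assumes "a * d - b * c \<noteq> 0"
  shows "pact (pt s) (mob a b c d) = (if s * \<iota> b + \<iota> d = 0 then infpt else pt ((s * \<iota> a + \<iota> c) / (s * \<iota> b + \<iota> d)))"
proof (cases "s * \<iota> b + \<iota> d = 0")
  case True
  then show ?thesis using act_nz[of s 1, OF _ det_nz[OF assms]] proj_pt_normal(1)[of "s * \<iota> a + \<iota> c"] by (simp add: act_proj)
next
  case False
  then show ?thesis using proj_pt_normal(2)[OF False, of "s * \<iota> a + \<iota> c"] by (simp add: act_proj)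
qed

lemma act_inf:
  assumes "a * d - b * c \<noteq> 0"
  shows "pact infpt (mob a b c d) = (if b = 0 then infpt else pt (\<iota> a / \<iota> b))"
proof (cases "b = 0")
  case True
  then show ?thesis using act_nz[of 1 0, OF _ det_nz[OF assms]] proj_pt_normal(1)[of "\<iota> a"] by (simp add: act_proj)
next
  case False
  then show ?thesis using proj_pt_normal(2)[of "\<iota> b" "\<iota> a"] by (simp add: act_proj)
qed

text \<open>Subtracting the quadratic equations of two roots gives Vieta's relation b (s + t) = a -
  d. A third root, or infinity as a fixed point, forces b = 0, whence a = d and c = 0.\<close>

lemma fix_three_finite:
  assumes det: "a * d - b * c \<noteq> 0"
    and f: "pact (pt s) (mob a b c d) = pt s" "pact (pt t) (mob a b c d) = pt t" "s \<noteq> t"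
    and third: "pact infpt (mob a b c d) = infpt \<or> (\<exists>r. r \<noteq> s \<and> r \<noteq> t \<and> pact (pt r) (mob a b c d) = pt r)"
  shows "b = 0 \<and> c = 0 \<and> a = d"
proof -
  have lin: "\<iota> b * (x + y) = \<iota> a - \<iota> d"
    if "pact (pt x) (mob a b c d) = pt x" "pact (pt y) (mob a b c d) = pt y" "x \<noteq> y" for x y
  proof -
    have "x * \<iota> a + \<iota> c = x * (x * \<iota> b + \<iota> d)" "y * \<iota> a + \<iota> c = y * (y * \<iota> b + \<iota> d)"
      using that(1,2) fix_pt_iff[OF det] by simp_all
    then have "(x * \<iota> a + \<iota> c) - (y * \<iota> a + \<iota> c) = x * (x * \<iota> b + \<iota> d) - y * (y * \<iota> b + \<iota> d)" by simp
    then have "(x - y) * (\<iota> b * (x + y)) = (x - y) * (\<iota> a - \<iota> d)" by (simp add: algebra_simps)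
    then show ?thesis using that(3) by simp
  qed
  have b: "b = 0"
    using third
  proof
    assume "\<exists>r. r \<noteq> s \<and> r \<noteq> t \<and> pact (pt r) (mob a b c d) = pt r"
    then obtain r where r: "r \<noteq> s" "r \<noteq> t" "pact (pt r) (mob a b c d) = pt r" by blast
    have "\<iota> b * (s + t) = \<iota> b * (s + r)" using lin[OF f] lin[OF f(1) r(3)] r by simp
    then show "b = 0" using r by simp
  qed (simp add: fix_inf_iff[OF det])
  then have "a = d" using lin[OF f] by simp
  then show ?thesis using b f(1) fix_pt_iff[OF det] by simp
qed

lemma fix_three:
  assumes g: "g \<in> carrier PGL2" and p: "p \<in> P1" "q \<in> P1" "r \<in> P1" "p \<noteq> q" "p \<noteq> r" "q \<noteq> r"
    and f: "pact p g = p" "pact q g = q" "pact r g = r"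
  shows "g = \<one>\<^bsub>PGL2\<^esub>"
proof -
  obtain a b c d where m: "g = mob a b c d" "a * d - b * c \<noteq> 0" using g by (rule PGL2_exhaust)
  have main: ?thesis if "pact (pt s) g = pt s" "pact (pt t) g = pt t" "s \<noteq> t"
    "pact infpt g = infpt \<or> (\<exists>r. r \<noteq> s \<and> r \<noteq> t \<and> pact (pt r) g = pt r)" for s t
    using fix_three_finite[OF m(2), of s t] that unfolding m(1) mob_eq_one_iff[OF m(2)] by simp
  from p(1) show ?thesis
  proof (cases rule: P1_cases)
    case 1
    obtain s where s: "q = pt s" using p(2) 1 p(4) by (cases rule: P1_cases) auto
    obtain t where t: "r = pt t" using p(3) 1 p(5) by (cases rule: P1_cases) auto
    show ?thesis by (rule main[of s t]) (use f p 1 s t in auto)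
  next
    case (2 s)
    from p(2) show ?thesis
    proof (cases rule: P1_cases)
      case 1
      obtain t where t: "r = pt t" using p(3) 1 p(6) by (cases rule: P1_cases) auto
      show ?thesis by (rule main[of s t]) (use f p 1 2 t in auto)
    next
      case t: (2 t)
      from p(3) show ?thesis
      proof (cases rule: P1_cases)
        case 1
        show ?thesis by (rule main[of s t]) (use f p 1 2 t in auto)
      next
        case r: (2 u)
        show ?thesis by (rule main[of s t]) (use f p 2 t r in auto)
      qed
    qed
  qed
qed

lemma unip_pt_iff:
  assumes det: "a * d - b * c \<noteq> 0"
  shows "mob a b c d = \<one>\<^bsub>PGL2\<^esub> \<or> Fix P1 pact (mob a b c d) = {pt s} \<longleftrightarrow>
    \<iota> a - \<iota> d = 2 * s * \<iota> b \<and> \<iota> c = - (s * s * \<iota> b)" (is "?L \<longleftrightarrow> ?R")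
proof
  assume ?L
  then show ?R
  proof
    assume F: "Fix P1 pact (mob a b c d) = {pt s}"
    have "infpt \<notin> Fix P1 pact (mob a b c d)" unfolding F by simp
    then have b: "b \<noteq> 0" by (simp add: Fix_def fix_inf_iff[OF det])
    have "pt s \<in> Fix P1 pact (mob a b c d)" unfolding F by simp
    then have s: "s * \<iota> a + \<iota> c = s * (s * \<iota> b + \<iota> d)" by (simp add: Fix_def fix_pt_iff[OF det])
    \<comment> \<open>The other root, by Vieta's formula; it is a fixed point, so it equals
      \<open>s\<close>.\<close>
    define t where "t = (\<iota> a - \<iota> d) / \<iota> b - s"
    have "\<iota> b * ((\<iota> a - \<iota> d) / \<iota> b) = \<iota> a - \<iota> d" using b by simp
    then have bt: "\<iota> b * t = \<iota> a - \<iota> d - \<iota> b * s" by (simp only: t_def right_diff_distrib)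
    have c: "\<iota> c = s * (s * \<iota> b + \<iota> d) - s * \<iota> a" using s by (simp add: algebra_simps)
    have a: "\<iota> a = \<iota> b * t + \<iota> d + \<iota> b * s" using bt by (simp add: algebra_simps)
    have "t * \<iota> a + \<iota> c = t * (t * \<iota> b + \<iota> d)" by (simp add: c a algebra_simps)
    then have "pt t \<in> Fix P1 pact (mob a b c d)" by (simp add: Fix_def fix_pt_iff[OF det])
    then have "t = s" unfolding F by simp
    then show ?R using a c by (simp add: algebra_simps)
  qed (simp add: mob_eq_one_iff[OF det])
next
  assume R: ?R
  show ?L
  proof (cases "b = 0")
    case True
    then show ?thesis using R mob_eq_one_iff[OF det] by auto
  next
    case False
    have "x = pt s" if x: "x \<in> Fix P1 pact (mob a b c d)" for x
    proof -
      have "x \<in> P1" using x by (simp add: Fix_def)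
      then show ?thesis
      proof (cases rule: P1_cases)
        case 1
        then show ?thesis using x False by (simp add: Fix_def fix_inf_iff[OF det])
      next
        case (2 t)
        then have "t * \<iota> a + \<iota> c = t * (t * \<iota> b + \<iota> d)" using x by (simp add: Fix_def fix_pt_iff[OF det])
        moreover have "\<iota> b * ((t - s) * (t - s)) = t * (t * \<iota> b + \<iota> d) - (t * \<iota> a + \<iota> c)"
        proof -
          have a: "\<iota> a = \<iota> d + 2 * s * \<iota> b" using R by (simp add: algebra_simps)
          have c: "\<iota> c = - (s * s * \<iota> b)" using R by blast
          show ?thesis unfolding a c by (simp add: algebra_simps)
        qed
        ultimately have "\<iota> b * ((t - s) * (t - s)) = 0" by simp
        then show ?thesis using False 2 by simp
      qed
    qed
    moreover have "pt s \<in> Fix P1 pact (mob a b c d)"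
    proof -
      have a: "\<iota> a = \<iota> d + 2 * s * \<iota> b" using R by (simp add: algebra_simps)
      have c: "\<iota> c = - (s * s * \<iota> b)" using R by blast
      have "s * \<iota> a + \<iota> c = s * (s * \<iota> b + \<iota> d)" unfolding a c by (simp add: algebra_simps)
      then show ?thesis by (simp add: Fix_def fix_pt_iff[OF det])
    qed
    ultimately show ?thesis by blast
  qed
qed

lemma unip_inf_iff:
  assumes det: "a * d - b * c \<noteq> 0"
  shows "mob a b c d = \<one>\<^bsub>PGL2\<^esub> \<or> Fix P1 pact (mob a b c d) = {infpt} \<longleftrightarrow> a = d \<and> b = 0" (is "?L \<longleftrightarrow> ?R")
proof
  assume ?L
  then show ?R
  proof
    assume F: "Fix P1 pact (mob a b c d) = {infpt}"
    have "infpt \<in> Fix P1 pact (mob a b c d)" unfolding F by simp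
    then have b: "b = 0" by (simp add: Fix_def fix_inf_iff[OF det])
    have "a = d"
    proof (rule ccontr)
      assume "a \<noteq> d"
      \<comment> \<open>For a \<noteq> d the point - c / (a - d) would be a second fixed
        point.\<close>
      then obtain t where t: "t * (\<iota> a - \<iota> d) = - \<iota> c"
        by (metis emb_eq_iff nonzero_eq_divide_eq right_minus_eq)
      then have "t * \<iota> a + \<iota> c = t * \<iota> d" by (simp add: algebra_simps eq_neg_iff_add_eq_0)
      then have "pt t \<in> Fix P1 pact (mob a b c d)"
        using fix_pt_iff[OF det, of t] b by (simp add: Fix_def)
      then show False unfolding F by simp
    qed
    then show ?R using b by simp
  qed (simp add: mob_eq_one_iff[OF det])
next
  assume R: ?R
  show ?L
  proof (cases "c = 0")
    case False
    have "x = infpt" if x: "x \<in> Fix P1 pact (mob a b c d)" for x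
    proof -
      have "x \<in> P1" using x by (simp add: Fix_def)
      then show ?thesis
      proof (cases rule: P1_cases)
        case (2 t)
        then show ?thesis using x R False fix_pt_iff[OF det, of t] by (simp add: Fix_def)
      qed
    qed
    moreover have "infpt \<in> Fix P1 pact (mob a b c d)" using R fix_inf_iff[OF det] by (simp add: Fix_def)
    ultimately show ?thesis by blast
  next
    case True
    then show ?thesis using R mob_eq_one_iff[OF det] by auto
  qed
qed

text \<open>With the double eigenvalue l = d + s b the matrix is l plus a matrix Z with square zero,
  so its k-th power is l^k + k l^(k-1) Z. The relations record this for k = \<open>Suc n\<close>,
  which avoids the subtraction in the exponent.\<close>

lemma power_unip:
  assumes det: "a * d - b * c \<noteq> 0" and R: "\<iota> a - \<iota> d = 2 * s * \<iota> b" "\<iota> c = - (s * s * \<iota> b)"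
  shows "\<exists>a' b' c' d'. mob a b c d [^]\<^bsub>PGL2\<^esub> Suc n = mob a' b' c' d' \<and> a' * d' - b' * c' \<noteq> 0 \<and>
    \<iota> b' = of_nat (Suc n) * (\<iota> d + s * \<iota> b) ^ n * \<iota> b \<and> \<iota> c' = - (s * s * \<iota> b') \<and>
    \<iota> d' + s * \<iota> b' = (\<iota> d + s * \<iota> b) ^ Suc n \<and> \<iota> a' - \<iota> d' = 2 * s * \<iota> b'"
proof (induction n)
  case 0
  interpret PGL2: group PGL2 by (rule group_PGL2)
  show ?case using assms by (intro exI[of _ a] exI[of _ b] exI[of _ c] exI[of _ d])
      (simp add: PGL2.nat_pow_Suc mob_in_PGL2)
next
  case (Suc n)
  interpret PGL2: group PGL2 by (rule group_PGL2)
  let ?l = "\<iota> d + s * \<iota> b"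
  obtain a' b' c' d' where IH: "mob a b c d [^]\<^bsub>PGL2\<^esub> Suc n = mob a' b' c' d'" "a' * d' - b' * c' \<noteq> 0"
    "\<iota> b' = of_nat (Suc n) * ?l ^ n * \<iota> b" "\<iota> c' = - (s * s * \<iota> b')"
    "\<iota> d' + s * \<iota> b' = ?l ^ Suc n" "\<iota> a' - \<iota> d' = 2 * s * \<iota> b'" using Suc.IH by blast
  have "mob a b c d [^]\<^bsub>PGL2\<^esub> Suc (Suc n) =
      mob (a' * a + b' * c) (a' * b + b' * d) (c' * a + d' * c) (c' * b + d' * d)"
    using mob_mult[OF IH(2) det] IH(1) PGL2.nat_pow_Suc[of "mob a b c d" "Suc n"] by simp
  moreover have a: "\<iota> a = \<iota> d + 2 * s * \<iota> b" using R(1) by (simp add: algebra_simps)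
  have a': "\<iota> a' = \<iota> d' + 2 * s * \<iota> b'" using IH(6) by (simp add: algebra_simps)
  have "\<iota> (a' * b + b' * d) = of_nat (Suc (Suc n)) * ?l ^ Suc n * \<iota> b"
  proof -
    have "\<iota> (a' * b + b' * d) = (\<iota> d' + s * \<iota> b') * \<iota> b + \<iota> b' * ?l" by (simp add: a' algebra_simps)
    also have "\<dots> = ?l ^ Suc n * \<iota> b + \<iota> b' * ?l" by (simp only: IH(5))
    also have "\<dots> = ?l ^ Suc n * \<iota> b + of_nat (Suc n) * ?l ^ Suc n * \<iota> b" unfolding IH(3) by simp
    also have "\<dots> = of_nat (Suc (Suc n)) * ?l ^ Suc n * \<iota> b" by (simp add: algebra_simps)
    finally show ?thesis .
  qed
  moreover have "\<iota> (c' * a + d' * c) = - (s * s * \<iota> (a' * b + b' * d))"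
    by (simp only: emb_simps a a' R(2) IH(4)) (simp add: algebra_simps)
  moreover have "\<iota> (c' * b + d' * d) + s * \<iota> (a' * b + b' * d) = ?l ^ Suc (Suc n)"
  proof -
    have "\<iota> (c' * b + d' * d) + s * \<iota> (a' * b + b' * d) = ?l * (\<iota> d' + s * \<iota> b')"
      by (simp only: emb_simps a' R(2) IH(4)) (simp add: algebra_simps)
    then show ?thesis unfolding IH(5) by simp
  qed
  moreover have "\<iota> (a' * a + b' * c) - \<iota> (c' * b + d' * d) = 2 * s * \<iota> (a' * b + b' * d)"
    by (simp only: emb_simps a a' R(2) IH(4)) (simp add: algebra_simps)
  ultimately show ?case using det_mult_nz[OF IH(2) det] by blast
qed

lemma power_unip_inf:
  assumes a: "a \<noteq> 0"
  shows "\<exists>c'. mob a 0 c a [^]\<^bsub>PGL2\<^esub> (n::nat) = mob 1 0 c' 1 \<and> c' = of_nat n * (c / a)"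
proof (induction n)
  case 0
  interpret PGL2: group PGL2 by (rule group_PGL2)
  show ?case by (simp add: one_PGL2)
next
  case (Suc n)
  interpret PGL2: group PGL2 by (rule group_PGL2)
  have "mob a 0 c a = mob 1 0 (c / a) 1" unfolding mob_eq_iff using a by (intro exI[of _ "1 / a"]) simp
  then show ?case using Suc by (simp add: PGL2.nat_pow_Suc mob_mult algebra_simps)
qed

text \<open>In the n-th power the off-diagonal entry is n times a nonzero factor. So a unipotent
  element has the characteristic as its order, and infinite order in characteristic 0.\<close>

lemma unip_power_eq_one_iff:
  assumes g: "g \<in> carrier PGL2" "g \<noteq> \<one>\<^bsub>PGL2\<^esub>" "Fix P1 pact g = {x}"
  shows "g [^]\<^bsub>PGL2\<^esub> (n::nat) = \<one>\<^bsub>PGL2\<^esub> \<longleftrightarrow> of_nat n = (0::'b)"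
proof -
  obtain a b c d where m: "g = mob a b c d" and det: "a * d - b * c \<noteq> 0" using g(1) by (rule PGL2_exhaust)
  have "x \<in> P1" using g(3) by (auto simp: Fix_def)
  then show ?thesis
  proof (cases rule: P1_cases)
    case 1
    then have ad: "a = d" "b = 0" using unip_inf_iff[OF det] g(3) m by blast+
    then have a: "a \<noteq> 0" and c: "c \<noteq> 0" using det g(2) m mob_eq_one_iff[OF det] by auto
    have "g [^]\<^bsub>PGL2\<^esub> n = mob 1 0 (of_nat n * (c / a)) 1" using power_unip_inf[OF a, of c n] m ad by simp
    then have "g [^]\<^bsub>PGL2\<^esub> n = \<one>\<^bsub>PGL2\<^esub> \<longleftrightarrow> of_nat n = (0::'a)"
      using a c by (simp add: mob_eq_one_iff)
    then show ?thesis by (simp flip: emb_of_nat emb_simps(5))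
  next
    case (2 s)
    then have R: "\<iota> a - \<iota> d = 2 * s * \<iota> b" "\<iota> c = - (s * s * \<iota> b)"
      using unip_pt_iff[OF det] g(3) m by blast+
    have b: "b \<noteq> 0"
    proof
      assume "b = 0"
      then show False using R g(2) mob_eq_one_iff[OF det] m by simp
    qed
    \<comment> \<open>The determinant is the square of this eigenvalue.\<close>
    have l: "\<iota> d + s * \<iota> b \<noteq> 0"
    proof
      assume l0: "\<iota> d + s * \<iota> b = 0"
      have "\<iota> a = \<iota> d + 2 * s * \<iota> b" using R(1) by (simp add: algebra_simps)
      then have "\<iota> a * \<iota> d - \<iota> b * \<iota> c = (\<iota> d + s * \<iota> b) * (\<iota> d + s * \<iota> b)" by (simp add: R(2) algebra_simps)
      then show False using det_nz[OF det] l0 by simp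
    qed
    show ?thesis
    proof (cases n)
      case 0
      then show ?thesis using group.is_monoid[OF group_PGL2] by (simp add: monoid.nat_pow_0)
    next
      case (Suc k)
      obtain a' b' c' d' where p: "g [^]\<^bsub>PGL2\<^esub> n = mob a' b' c' d'" "a' * d' - b' * c' \<noteq> 0"
        "\<iota> b' = of_nat n * (\<iota> d + s * \<iota> b) ^ k * \<iota> b" "\<iota> c' = - (s * s * \<iota> b')" "\<iota> a' - \<iota> d' = 2 * s * \<iota> b'"
        using power_unip[OF det R, of k] unfolding m Suc by blast
      have "g [^]\<^bsub>PGL2\<^esub> n = \<one>\<^bsub>PGL2\<^esub> \<longleftrightarrow> b' = 0" unfolding p(1) mob_eq_one_iff[OF p(2)]
        using p(4,5) by auto
      also have "\<dots> \<longleftrightarrow> of_nat n = (0::'b)" using p(3) l b by (simp flip: emb_simps(5))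
      finally show ?thesis .
    qed
  qed
qed

text \<open>Eigenvalues make sense for matrices but not for their classes modulo scalars, so the
  power is followed on representatives.\<close>

lemma power_eigenvectors:
  assumes "invertible A"
  shows "\<exists>B. invertible B \<and> to_PGL2 A [^]\<^bsub>PGL2\<^esub> (n::nat) = to_PGL2 B \<and>
    (\<forall>v l. v v* map_matrix \<iota> A = l *s v \<longrightarrow> v v* map_matrix \<iota> B = (l ^ n) *s v)"
proof (induction n)
  case 0
  show ?case
    by (intro exI[of _ "mat 1"]) (simp add: to_PGL2_one invertible_det_nz map_matrix_mat[OF emb])
next
  case (Suc n)
  interpret PGL2: group PGL2 by (rule group_PGL2)
  obtain B where B: "invertible B" "to_PGL2 A [^]\<^bsub>PGL2\<^esub> n = to_PGL2 B"
    "\<And>v l. v v* map_matrix \<iota> A = l *s v \<Longrightarrow> v v* map_matrix \<iota> B = (l ^ n) *s v" using Suc.IH by blast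
  have "v v* map_matrix \<iota> (B ** A) = (l ^ Suc n) *s v" if v: "v v* map_matrix \<iota> A = l *s v" for v l
  proof -
    have "v v* map_matrix \<iota> (B ** A) = ((l ^ n) *s v) v* map_matrix \<iota> A"
      by (simp only: map_matrix_mult[OF emb] B(3)[OF v] vector_matrix_mul_assoc[symmetric])
    also have "\<dots> = (l ^ n) *s (v v* map_matrix \<iota> A)"
      by (simp add: vec_eq_iff vector_matrix_mult_def sum_2 algebra_simps)
    finally show ?thesis using v by (simp add: vec_eq_iff)
  qed
  moreover have "invertible (B ** A)" using B(1) assms by (rule invertible_mult)
  moreover have "to_PGL2 A [^]\<^bsub>PGL2\<^esub> Suc n = to_PGL2 (B ** A)"
    using B(2) to_PGL2_mult[OF B(1) assms] by (simp add: PGL2.nat_pow_Suc)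
  ultimately show ?case by blast
qed

lemma fixed_eigenvector:
  assumes A: "A = mat2 a b c d" and xy: "x \<noteq> 0 \<or> y \<noteq> 0" and f: "pact (proj_pt x y) (mob a b c d) = proj_pt x y"
  obtains l where "vector [x, y] v* map_matrix \<iota> A = l *s vector [x, y]"
proof -
  have "vector [x, y] \<in> proj_pt x y" unfolding proj_pt_eq by (intro CollectI exI[of _ 1]) simp
  then have "vector [x, y] v* map_matrix \<iota> A \<in> pact (proj_pt x y) (mob a b c d)"
    unfolding mob_def A P1_act_to_PGL2[OF emb proj_pt_in_P1[OF xy]] by blast
  then have "vector [x, y] v* map_matrix \<iota> A \<in> proj_pt x y" by (simp only: f)
  then obtain l where "vector [x, y] v* map_matrix \<iota> A = vector [l * x, l * y]" unfolding proj_pt_eq by blast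
  then show ?thesis by (intro that[of l]) (simp add: scale_vec2)
qed

text \<open>Two fixed points are spanned by eigenvectors with eigenvalues l and k. The p-th power is
  scalar, so l^p = k^p, and in characteristic p this means (l - k)^p = 0, hence l = k. Then the sum
  of the two eigenvectors spans a third fixed point.\<close>

lemma power_CHAR_fix_unique:
  assumes p: "prime CHAR('a)" and g: "g \<in> carrier PGL2" "g [^]\<^bsub>PGL2\<^esub> CHAR('a) = \<one>\<^bsub>PGL2\<^esub>" "g \<noteq> \<one>\<^bsub>PGL2\<^esub>"
    and x: "x \<in> P1" "pact x g = x" and y: "y \<in> P1" "pact y g = y"
  shows "x = y"
proof (rule ccontr)
  assume ne: "x \<noteq> y"
  obtain a b c d where m: "g = mob a b c d" and det: "a * d - b * c \<noteq> 0" using g(1) by (rule PGL2_exhaust)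
  define A where "A = mat2 a b c d"
  have iA: "invertible A" using det by (simp add: A_def)
  obtain x1 x2 where x12: "x = proj_pt x1 x2" "x1 \<noteq> 0 \<or> x2 \<noteq> 0" using x(1) by (rule P1_exhaust_proj)
  obtain y1 y2 where y12: "y = proj_pt y1 y2" "y1 \<noteq> 0 \<or> y2 \<noteq> 0" using y(1) by (rule P1_exhaust_proj)
  obtain l where l: "vector [x1, x2] v* map_matrix \<iota> A = l *s vector [x1, x2]"
    using fixed_eigenvector[OF A_def x12(2)] x(2) unfolding x12(1) m by blast
  obtain k where k: "vector [y1, y2] v* map_matrix \<iota> A = k *s vector [y1, y2]"
    using fixed_eigenvector[OF A_def y12(2)] y(2) unfolding y12(1) m by blast
  obtain B where B: "to_PGL2 A [^]\<^bsub>PGL2\<^esub> CHAR('a) = to_PGL2 B"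
    "\<And>v l. v v* map_matrix \<iota> A = l *s v \<Longrightarrow> v v* map_matrix \<iota> B = (l ^ CHAR('a)) *s v"
    using power_eigenvectors[OF iA, of "CHAR('a)"] by blast
  obtain a' b' c' d' where B': "B = mat2 a' b' c' d'" by (rule mat2_exhaust)
  have "mob 1 0 0 1 = mob a' b' c' d'" using B(1) g(2) unfolding m one_PGL2 by (simp add: mob_def A_def B')
  then obtain r where r: "B = mat2 r 0 0 r" unfolding mob_eq_iff B' by auto
  have "l ^ CHAR('a) = \<iota> r" using B(2)[OF l] x12(2) by (auto simp: r map_mat2 vec2_mat2 scale_vec2)
  moreover have "k ^ CHAR('a) = \<iota> r" using B(2)[OF k] y12(2) by (auto simp: r map_mat2 vec2_mat2 scale_vec2)
  ultimately have lk: "l ^ CHAR('b) = k ^ CHAR('b)" unfolding CHAR_eq by simp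
  have pb: "prime CHAR('b)" using p by (simp add: CHAR_eq)
  have "l ^ CHAR('b) = ((l - k) + k) ^ CHAR('b)" by simp
  also have "\<dots> = (l - k) ^ CHAR('b) + k ^ CHAR('b)" by (rule freshmans_dream[OF pb refl])
  finally have "(l - k) ^ CHAR('b) = 0" using lk by simp
  then have "l = k" by simp
  define z where "z = proj_pt (x1 + y1) (x2 + y2)"
  have ne': "x1 * y2 \<noteq> y1 * x2" using ne x12 y12 by (simp add: proj_pt_eq_iff)
  have z0: "x1 + y1 \<noteq> 0 \<or> x2 + y2 \<noteq> 0"
  proof (rule ccontr)
    assume "\<not> ?thesis"
    then have "y1 = - x1" "y2 = - x2" by (auto simp: eq_neg_iff_add_eq_0 add.commute)
    then show False using ne' by simp
  qed
  have zP: "z \<in> P1" unfolding z_def using z0 by (rule proj_pt_in_P1)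
  have "(x1 + y1) * \<iota> a + (x2 + y2) * \<iota> c = l * (x1 + y1)" "(x1 + y1) * \<iota> b + (x2 + y2) * \<iota> d = l * (x2 + y2)"
    using l k \<open>l = k\<close> by (auto simp: A_def map_mat2 vec2_mat2 scale_vec2 algebra_simps)
  then have zf: "pact z g = z" using act_nz[OF z0 det_nz[OF det]] z0
    unfolding z_def m act_proj[OF z0] by (simp add: proj_pt_eq_iff)
  have "x \<noteq> z"
  proof
    assume "x = z"
    then have "x1 * (x2 + y2) = (x1 + y1) * x2" using x12 z0 by (simp add: z_def proj_pt_eq_iff)
    then show False using ne' by (simp add: algebra_simps)
  qed
  moreover have "y \<noteq> z"
  proof
    assume "y = z"
    then have "y1 * (x2 + y2) = (x1 + y1) * y2" using y12 z0 by (simp add: z_def proj_pt_eq_iff)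
    then show False using ne' by (simp add: algebra_simps)
  qed
  ultimately have "g = \<one>\<^bsub>PGL2\<^esub>" using fix_three[OF g(1) x(1) y(1) zP ne _ _ x(2) y(2) zf] by blast
  then show False using g(3) by simp
qed

end

section \<open>Unipotent elements and conjugation\<close>

lemma (in fp_action) Gamma_eq: "\<Gamma> = {y. \<exists>g\<in>carrier G. g \<noteq> \<one> \<and> Fix \<Omega> act g = {y}}"
proof -
  have "Fix \<Omega> act g \<subseteq> \<Omega>" for g by (auto simp: Fix_def)
  then show ?thesis unfolding \<Gamma>_def by blast
qed

context emb
begin

sublocale P: right_action PGL2 P1 pact
  by (rule right_action_PGL2[OF emb])

definition unip where "unip x g \<longleftrightarrow> g = \<one>\<^bsub>PGL2\<^esub> \<or> Fix P1 pact g = {x}"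

text \<open>In coordinates these elements are the matrices l + r Z with scalars l and r, where Z
  depends only on \<open>x\<close> and has square zero. They commute, and products have the same
  form.\<close>

lemma unip_mult:
  assumes x: "x \<in> P1" and g: "g \<in> carrier PGL2" "unip x g" and h: "h \<in> carrier PGL2" "unip x h"
  shows "unip x (g \<cdot> h)" "g \<cdot> h = h \<cdot> g"
proof -
  obtain a b c d where m: "g = mob a b c d" and det: "a * d - b * c \<noteq> 0" using g(1) by (rule PGL2_exhaust)
  obtain a' b' c' d' where m': "h = mob a' b' c' d'" and det': "a' * d' - b' * c' \<noteq> 0" using h(1) by (rule PGL2_exhaust)
  note mm = mob_mult[OF det det'] and mm' = mob_mult[OF det' det] and dd = det_mult_nz[OF det det']
  have "unip x (g \<cdot> h) \<and> g \<cdot> h = h \<cdot> g"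
    using x
  proof (cases rule: P1_cases)
    case 1
    then have "a = d" "b = 0" "a' = d'" "b' = 0"
      using g(2) h(2) unip_inf_iff[OF det] unip_inf_iff[OF det'] unfolding unip_def m m' by simp_all
    then show ?thesis using unip_inf_iff[OF dd] unfolding unip_def m m' mm mm' 1 by (simp add: mult.commute add.commute)
  next
    case (2 s)
    then have R: "\<iota> a - \<iota> d = 2 * s * \<iota> b" "\<iota> c = - (s * s * \<iota> b)"
      and R': "\<iota> a' - \<iota> d' = 2 * s * \<iota> b'" "\<iota> c' = - (s * s * \<iota> b')"
      using g(2) h(2) unip_pt_iff[OF det] unip_pt_iff[OF det'] unfolding unip_def m m' by simp_all
    have a: "\<iota> a = \<iota> d + 2 * s * \<iota> b" using R(1) by (simp add: algebra_simps)
    have a': "\<iota> a' = \<iota> d' + 2 * s * \<iota> b'" using R'(1) by (simp add: algebra_simps)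
    have "unip x (g \<cdot> h)" unfolding unip_def m m' mm 2 unip_pt_iff[OF dd] emb_simps a a' R(2) R'(2)
      by (simp add: algebra_simps)
    moreover have "a * a' + b * c' = a' * a + b' * c" "a * b' + b * d' = a' * b + b' * d"
      "c * a' + d * c' = c' * a + d' * c" "c * b' + d * d' = c' * b + d' * d"
      unfolding emb_eq_iff[symmetric] emb_simps a a' R(2) R'(2) by (simp_all add: algebra_simps)
    then have "g \<cdot> h = h \<cdot> g" unfolding m m' mm mm' by (simp only:)
    ultimately show ?thesis by blast
  qed
  then show "unip x (g \<cdot> h)" "g \<cdot> h = h \<cdot> g" by blast+
qed

lemma Fix_inv:
  assumes "g \<in> carrier PGL2" shows "Fix P1 pact (inv\<^bsub>PGL2\<^esub> g) = Fix P1 pact g"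
proof -
  have "pact x (inv\<^bsub>PGL2\<^esub> g) = x \<longleftrightarrow> pact x g = x" if "x \<in> P1" for x
    using P.act_inv_cancel[OF that assms] by metis
  then show ?thesis by (auto simp: Fix_def)
qed

lemma unip_inv: "g \<in> carrier PGL2 \<Longrightarrow> unip x g \<Longrightarrow> unip x (inv\<^bsub>PGL2\<^esub> g)"
  by (auto simp: unip_def Fix_inv)

lemma unip_infE:
  assumes "g \<in> carrier PGL2" "unip infpt g" obtains c where "g = mob 1 0 c 1"
proof -
  obtain a b c d where m: "g = mob a b c d" and det: "a * d - b * c \<noteq> 0" using assms(1) by (rule PGL2_exhaust)
  then have "a = d" "b = 0" "a \<noteq> 0" using assms(2) unip_inf_iff[OF det] det by (auto simp: unip_def)
  then have "g = mob 1 0 (c / a) 1" unfolding m mob_eq_iff by (intro exI[of _ "1 / a"]) simp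
  then show ?thesis by (rule that)
qed

lemma P1_over_UNIV_act:
  assumes "x \<in> P1_over \<iota> UNIV" "g \<in> carrier PGL2" shows "pact x g \<in> P1_over \<iota> UNIV"
proof -
  obtain a b c d where m: "g = mob a b c d" and det: "a * d - b * c \<noteq> 0" using assms(2) by (rule PGL2_exhaust)
  have in1: "infpt \<in> P1_over \<iota> UNIV" and in2: "pt (\<iota> r) \<in> P1_over \<iota> UNIV" for r
    by (auto simp: P1_over_def)
  consider "x = infpt" | r where "x = pt (\<iota> r)" using assms(1) by (auto simp: P1_over_def)
  then show ?thesis
  proof cases
    case 1
    then show ?thesis using in1 in2[of "a / b"] unfolding m 1 act_inf[OF det] by simp
  next
    case (2 r)
    then show ?thesis using in1 in2[of "(r * a + c) / (r * b + d)"] unfolding m 2 act_pt[OF det] by simp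
  qed
qed

text \<open>Only points over the ground field can be moved to infinity and 0 by elements with
  coefficients in F; this is what the rationality of \<Gamma> is for.\<close>

lemma move_to_inf_zero:
  assumes x: "x \<in> P1_over \<iota> UNIV" and y: "y \<in> P1_over \<iota> UNIV" "x \<noteq> y"
  obtains h where "h \<in> carrier PGL2" "pact x h = infpt" "pact y h = pt 0"
proof -
  have "\<exists>h\<in>carrier PGL2. pact x h = infpt"
  proof -
    consider "x = infpt" | r where "x = pt (\<iota> r)" using x by (auto simp: P1_over_def)
    then show ?thesis
    proof cases
      case 1
      then show ?thesis using P.act_one[of infpt] by (intro bexI[of _ "\<one>\<^bsub>PGL2\<^esub>"]) simp_all
    next
      case (2 r)
      then show ?thesis using act_pt[of 0 "- r" 1 1 "\<iota> r"] mob_in_PGL2[of 0 "- r" 1 1]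
        by (intro bexI[of _ "mob 0 1 1 (- r)"]) simp_all
    qed
  qed
  then obtain h where h: "h \<in> carrier PGL2" "pact x h = infpt" by blast
  have xy: "x \<in> P1" "y \<in> P1" using x y by (auto simp: P1_over_def)
  have "pact y h \<noteq> infpt" using P.act_eq_iff[OF xy h(1)] h(2) y(2) by auto
  then obtain t where t: "pact y h = pt (\<iota> t)" using P1_over_UNIV_act[OF y(1) h(1)] by (auto simp: P1_over_def)
  let ?k = "mob 1 0 (- t) 1"
  have k: "?k \<in> carrier PGL2" by (rule mob_in_PGL2) simp
  have "pact infpt ?k = infpt" "pact (pt (\<iota> t)) ?k = pt 0" by (simp_all add: act_inf act_pt)
  then show ?thesis using h k t xy by (intro that[of "h \<cdot> ?k"]) (simp_all add: P.act_mult)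
qed

end

text \<open>The situation of the theorem with its first alternative excluded: \<open>large\<close>
  says that no orbit has length one or two.\<close>

locale fin_pgl = emb \<iota> for \<iota> :: "'a::field \<Rightarrow> 'b::field" +
  fixes G :: "('a^2^2) set set"
  assumes G_subgroup: "subgroup G PGL2" and finite_carrier: "finite G"
    and has_fixed_point: "g \<in> G \<Longrightarrow> Fix P1 pact g \<noteq> {}"
    and large: "x \<in> P1 \<Longrightarrow> 2 < card (pact x ` G)"
begin

abbreviation "Gr \<equiv> PGL2\<lparr>carrier := G\<rparr>"

lemma G_carrier: "g \<in> G \<Longrightarrow> g \<in> carrier PGL2"
  using subgroup.subset[OF G_subgroup] by blast

lemma inv_Gr: "g \<in> G \<Longrightarrow> inv\<^bsub>Gr\<^esub> g = inv\<^bsub>PGL2\<^esub> g"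
  by (rule P.m_inv_consistent[OF G_subgroup])

lemma pow_Gr: "g [^]\<^bsub>Gr\<^esub> (n::nat) = g [^]\<^bsub>PGL2\<^esub> n"
  by (simp add: P.nat_pow_consistent[symmetric])

sublocale A: right_action Gr P1 pact
  by (rule P.restrict_group[OF G_subgroup])

lemma card_Fix_G:
  assumes g: "g \<in> G" "g \<noteq> \<one>\<^bsub>PGL2\<^esub>"
  shows "card (Fix P1 pact g) = 1 \<or> card (Fix P1 pact g) = 2"
proof -
  obtain x where x: "x \<in> Fix P1 pact g" using has_fixed_point[OF g(1)] by blast
  show ?thesis
  proof (cases "Fix P1 pact g = {x}")
    case False
    then obtain y where y: "y \<in> Fix P1 pact g" "y \<noteq> x" using x by blast
    have "z \<in> {x, y}" if z: "z \<in> Fix P1 pact g" for z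
    proof (rule ccontr)
      assume "z \<notin> {x, y}"
      then have "g = \<one>\<^bsub>PGL2\<^esub>" using x y z by (intro fix_three[OF G_carrier[OF g(1)], of x y z]) (auto simp: Fix_def)
      then show False using g(2) by simp
    qed
    then have "Fix P1 pact g = {x, y}" using x y by blast
    then show ?thesis using y(2) by simp
  qed simp
qed

lemma card_pos: "0 < card G"
  using subgroup.one_closed[OF G_subgroup] finite_carrier card_gt_0_iff by blast

sublocale fp: fp_action Gr P1 pact "CHAR('a)"
proof (intro fp_action.intro fp_action_axioms.intro A.right_action_axioms)
  show "finite (carrier Gr)" by (simp add: finite_carrier)
  show "P1 \<noteq> ({} :: ('b^2) set set)" using pt_in_P1(2) by blast
  show "card (Fix P1 pact g) = 1 \<or> card (Fix P1 pact g) = 2" if "g \<in> carrier Gr" "g \<noteq> \<one>\<^bsub>Gr\<^esub>" for g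
    using card_Fix_G[of g] that by simp
  show "subgroup {g \<in> carrier Gr. g = \<one>\<^bsub>Gr\<^esub> \<or> Fix P1 pact g = {x}} Gr" if x: "x \<in> P1" for x
  proof -
    have eq: "{g \<in> carrier Gr. g = \<one>\<^bsub>Gr\<^esub> \<or> Fix P1 pact g = {x}} = {g \<in> G. unip x g}" by (simp add: unip_def)
    show ?thesis unfolding eq
    proof (rule A.subgroupI)
      show "{g \<in> G. unip x g} \<noteq> {}" using subgroup.one_closed[OF G_subgroup] by (auto simp: unip_def)
      show "inv\<^bsub>Gr\<^esub> g \<in> {g \<in> G. unip x g}" if "g \<in> {g \<in> G. unip x g}" for g
        using that subgroup.m_inv_closed[OF G_subgroup] G_carrier by (simp add: inv_Gr unip_inv)
      show "g \<otimes>\<^bsub>Gr\<^esub> h \<in> {g \<in> G. unip x g}" if "g \<in> {g \<in> G. unip x g}" "h \<in> {g \<in> G. unip x g}" for g h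
        using that subgroup.m_closed[OF G_subgroup] unip_mult(1)[OF x] G_carrier by simp
    qed simp
  qed
  show "g \<otimes>\<^bsub>Gr\<^esub> h = h \<otimes>\<^bsub>Gr\<^esub> g"
    if "g \<in> carrier Gr" "h \<in> carrier Gr" "g \<noteq> \<one>\<^bsub>Gr\<^esub>" "h \<noteq> \<one>\<^bsub>Gr\<^esub>" "Fix P1 pact g = {x}" "Fix P1 pact h = {x}" for g h x
  proof -
    have "x \<in> P1" using that(5) by (auto simp: Fix_def)
    then show ?thesis using unip_mult(2)[of x g h] that G_carrier by (simp add: unip_def)
  qed
  show "prime CHAR('a) \<and> g [^]\<^bsub>Gr\<^esub> CHAR('a) = \<one>\<^bsub>Gr\<^esub>"
    if g: "g \<in> carrier Gr" "g \<noteq> \<one>\<^bsub>Gr\<^esub>" and c: "card (Fix P1 pact g) = 1" for g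
  proof -
    obtain x where x: "Fix P1 pact g = {x}" using c by (rule card_1_singletonE)
    have iff: "g [^]\<^bsub>PGL2\<^esub> n = \<one>\<^bsub>PGL2\<^esub> \<longleftrightarrow> of_nat n = (0::'b)" for n :: nat
      using unip_power_eq_one_iff[OF G_carrier _ x] g by simp
    \<comment> \<open>By \<open>iff\<close> the number |G| vanishes in the field, so the
      characteristic is positive and therefore prime.\<close>
    have "g [^]\<^bsub>PGL2\<^esub> card G = \<one>\<^bsub>PGL2\<^esub>"
      using P.subgroup_pow_card[OF G_subgroup finite_carrier] g by simp
    then have "CHAR('a) dvd card G" unfolding iff by (simp add: of_nat_eq_0_iff_char_dvd CHAR_eq)
    then have "CHAR('a) > 0" using card_pos by (intro Nat.gr0I) simp
    then have "prime CHAR('a)" by (rule prime_CHAR_semidom)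
    moreover have "g [^]\<^bsub>PGL2\<^esub> CHAR('a) = \<one>\<^bsub>PGL2\<^esub>" unfolding iff by (simp flip: CHAR_eq)
    ultimately show ?thesis by (simp add: pow_Gr)
  qed
  show "card (Fix P1 pact g) = 1"
    if p: "prime CHAR('a)" and g: "g \<in> carrier Gr" "g \<noteq> \<one>\<^bsub>Gr\<^esub>" "g [^]\<^bsub>Gr\<^esub> CHAR('a) = \<one>\<^bsub>Gr\<^esub>" for g
  proof -
    obtain x where x: "x \<in> Fix P1 pact g" using has_fixed_point g(1) by auto
    have "y = x" if y: "y \<in> Fix P1 pact g" for y
      using power_CHAR_fix_unique[OF p, of g y x] G_carrier[of g] g x y by (simp add: Fix_def pow_Gr)
    then have "Fix P1 pact g = {x}" using x by blast
    then show ?thesis by simp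
  qed
  show "2 < card (pact x ` carrier Gr)" if "x \<in> P1" for x
    using large[OF that] by simp
qed

lemma fp_U_iff: "g \<in> fp.U x \<longleftrightarrow> g \<in> G \<and> unip x g"
  by (simp add: fp.U_def unip_def)

lemma stab_Gr_iff: "g \<in> A.stab x \<longleftrightarrow> g \<in> G \<and> pact x g = x"
  by (simp add: A.stab_iff)

text \<open>The double root satisfies 2 s b = a - d, which can be solved over F unless the
  characteristic is two. There s^2 = c / b, and if s is not in F, the fixed point equation shows
  that all elements of the stabilizer are unipotent. So the index e of \<open>fp.U x\<close> in the
  stabilizer is 1, which leaves only q = 3; but the characteristic 2 divides q.\<close>

lemma Gamma_rational: "fp.\<Gamma> \<subseteq> P1_over \<iota> UNIV"
proof
  fix x assume x: "x \<in> fp.\<Gamma>"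
  then have xP: "x \<in> P1" by (simp add: fp.Gamma_iff)
  then show "x \<in> P1_over \<iota> UNIV"
  proof (cases rule: P1_cases)
    case (2 s)
    obtain g where g: "g \<in> fp.U x" "g \<noteq> \<one>\<^bsub>Gr\<^esub>" using x by (rule fp.Gamma_unipotent)
    then have gc: "g \<in> carrier PGL2" and gu: "unip (pt s) g" using G_carrier 2 by (auto simp: fp_U_iff)
    obtain a b c d where m: "g = mob a b c d" and det: "a * d - b * c \<noteq> 0" using gc by (rule PGL2_exhaust)
    have R: "\<iota> a - \<iota> d = 2 * s * \<iota> b" "\<iota> c = - (s * s * \<iota> b)" using gu unip_pt_iff[OF det] unfolding unip_def m by simp_all
    have b: "b \<noteq> 0" using R g(2) mob_eq_one_iff[OF det] m by auto
    show ?thesis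
    proof (cases "(2 :: 'a) = 0")
      case False
      then have "(2 :: 'b) \<noteq> 0" using emb_simps(5)[of 2] by simp
      then have "s = \<iota> ((a - d) / (2 * b))" using R(1) b by (simp add: field_simps)
      then have "x = pt (\<iota> ((a - d) / (2 * b)))" using 2 by (simp only:)
      then show ?thesis unfolding P1_over_def by blast
    next
      case True
      then have two: "(2 :: 'b) = 0" by (metis emb_numeral emb_simps(4))
      then have neg: "- z = z" for z :: 'b by (metis add_eq_0_iff mult_2 mult_zero_left)
      show ?thesis
      proof (rule ccontr)
        assume "x \<notin> P1_over \<iota> UNIV"
        then have s: "s \<noteq> \<iota> r" for r using 2 by (auto simp: P1_over_def)
        have ss: "s * s = \<iota> (c / b)" using R(2) b neg by (simp add: field_simps)
        have "A.stab x \<subseteq> fp.U x"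
        proof
          fix h assume "h \<in> A.stab x"
          then have h: "h \<in> G" "pact (pt s) h = pt s" using 2 by (simp_all add: stab_Gr_iff)
          obtain a' b' c' d' where m': "h = mob a' b' c' d'" and det': "a' * d' - b' * c' \<noteq> 0"
            using G_carrier[OF h(1)] by (rule PGL2_exhaust)
          have "s * \<iota> a' + \<iota> c' = s * (s * \<iota> b' + \<iota> d')" using h(2) fix_pt_iff[OF det'] m' by simp
          then have "s * \<iota> (a' - d') = s * s * \<iota> b' - \<iota> c'" by (simp add: algebra_simps)
          also have "\<dots> = \<iota> (c / b * b' - c')" by (simp only: ss emb_simps emb_diff)
          finally have eq: "s * \<iota> (a' - d') = \<iota> (c / b * b' - c')" .
          have "a' = d'"
          proof (rule ccontr)
            assume "a' \<noteq> d'"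
            then have "s = \<iota> ((c / b * b' - c') / (a' - d'))" using eq by (simp add: field_simps)
            then show False using s by blast
          qed
          moreover from this have "\<iota> c' = s * s * \<iota> b'" using eq ss by simp
          ultimately have "unip (pt s) h" unfolding unip_def m' unip_pt_iff[OF det'] using two neg by simp
          then show "h \<in> fp.U x" using h(1) 2 by (simp add: fp_U_iff)
        qed
        then have eq: "A.stab x = fp.U x" using fp.U_stab[OF xP] by blast
        have "fp.\<Gamma> \<noteq> {}" using x by blast
        then obtain q e \<Delta> where "fp.\<Gamma> \<in> fp.NR" "fp.NR - {fp.\<Gamma>} = {\<Delta>}"
          and q: "\<And>x. x \<in> fp.\<Gamma> \<Longrightarrow> card (fp.U x) = q" "\<And>x. x \<in> fp.\<Gamma> \<Longrightarrow> card (A.stab x) = q * e"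
          and "card (carrier Gr) = card fp.\<Gamma> * (q * e)" and p: "CHAR('a) dvd q"
          and trich: "3 \<le> q \<and> card fp.\<Gamma> = q + 1 \<and> card \<Delta> = q * (q - 1) \<and> (e = q - 1 \<or> 2 * e = q - 1) \<or>
             q = 3 \<and> e = 2 \<and> card fp.\<Gamma> = 10 \<and> card \<Delta> = 12"
          by (rule fp.orbits_unipotents) (rule that)
        have "q = q * e" using q(1,2)[OF x] eq by simp
        then have "e = 1" using trich by auto
        then have "q = 3" using trich by auto
        moreover have "CHAR('a) dvd 2" using True of_nat_eq_0_iff_char_dvd[of 2, where 'a = 'a] by simp
        ultimately have "CHAR('a) dvd 3 - 2" using p by (intro dvd_diff_nat) simp_all
        then have "CHAR('a) = 1" by simp
        then show False by simp
      qed
    qed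
  qed (simp add: P1_over_def)
qed

end

section \<open>Conjugation within PGL_2 and the choice of coordinates\<close>

context emb
begin

lemma conj_fin_pgl:
  assumes "fin_pgl \<iota> G" and h: "h \<in> carrier PGL2"
  shows "fin_pgl \<iota> ((\<lambda>g. P.conjg g h) ` G)"
    and "fp_action.\<Gamma> (PGL2\<lparr>carrier := (\<lambda>g. P.conjg g h) ` G\<rparr>) P1 pact =
      (\<lambda>x. pact x h) ` fp_action.\<Gamma> (PGL2\<lparr>carrier := G\<rparr>) P1 pact"
    and "card ((\<lambda>g. P.conjg g h) ` G) = card G"
proof -
  interpret F: fin_pgl \<iota> G by fact
  let ?H = "(\<lambda>g. P.conjg g h) ` G"
  have hom: "(\<lambda>g. P.conjg g h) \<in> hom PGL2 PGL2"
    using h by (auto simp: hom_def P.conjg_mult_left)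
  interpret ch: group_hom PGL2 PGL2 "\<lambda>g. P.conjg g h"
    by (rule group_hom.intro) (use hom group_PGL2 in \<open>auto simp: group_hom_axioms_def\<close>)
  have sub: "subgroup ?H PGL2" by (rule ch.subgroup_img_is_subgroup[OF F.G_subgroup])
  have FixH: "Fix P1 pact (P.conjg g h) = (\<lambda>x. pact x h) ` Fix P1 pact g" if "g \<in> G" for g
    by (rule P.Fix_conjg[OF F.G_carrier[OF that] h])
  show "fin_pgl \<iota> ?H"
  proof (intro fin_pgl.intro fin_pgl_axioms.intro emb_axioms)
    show "subgroup ?H PGL2" by (rule sub)
    show "finite ?H" using F.finite_carrier by simp
    show "Fix P1 pact g \<noteq> {}" if "g \<in> ?H" for g using that FixH F.has_fixed_point by auto
    fix y :: "('b^2) set" assume y: "y \<in> P1"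
    define x where "x = pact y (inv\<^bsub>PGL2\<^esub> h)"
    have x: "x \<in> P1" and yx: "y = pact x h" using y h by (simp_all add: x_def P.act_closed)
    have "pact y (P.conjg g h) = pact (pact x g) h" if "g \<in> G" for g
    proof -
      have "pact y (P.conjg g h) = pact (pact (pact (pact x h) (inv\<^bsub>PGL2\<^esub> h)) g) h"
        using y h F.G_carrier[OF that] unfolding yx[symmetric] P.conjg_def by (simp add: P.act_mult P.act_closed)
      then show ?thesis using x h by simp
    qed
    then have "pact y ` ?H = (\<lambda>z. pact z h) ` (pact x ` G)" by (simp add: image_image cong: image_cong)
    moreover have "inj_on (\<lambda>z. pact z h) (pact x ` G)"
      by (rule inj_on_subset[OF P.act_inj[OF h]]) (use x F.G_carrier in \<open>auto simp: P.act_closed\<close>)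
    ultimately show "2 < card (pact y ` ?H)" using F.large[OF x] by (simp add: card_image)
  qed
  then interpret H: fin_pgl \<iota> ?H .
  have one: "P.conjg g h = \<one>\<^bsub>PGL2\<^esub> \<longleftrightarrow> g = \<one>\<^bsub>PGL2\<^esub>" if "g \<in> G" for g
    using F.G_carrier[OF that] h by simp
  have HG: "H.fp.\<Gamma> = {y. \<exists>g\<in>G. g \<noteq> \<one>\<^bsub>PGL2\<^esub> \<and> (\<lambda>x. pact x h) ` Fix P1 pact g = {y}}"
    unfolding H.fp.Gamma_eq by (simp add: one FixH cong: bex_cong)
  have FG: "F.fp.\<Gamma> = {y. \<exists>g\<in>G. g \<noteq> \<one>\<^bsub>PGL2\<^esub> \<and> Fix P1 pact g = {y}}"
    unfolding F.fp.Gamma_eq by simp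
  show "H.fp.\<Gamma> = (\<lambda>x. pact x h) ` F.fp.\<Gamma>"
  proof (intro equalityI subsetI)
    fix y assume "y \<in> H.fp.\<Gamma>"
    then obtain g where g: "g \<in> G" "g \<noteq> \<one>\<^bsub>PGL2\<^esub>" "(\<lambda>x. pact x h) ` Fix P1 pact g = {y}" unfolding HG by blast
    have "inj_on (\<lambda>z. pact z h) (Fix P1 pact g)" by (rule inj_on_subset[OF P.act_inj[OF h]]) (auto simp: Fix_def)
    then have "card (Fix P1 pact g) = 1" using g(3) card_image by fastforce
    then obtain x where x: "Fix P1 pact g = {x}" by (rule card_1_singletonE)
    then have "x \<in> F.fp.\<Gamma>" using g(1,2) unfolding FG by blast
    moreover have "y = pact x h" using g(3) unfolding x by simp
    ultimately show "y \<in> (\<lambda>x. pact x h) ` F.fp.\<Gamma>" by blast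
  next
    fix y assume "y \<in> (\<lambda>x. pact x h) ` F.fp.\<Gamma>"
    then obtain x g where "y = pact x h" "g \<in> G" "g \<noteq> \<one>\<^bsub>PGL2\<^esub>" "Fix P1 pact g = {x}" unfolding FG by blast
    then show "y \<in> H.fp.\<Gamma>" unfolding HG by (intro CollectI bexI[of _ g]) simp_all
  qed
  show "card ?H = card G"
    by (rule card_image, rule inj_on_subset[OF P.inj_on_conjg[OF h]]) (use F.G_carrier in blast)
qed

end

text \<open>Coordinates in which infinity, 0 and 1 lie in \<Gamma>: the point 1 is the image of 0
  under the translation, which fixes the scale.\<close>

locale normalized_pgl = fin_pgl +
  assumes inf_Gamma: "infpt \<in> fp.\<Gamma>" and zero_Gamma: "pt 0 \<in> fp.\<Gamma>" and translation_one: "mob 1 0 1 1 \<in> G"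

context fin_pgl
begin

lemma normalize:
  assumes x: "x \<in> fp.\<Gamma>" and y: "y \<in> fp.\<Gamma>" "x \<noteq> y"
  obtains h where "h \<in> carrier PGL2" "normalized_pgl \<iota> ((\<lambda>g. P.conjg g h) ` G)" "pact x h = infpt" "pact y h = pt 0"
proof -
  have xP: "x \<in> P1" and yP: "y \<in> P1" using x y by (simp_all add: fp.Gamma_iff)
  obtain k where k: "k \<in> carrier PGL2" "pact x k = infpt" "pact y k = pt 0"
    using move_to_inf_zero[OF subsetD[OF Gamma_rational x] subsetD[OF Gamma_rational y(1)] y(2)] .
  obtain u where u: "u \<in> fp.U x" "u \<noteq> \<one>\<^bsub>Gr\<^esub>" using x by (rule fp.Gamma_unipotent)
  then have uG: "u \<in> G" and uu: "Fix P1 pact u = {x}" and u1: "u \<noteq> \<one>\<^bsub>PGL2\<^esub>" by (auto simp: fp.U_def)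
  have uc: "u \<in> carrier PGL2" using uG by (rule G_carrier)
  have "Fix P1 pact (P.conjg u k) = {infpt}" using P.Fix_conjg[OF uc k(1)] uu k(2) by simp
  then obtain e where e: "P.conjg u k = mob 1 0 e 1"
    using unip_infE[of "P.conjg u k"] uc k(1) by (auto simp: unip_def)
  have "P.conjg u k \<noteq> \<one>\<^bsub>PGL2\<^esub>" using u1 uc k(1) by simp
  then have e0: "e \<noteq> 0" unfolding e by (auto simp: mob_eq_one_iff)
  \<comment> \<open>Conjugation by this dilation turns the translation by \<open>e\<close> into the
    translation by 1; infinity and 0 stay in place.\<close>
  let ?d = "mob (1 / e) 0 0 1"
  have d: "?d \<in> carrier PGL2" using e0 by (intro mob_in_PGL2) simp
  have inv_d: "inv\<^bsub>PGL2\<^esub> ?d = mob e 0 0 1"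
    using e0 by (intro P.inv_equality) (simp_all add: mob_mult one_PGL2 mob_in_PGL2)
  have cd: "P.conjg (mob 1 0 e 1) ?d = mob 1 0 1 1"
    unfolding P.conjg_def inv_d using e0 by (simp add: mob_mult)
  have dinf: "pact infpt ?d = infpt" and dzero: "pact (pt 0) ?d = pt 0" using e0 by (simp_all add: act_inf act_pt)
  let ?h = "k \<cdot> ?d"
  have h: "?h \<in> carrier PGL2" using k d by simp
  have hx: "pact x ?h = infpt" "pact y ?h = pt 0" using xP yP k d dinf dzero by (simp_all add: P.act_mult)
  have loc: "fin_pgl \<iota> G" by unfold_locales
  interpret H: fin_pgl \<iota> "(\<lambda>g. P.conjg g ?h) ` G" by (rule conj_fin_pgl(1)[OF loc h])
  have "P.conjg u ?h = mob 1 0 1 1" using uc k d cd e by (simp add: P.conjg_mult_right)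
  then have "mob 1 0 1 1 \<in> (\<lambda>g. P.conjg g ?h) ` G" using uG by (intro image_eqI[of _ _ u]) simp_all
  moreover have "infpt \<in> H.fp.\<Gamma>" "pt 0 \<in> H.fp.\<Gamma>" unfolding conj_fin_pgl(2)[OF loc h]
    using imageI[OF x, of "\<lambda>x. pact x ?h"] imageI[OF y(1), of "\<lambda>x. pact x ?h"] hx by simp_all
  ultimately have "normalized_pgl \<iota> ((\<lambda>g. P.conjg g ?h) ` G)" by unfold_locales
  then show ?thesis using that[OF h] hx by blast
qed

end

section \<open>Projective groups over finite subfields\<close>

text \<open>Multiplication by a nonzero element is injective on the finite set \<open>E\<close>,
  hence surjective, so 1 is attained.\<close>

lemma finite_subring_subfield:
  fixes E :: "'a::field set"
  assumes fin: "finite E" and one: "1 \<in> E"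
    and add: "\<And>x y. x \<in> E \<Longrightarrow> y \<in> E \<Longrightarrow> x + y \<in> E" and neg: "\<And>x. x \<in> E \<Longrightarrow> - x \<in> E"
    and mult: "\<And>x y. x \<in> E \<Longrightarrow> y \<in> E \<Longrightarrow> x * y \<in> E"
  shows "\<And>x. x \<in> E \<Longrightarrow> inverse x \<in> E" and "subfield E ring_of_type_algebra"
proof -
  show inverse: "inverse x \<in> E" if x: "x \<in> E" for x
  proof (cases "x = 0")
    case False
    have "(*) x ` E \<subseteq> E" using mult x by blast
    moreover have "inj_on ((*) x) E" using False by (auto intro: inj_onI)
    ultimately have "(*) x ` E = E" by (rule endo_inj_surj[OF fin])
    then obtain y where "y \<in> E" "1 = x * y" using one by blast
    then show ?thesis by (simp add: inverse_unique)
  qed (use x in simp)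
  interpret R: Ring.field "ring_of_type_algebra :: 'a ring" by (rule field_from_type_algebra)
  have carr: "carrier (ring_of_type_algebra :: 'a ring) = UNIV" and addR: "x \<oplus>\<^bsub>ring_of_type_algebra\<^esub> y = x + y"
    and mulR: "x \<otimes>\<^bsub>ring_of_type_algebra\<^esub> y = x * y" and oneR: "\<one>\<^bsub>ring_of_type_algebra\<^esub> = (1::'a)"
    and zeroR: "\<zero>\<^bsub>ring_of_type_algebra\<^esub> = (0::'a)" for x y :: 'a
    by (simp_all add: ring_of_type_algebra_def)
  have aminus: "\<ominus>\<^bsub>ring_of_type_algebra\<^esub> x = - x" for x :: 'a
    by (rule R.minus_equality) (simp_all add: carr addR zeroR)
  have zero: "0 \<in> E" using add[OF one neg[OF one]] by simp
  have "subring E ring_of_type_algebra"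
    by (rule R.subringI) (simp_all add: carr addR mulR oneR aminus one add neg mult)
  then show "subfield E ring_of_type_algebra"
  proof (rule R.subfieldI')
    fix k assume k: "k \<in> E - {\<zero>\<^bsub>ring_of_type_algebra\<^esub>}"
    then have "inv\<^bsub>ring_of_type_algebra\<^esub> k = inverse k"
      by (intro R.comm_inv_char) (simp_all add: carr mulR oneR zeroR)
    then show "inv\<^bsub>ring_of_type_algebra\<^esub> k \<in> E" using inverse k by simp
  qed
qed

context emb
begin

text \<open>In the coordinate x the map obtained is x \<mapsto> c / x.\<close>

lemma swap_form:
  assumes g: "g \<in> carrier PGL2" "pact infpt g = pt 0" "pact (pt 0) g = infpt"
  obtains c where "c \<noteq> 0" "g = mob 0 1 c 0"
proof -
  obtain a b c d where m: "g = mob a b c d" and det: "a * d - b * c \<noteq> 0" using g(1) by (rule PGL2_exhaust)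
  have "b \<noteq> 0" using g(2) unfolding m act_inf[OF det] by auto
  then have "a = 0" using g(2) unfolding m act_inf[OF det] by simp
  moreover have "d = 0" using g(3) unfolding m act_pt[OF det] by (auto split: if_splits)
  ultimately have "mob a b c d = mob 0 1 (c / b) 0" "c / b \<noteq> 0"
    using \<open>b \<noteq> 0\<close> det unfolding mob_eq_iff by (auto intro!: exI[of _ "1 / b"])
  then show ?thesis using m by (intro that[of "c / b"]) simp_all
qed

lemma stab_inf_form:
  assumes g: "g \<in> carrier PGL2" "pact infpt g = infpt"
  obtains a c where "a \<noteq> 0" "g = mob a 0 c 1"
proof -
  obtain a b c d where m: "g = mob a b c d" and det: "a * d - b * c \<noteq> 0" using g(1) by (rule PGL2_exhaust)
  have "b = 0" using g(2) fix_inf_iff[OF det] unfolding m by simp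
  then have "mob a b c d = mob (a / d) 0 (c / d) 1" "a / d \<noteq> 0"
    using det unfolding mob_eq_iff by (auto intro!: exI[of _ "1 / d"])
  then show ?thesis using m by (intro that[of "a / d" "c / d"]) simp_all
qed

text \<open>A Bruhat argument: both groups move any point of the finite orbit back to infinity by a
  translation followed by \<open>x \<mapsto> - 1 / x\<close>, so they are determined by their stabilizers of infinity.\<close>

lemma subgroup_le_of_stab_inf:
  assumes H: "subgroup H PGL2" and K: "subgroup K PGL2"
    and tr: "\<And>b. b \<in> E \<Longrightarrow> mob 1 0 (- b) 1 \<in> H \<inter> K" and J: "mob 0 (-1) 1 0 \<in> H \<inter> K"
    and orb: "\<And>g. g \<in> H \<Longrightarrow> pact infpt g = infpt \<or> (\<exists>b\<in>E. pact infpt g = pt (\<iota> b))"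
    and stab: "\<And>g. g \<in> H \<Longrightarrow> pact infpt g = infpt \<Longrightarrow> g \<in> K"
  shows "H \<subseteq> K"
proof
  fix g assume g: "g \<in> H"
  have gc: "g \<in> carrier PGL2" using subgroup.subset[OF H] g by blast
  from orb[OF g] show "g \<in> K"
  proof
    assume "\<exists>b\<in>E. pact infpt g = pt (\<iota> b)"
    then obtain b where b: "b \<in> E" "pact infpt g = pt (\<iota> b)" by blast
    let ?k = "mob 1 0 (- b) 1 \<cdot> mob 0 (-1) 1 0"
    have kH: "?k \<in> H" and kK: "?k \<in> K" using tr[OF b(1)] J H K by (simp_all add: subgroup.m_closed)
    have kc: "?k \<in> carrier PGL2" using subgroup.subset[OF H] kH by blast
    have "pact (pt (\<iota> b)) ?k = infpt"
      by (subst P.act_mult) (simp_all add: mob_in_PGL2 act_pt)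
    then have "pact infpt (g \<cdot> ?k) = infpt" using b(2) gc kc by (simp add: P.act_mult)
    then have "g \<cdot> ?k \<in> K" using stab subgroup.m_closed[OF H g kH] by blast
    then have "g \<cdot> ?k \<cdot> inv\<^bsub>PGL2\<^esub> ?k \<in> K"
      using subgroup.m_closed[OF K] subgroup.m_inv_closed[OF K kK] by blast
    then show "g \<in> K" using gc kc by (simp add: P.m_assoc)
  qed (rule stab[OF g])
qed

end

text \<open>A common form of both target groups: \<open>D = {1}\<close> gives PSL_2 over
  \<open>E\<close> and \<open>D = E - {0}\<close> gives PGL_2, so the comparison with
  \<open>G\<close> is carried out only once.\<close>

definition det_group :: "'a::field set \<Rightarrow> 'a set \<Rightarrow> ('a^2^2) set set"
  where "det_group E D = {mob a b c d | a b c d. a \<in> E \<and> b \<in> E \<and> c \<in> E \<and> d \<in> E \<and> a * d - b * c \<in> D}"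

lemma PSL2_over_eq: "PSL2_over E = det_group E {1}"
proof -
  have "SL2_over E = {mat2 a b c d | a b c d. a \<in> E \<and> b \<in> E \<and> c \<in> E \<and> d \<in> E \<and> a * d - b * c \<in> {1}}"
  proof (intro equalityI subsetI)
    fix A assume A: "A \<in> SL2_over E"
    obtain a b c d where "A = mat2 a b c d" by (rule mat2_exhaust)
    then show "A \<in> {mat2 a b c d | a b c d. a \<in> E \<and> b \<in> E \<and> c \<in> E \<and> d \<in> E \<and> a * d - b * c \<in> {1}}"
      using A by (auto simp: SL2_over_def forall_2)
  qed (auto simp: SL2_over_def forall_2)
  then show ?thesis unfolding PSL2_over_def det_group_def mob_def by (simp only:) blast
qed

lemma PGL2_over_eq:
  assumes inverse: "\<And>x. x \<in> E \<Longrightarrow> inverse x \<in> E" and neg: "\<And>x. x \<in> E \<Longrightarrow> - x \<in> E"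
    and add: "\<And>x y. x \<in> E \<Longrightarrow> y \<in> E \<Longrightarrow> x + y \<in> E" and mult: "\<And>x y. x \<in> E \<Longrightarrow> y \<in> E \<Longrightarrow> x * y \<in> E"
  shows "PGL2_over E = det_group E (E - {0})"
proof -
  have "GL2_over E = {mat2 a b c d | a b c d. a \<in> E \<and> b \<in> E \<and> c \<in> E \<and> d \<in> E \<and> a * d - b * c \<in> E - {0}}"
  proof (intro equalityI subsetI)
    fix A assume A: "A \<in> GL2_over E"
    obtain a b c d where m: "A = mat2 a b c d" by (rule mat2_exhaust)
    have E: "a \<in> E" "b \<in> E" "c \<in> E" "d \<in> E" using A unfolding m by (auto simp: GL2_over_def forall_2)
    have "invertible A" using A unfolding GL2_over_def invertible_def by blast
    then have "a * d - b * c \<noteq> 0" by (simp add: m)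
    moreover have "a * d - b * c \<in> E" using add[OF mult[OF E(1,4)] neg[OF mult[OF E(2,3)]]] by simp
    ultimately show "A \<in> {mat2 a b c d | a b c d. a \<in> E \<and> b \<in> E \<and> c \<in> E \<and> d \<in> E \<and> a * d - b * c \<in> E - {0}}"
      using m E by blast
  next
    fix A assume "A \<in> {mat2 a b c d | a b c d. a \<in> E \<and> b \<in> E \<and> c \<in> E \<and> d \<in> E \<and> a * d - b * c \<in> E - {0}}"
    then obtain a b c d where m: "A = mat2 a b c d" and E: "a \<in> E" "b \<in> E" "c \<in> E" "d \<in> E"
      and D: "a * d - b * c \<in> E" "a * d - b * c \<noteq> 0" by blast
    define r where "r = inverse (a * d - b * c)"
    have r: "r \<in> E" "r * (a * d - b * c) = 1" using inverse[OF D(1)] D(2) by (simp_all add: r_def)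
    let ?B = "mat2 (r * d) (- (r * b)) (- (r * c)) (r * a)"
    have "A ** ?B = mat 1" "?B ** A = mat 1"
      using r(2) unfolding m mat_eq_mat2 by (simp_all add: algebra_simps)
    moreover have "\<forall>i j. ?B $ i $ j \<in> E" using mult neg r E by (simp add: forall_2)
    moreover have "\<forall>i j. A $ i $ j \<in> E" using E by (simp add: forall_2 m)
    ultimately show "A \<in> GL2_over E" unfolding GL2_over_def by blast
  qed
  then show ?thesis unfolding PGL2_over_def det_group_def mob_def by (simp only:) blast
qed

lemma det_group_subgroup:
  assumes neg: "\<And>x. x \<in> E \<Longrightarrow> - x \<in> E"
    and add: "\<And>x y. x \<in> E \<Longrightarrow> y \<in> E \<Longrightarrow> x + y \<in> E" and mult: "\<And>x y. x \<in> E \<Longrightarrow> y \<in> E \<Longrightarrow> x * y \<in> E"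
    and one: "1 \<in> E" "1 \<in> D" and D: "0 \<notin> D" "\<And>x y. x \<in> D \<Longrightarrow> y \<in> D \<Longrightarrow> x * y \<in> D"
  shows "subgroup (det_group E D) PGL2"
proof -
  interpret PGL2: group PGL2 by (rule group_PGL2)
  have zero: "0 \<in> E" using add[OF one(1) neg[OF one(1)]] by simp
  show ?thesis
  proof (rule PGL2.subgroupI)
    show "det_group E D \<subseteq> carrier PGL2" using D(1) by (auto simp: det_group_def intro!: mob_in_PGL2)
    have "mob 1 0 0 1 \<in> det_group E D" unfolding det_group_def using one zero
      by (intro CollectI exI[of _ 1] exI[of _ 0] conjI) simp_all
    then show "det_group E D \<noteq> {}" by blast
  next
    fix g assume "g \<in> det_group E D"
    then obtain a b c d where m: "g = mob a b c d" and E: "a \<in> E" "b \<in> E" "c \<in> E" "d \<in> E"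
      and det: "a * d - b * c \<in> D" unfolding det_group_def by blast
    have nz: "a * d - b * c \<noteq> 0" using det D(1) by auto
    then have nz': "d * a - (- b) * (- c) \<noteq> 0" by (simp add: mult.commute)
    have "inv\<^bsub>PGL2\<^esub> g = mob d (- b) (- c) a"
    proof (rule PGL2.inv_equality)
      have "mob d (- b) (- c) a \<cdot> g = mob (a * d - b * c) 0 0 (a * d - b * c)"
        unfolding m mob_mult[OF nz' nz] by (simp add: algebra_simps)
      also have "\<dots> = \<one>\<^bsub>PGL2\<^esub>" using nz by (subst mob_eq_one_iff) simp_all
      finally show "mob d (- b) (- c) a \<cdot> g = \<one>\<^bsub>PGL2\<^esub>" .
    qed (use m nz nz' in \<open>auto intro: mob_in_PGL2\<close>)
    moreover have "d * a - (- b) * (- c) \<in> D" using det by (simp add: mult.commute)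
    ultimately show "inv\<^bsub>PGL2\<^esub> g \<in> det_group E D" unfolding det_group_def using E neg by blast
  next
    fix g h assume "g \<in> det_group E D" "h \<in> det_group E D"
    then obtain a b c d a' b' c' d' where m: "g = mob a b c d" "h = mob a' b' c' d'"
      and E: "a \<in> E" "b \<in> E" "c \<in> E" "d \<in> E" "a' \<in> E" "b' \<in> E" "c' \<in> E" "d' \<in> E"
      and det: "a * d - b * c \<in> D" "a' * d' - b' * c' \<in> D" unfolding det_group_def by blast
    have "a * d - b * c \<noteq> 0" "a' * d' - b' * c' \<noteq> 0" using det D(1) by auto
    then have gh: "g \<cdot> h = mob (a * a' + b * c') (a * b' + b * d') (c * a' + d * c') (c * b' + d * d')"
      unfolding m by (rule mob_mult)
    have "(a * a' + b * c') * (c * b' + d * d') - (a * b' + b * d') * (c * a' + d * c') = (a * d - b * c) * (a' * d' - b' * c')"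
      by (simp add: algebra_simps)
    then have "(a * a' + b * c') * (c * b' + d * d') - (a * b' + b * d') * (c * a' + d * c') \<in> D"
      using D(2)[OF det] by simp
    moreover have "a * a' + b * c' \<in> E" "a * b' + b * d' \<in> E" "c * a' + d * c' \<in> E" "c * b' + d * d' \<in> E"
      using E add mult by simp_all
    ultimately show "g \<cdot> h \<in> det_group E D" unfolding det_group_def gh by blast
  qed
qed

text \<open>Squaring is at most two-to-one, as x^2 = s^2 has only the solutions s and - s.\<close>

lemma card_squares:
  fixes S :: "'a::field set"
  assumes "finite S"
  shows "card S \<le> 2 * card ((\<lambda>x. x * x) ` S)"
proof -
  have "S \<subseteq> (\<Union>y\<in>(\<lambda>x. x * x) ` S. {x \<in> S. x * x = y})" by blast
  then have "card S \<le> card (\<Union>y\<in>(\<lambda>x. x * x) ` S. {x \<in> S. x * x = y})" using assms by (intro card_mono) auto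
  also have "\<dots> \<le> (\<Sum>y\<in>(\<lambda>x. x * x) ` S. card {x \<in> S. x * x = y})" using assms by (intro card_UN_le) simp
  also have "\<dots> \<le> (\<Sum>y\<in>(\<lambda>x. x * x) ` S. 2)"
  proof (rule sum_mono)
    fix y assume "y \<in> (\<lambda>x. x * x) ` S"
    then obtain s where s: "y = s * s" by blast
    have "{x \<in> S. x * x = y} \<subseteq> {s, - s}"
    proof
      fix x assume "x \<in> {x \<in> S. x * x = y}"
      then have "(x - s) * (x + s) = 0" by (simp add: s algebra_simps)
      then show "x \<in> {s, - s}" by (auto simp: eq_neg_iff_add_eq_0)
    qed
    then have "card {x \<in> S. x * x = y} \<le> card {s, - s}" by (intro card_mono) auto
    also have "\<dots> \<le> 2" by (simp add: card_insert_if)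
    finally show "card {x \<in> S. x * x = y} \<le> 2" .
  qed
  finally show ?thesis by simp
qed

section \<open>The linear case\<close>

context normalized_pgl
begin

text \<open>\<open>E\<close> collects the translations x \<mapsto> x + b in \<open>G\<close>, and
  \<open>M\<close> the dilations x \<mapsto> a x. At first \<open>E\<close> is only an additive
  group on which the multiplicative group \<open>M\<close> acts.\<close>

definition E where "E = {b. mob 1 0 b 1 \<in> G}"
definition M where "M = {a. a \<noteq> 0 \<and> mob a 0 0 1 \<in> G}"

lemma G_mult: "g \<in> G \<Longrightarrow> h \<in> G \<Longrightarrow> g \<cdot> h \<in> G"
  by (rule subgroup.m_closed[OF G_subgroup])

lemma G_inv: "g \<in> G \<Longrightarrow> inv\<^bsub>PGL2\<^esub> g \<in> G"
  by (rule subgroup.m_inv_closed[OF G_subgroup])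

lemma G_one: "mob 1 0 0 1 \<in> G"
  using subgroup.one_closed[OF G_subgroup] by (simp add: one_PGL2)

lemma inv_translation: "inv\<^bsub>PGL2\<^esub> (mob 1 0 b 1) = mob 1 0 (- b) (1::'a)"
  by (rule P.inv_equality) (simp_all add: mob_mult one_PGL2 mob_in_PGL2)

lemma inv_dilation: "a \<noteq> 0 \<Longrightarrow> inv\<^bsub>PGL2\<^esub> (mob a 0 0 1) = mob (1 / a) 0 0 (1::'a)"
  by (rule P.inv_equality) (simp_all add: mob_mult one_PGL2 mob_in_PGL2)

lemma E_one: "1 \<in> E" and E_zero: "0 \<in> E" and M_one: "1 \<in> M"
  using translation_one G_one by (simp_all add: E_def M_def)

lemma E_add: "b \<in> E \<Longrightarrow> c \<in> E \<Longrightarrow> b + c \<in> E"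
  using G_mult[of "mob 1 0 b 1" "mob 1 0 c 1"] by (simp add: E_def mob_mult)

lemma E_neg: "b \<in> E \<Longrightarrow> - b \<in> E"
  using G_inv[of "mob 1 0 b 1"] by (simp add: E_def inv_translation)

lemma M_nz: "a \<in> M \<Longrightarrow> a \<noteq> 0"
  by (simp add: M_def)

lemma M_mult: "a \<in> M \<Longrightarrow> b \<in> M \<Longrightarrow> a * b \<in> M"
  using G_mult[of "mob a 0 0 1" "mob b 0 0 1"] by (simp add: M_def mob_mult)

lemma M_inv: "a \<in> M \<Longrightarrow> 1 / a \<in> M"
  using G_inv[of "mob a 0 0 1"] by (simp add: M_def inv_dilation)

lemma ME: assumes a: "a \<in> M" and b: "b \<in> E" shows "a * b \<in> E"
proof -
  have "mob (1 / a) 0 0 1 \<cdot> mob 1 0 b 1 \<cdot> mob a 0 0 1 \<in> G"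
    using M_inv[OF a] a b by (intro G_mult) (simp_all add: M_def E_def)
  moreover have "mob (1 / a) 0 0 1 \<cdot> mob 1 0 b 1 \<cdot> mob a 0 0 1 = mob 1 0 (a * b) 1"
    using M_nz[OF a] by (simp add: mob_mult mult.commute)
  ultimately show ?thesis by (simp add: E_def)
qed

lemma M_subset: "M \<subseteq> E - {0}"
  using ME[OF _ E_one] M_nz by auto

lemma U_inf: "fp.U infpt = (\<lambda>b. mob 1 0 b 1) ` E"
proof (intro equalityI subsetI)
  fix g assume "g \<in> fp.U infpt"
  then have g: "g \<in> G" "unip infpt g" by (simp_all add: fp_U_iff)
  obtain c where "g = mob 1 0 c 1" using unip_infE[OF G_carrier[OF g(1)] g(2)] .
  then show "g \<in> (\<lambda>b. mob 1 0 b 1) ` E" using g by (auto simp: E_def)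
next
  fix g assume "g \<in> (\<lambda>b. mob 1 0 b 1) ` E"
  then obtain b where "g = mob 1 0 b 1" "g \<in> G" by (auto simp: E_def)
  then show "g \<in> fp.U infpt" using unip_inf_iff[of 1 1 0 b] by (simp add: fp_U_iff unip_def)
qed

lemma card_E: "card E = card (fp.U infpt)"
  unfolding U_inf by (rule card_image[symmetric]) (auto intro!: inj_onI simp: mob_eq_iff)

lemma finite_E: "finite E"
proof -
  have "finite ((\<lambda>b. mob 1 0 b 1) ` E)" unfolding U_inf[symmetric] by (rule fp.finite_U)
  moreover have "inj_on (\<lambda>b. mob 1 0 b 1) E" by (auto intro!: inj_onI simp: mob_eq_iff)
  ultimately show ?thesis by (rule finite_imageD)
qed

lemma Gamma_act': "x \<in> fp.\<Gamma> \<Longrightarrow> g \<in> G \<Longrightarrow> pact x g \<in> fp.\<Gamma>"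
  using fp.Gamma_act[of x g] by simp

lemma translate_Gamma: assumes "b \<in> E" "pt (\<iota> x) \<in> fp.\<Gamma>" shows "pt (\<iota> (x + b)) \<in> fp.\<Gamma>"
  using Gamma_act'[OF assms(2), of "mob 1 0 b 1"] assms(1) by (simp add: E_def act_pt)

lemma E_Gamma: "b \<in> E \<Longrightarrow> pt (\<iota> b) \<in> fp.\<Gamma>"
  using translate_Gamma[of b 0] zero_Gamma by simp

lemma finite_Gamma: "finite fp.\<Gamma>"
  using fp.Gamma_orbit[OF inf_Gamma] fp.finite_orb by simp

lemma Gamma_transitive: assumes "x \<in> fp.\<Gamma>" "y \<in> fp.\<Gamma>" obtains g where "g \<in> G" "pact x g = y"
  using fp.Gamma_orbit[OF assms(1)] assms(2) by auto

text \<open>An element g that takes infinity to 0 is preceded by the translation that takes 0 to the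
  preimage of infinity under g; the product interchanges 0 and infinity. The assumption
  \<open>nb\<close> says that \<open>G\<close> contains this translation, and each of the two cases
  verifies it in its own way.\<close>

lemma exists_swap:
  assumes nb: "\<And>y g. y \<in> fp.\<Gamma> \<Longrightarrow> g \<in> G \<Longrightarrow> pact infpt g = pt 0 \<Longrightarrow> pact y g = infpt \<Longrightarrow> \<exists>b\<in>E. y = pt (\<iota> b)"
  obtains c where "c \<noteq> 0" "mob 0 1 c 0 \<in> G"
proof -
  obtain g where g: "g \<in> G" "pact infpt g = pt 0" using Gamma_transitive[OF inf_Gamma zero_Gamma] .
  have gc: "g \<in> carrier PGL2" by (rule G_carrier[OF g(1)])
  have y: "pact infpt (inv\<^bsub>PGL2\<^esub> g) \<in> fp.\<Gamma>" by (rule Gamma_act'[OF inf_Gamma G_inv[OF g(1)]])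
  have "pact (pact infpt (inv\<^bsub>PGL2\<^esub> g)) g = infpt" using gc by simp
  then obtain b where b: "b \<in> E" "pact infpt (inv\<^bsub>PGL2\<^esub> g) = pt (\<iota> b)" using nb[OF y g] by blast
  have bg: "pact (pt (\<iota> b)) g = infpt" using P.act_inv_cancel(2)[OF pt_in_P1(2) gc] b(2) by simp
  let ?t = "mob 1 0 b 1"
  have t: "?t \<in> G" using b(1) by (simp add: E_def)
  have tc: "?t \<in> carrier PGL2" by (rule G_carrier[OF t])
  have w: "?t \<cdot> g \<in> G" by (rule G_mult[OF t g(1)])
  have "pact infpt (?t \<cdot> g) = pt 0" "pact (pt 0) (?t \<cdot> g) = infpt"
    using g(2) bg gc tc by (simp_all add: P.act_mult act_inf act_pt)
  from swap_form[OF G_carrier[OF w] this] obtain c where "c \<noteq> 0" "?t \<cdot> g = mob 0 1 c 0" .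
  then show ?thesis using w by (intro that[of c]) simp_all
qed

text \<open>Conjugation by the involution x \<mapsto> c / x turns a translation into a unipotent
  element that fixes 0 instead of infinity.\<close>

lemma lower_translation:
  assumes c: "c \<noteq> 0" "mob 0 1 c 0 \<in> G" and b: "b \<in> E"
  shows "mob 1 (b / c) 0 1 \<in> G"
proof -
  have "mob 0 1 c 0 \<cdot> mob 1 0 b 1 \<cdot> mob 0 1 c 0 \<in> G"
    using c b by (intro G_mult) (simp_all add: E_def)
  moreover have "mob 0 1 c 0 \<cdot> mob 1 0 b 1 \<cdot> mob 0 1 c 0 = mob c b 0 c"
    using c by (simp add: mob_mult)
  moreover have "mob c b 0 c = mob 1 (b / c) 0 1" using c unfolding mob_eq_iff by (intro exI[of _ "1 / c"]) simp
  ultimately show ?thesis by simp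
qed

text \<open>By counting, \<Gamma> consists of infinity and the points of \<open>E\<close>, and |M| =
  d. The Bruhat argument then reduces the identification of \<open>G\<close> to showing that
  \<open>M\<close> consists of all nonzero elements of \<open>E\<close> or of the nonzero
  squares.\<close>

theorem linear_case:
  assumes q: "3 \<le> q" "card (fp.U infpt) = q" "card (A.stab infpt) = q * d" "card fp.\<Gamma> = q + 1"
    and d: "d = q - 1 \<or> 2 * d = q - 1"
  shows "\<exists>E. finite E \<and> subfield E ring_of_type_algebra \<and> fp.\<Gamma> = P1_over \<iota> E \<and> card E = q \<and>
    (G = PSL2_over E \<or> G = PGL2_over E)"
proof -
  have cE: "card E = q" using card_E q(2) by simp
  have Gam: "fp.\<Gamma> = insert infpt ((\<lambda>b. pt (\<iota> b)) ` E)"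
  proof (rule card_subset_eq[OF finite_Gamma, symmetric])
    show "insert infpt ((\<lambda>b. pt (\<iota> b)) ` E) \<subseteq> fp.\<Gamma>" using inf_Gamma E_Gamma by blast
    have "inj_on (\<lambda>b. pt (\<iota> b)) E" by (auto intro: inj_onI)
    then show "card (insert infpt ((\<lambda>b. pt (\<iota> b)) ` E)) = card fp.\<Gamma>"
      using q(4) cE finite_E by (subst card_insert_disjoint) (auto simp: card_image)
  qed
  have inE: "x \<in> E" if "pt (\<iota> x) \<in> fp.\<Gamma>" for x using that unfolding Gam by auto
  \<comment> \<open>A map x \<mapsto> a x + c in \<open>G\<close> takes 0 to c, which therefore lies
    in \<open>E\<close>; so the stabilizer is the product of the dilations and the
    translations.\<close>
  have stab: "A.stab infpt = (\<lambda>(a, b). mob a 0 b 1) ` (M \<times> E)"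
  proof (intro equalityI subsetI)
    fix g assume "g \<in> A.stab infpt"
    then have g: "g \<in> G" "pact infpt g = infpt" by (simp_all add: stab_Gr_iff)
    obtain a c where ac: "a \<noteq> 0" "g = mob a 0 c 1" using stab_inf_form[OF G_carrier[OF g(1)] g(2)] .
    have "pact (pt 0) g = pt (\<iota> c)" using ac by (simp add: act_pt)
    then have c: "c \<in> E" using Gamma_act'[OF zero_Gamma g(1)] by (intro inE) simp
    then have "g \<cdot> mob 1 0 (- c) 1 \<in> G" using E_neg[OF c] g(1) by (intro G_mult) (simp_all add: E_def)
    then have "a \<in> M" using ac by (simp add: mob_mult M_def)
    then show "g \<in> (\<lambda>(a, b). mob a 0 b 1) ` (M \<times> E)" using ac c by (intro image_eqI[of _ _ "(a, c)"]) simp_all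
  next
    fix g assume "g \<in> (\<lambda>(a, b). mob a 0 b 1) ` (M \<times> E)"
    then obtain a b where ab: "a \<in> M" "b \<in> E" "g = mob a 0 b 1" by auto
    have "mob a 0 0 1 \<cdot> mob 1 0 b 1 \<in> G" using ab by (intro G_mult) (simp_all add: M_def E_def)
    then have "g \<in> G" using ab M_nz[OF ab(1)] by (simp add: mob_mult)
    then show "g \<in> A.stab infpt" using ab M_nz[OF ab(1)] by (simp add: stab_Gr_iff act_inf)
  qed
  have finM: "finite M" using M_subset finite_E finite_subset by blast
  have "inj_on (\<lambda>(a, b). mob a 0 b 1) (M \<times> E)" by (auto intro!: inj_onI simp: mob_eq_iff)
  then have "card M * q = q * d" using q(3) cE unfolding stab by (simp add: card_image card_cartesian_product)
  then have cM: "card M = d" using q(1) by simp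
  obtain c where c: "c \<noteq> 0" "mob 0 1 c 0 \<in> G"
  proof (rule exists_swap)
    fix y g assume y: "y \<in> fp.\<Gamma>" and g: "pact infpt g = pt 0" "pact y g = infpt"
    then have "y \<noteq> infpt" by auto
    then show "\<exists>b\<in>E. y = pt (\<iota> b)" using y unfolding Gam by blast
  qed
  have cinE: "c \<in> E"
  proof (rule inE)
    have "pact (pt (\<iota> 1)) (mob 0 1 c 0) = pt (\<iota> c)" using c(1) by (simp add: act_pt)
    then show "pt (\<iota> c) \<in> fp.\<Gamma>" using Gamma_act'[OF E_Gamma[OF E_one] c(2)] by simp
  qed
  \<comment> \<open>As c lies in \<open>E\<close>, the translation by - c is available to be
    conjugated by the swap. With the unit translation u, the product u L u is x \<mapsto> - 1 /
    x.\<close>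
  have L: "mob 1 (- 1) 0 1 \<in> G" using lower_translation[OF c E_neg[OF cinE]] c(1) by simp
  have J: "mob 0 (- 1) 1 0 \<in> G"
  proof -
    have "mob 1 0 1 1 \<cdot> mob 1 (- 1) 0 1 \<cdot> mob 1 0 1 1 \<in> G"
      by (intro G_mult translation_one L)
    then show ?thesis by (simp add: mob_mult)
  qed
  have mult: "x * y \<in> E" if "x \<in> E" "y \<in> E" for x y
  proof -
    \<comment> \<open>The multipliers of \<open>E\<close> form an additive subgroup that contains 0
      and \<open>M\<close>, hence at least d + 1 > q / 2 elements. A proper subgroup would have a
      disjoint translate inside \<open>E\<close>.\<close>
    define S where "S = {x \<in> E. \<forall>y\<in>E. x * y \<in> E}"
    have SE: "S \<subseteq> E" by (auto simp: S_def)
    have finS: "finite S" using SE finite_E by (rule finite_subset)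
    have "insert 0 M \<subseteq> S" using M_subset ME E_zero by (auto simp: S_def)
    then have "card (insert 0 M) \<le> card S" using finS by (intro card_mono)
    then have cS: "q < 2 * card S" using cM d q(1) finM M_nz by (subst (asm) card_insert_disjoint) auto
    have Sdiff: "u - v \<in> S" if "u \<in> S" "v \<in> S" for u v
    proof -
      have "u - v \<in> E" using E_add[OF _ E_neg] that SE by fastforce
      moreover have "(u - v) * y \<in> E" if "y \<in> E" for y
        using E_add[OF _ E_neg, of "u * y" "v * y"] that \<open>u \<in> S\<close> \<open>v \<in> S\<close> by (simp add: S_def left_diff_distrib)
      ultimately show ?thesis by (simp add: S_def)
    qed
    have "E \<subseteq> S"
    proof (rule subsetI, rule ccontr)
      fix z assume z: "z \<in> E" "z \<notin> S"
      have "S \<inter> (+) z ` S = {}"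
      proof (rule ccontr)
        assume "S \<inter> (+) z ` S \<noteq> {}"
        then obtain u where "u \<in> S" "z + u \<in> S" by blast
        then have "z \<in> S" using Sdiff[of "z + u" u] by simp
        then show False using z(2) by simp
      qed
      then have "card (S \<union> (+) z ` S) = 2 * card S"
        using finS by (subst card_Un_disjoint) (simp_all add: card_image)
      moreover have "card (S \<union> (+) z ` S) \<le> card E"
        using SE E_add[OF z(1)] by (intro card_mono finite_E) auto
      ultimately show False using cS cE by simp
    qed
    then show ?thesis using that by (auto simp: S_def)
  qed
  have inverse: "inverse x \<in> E" if "x \<in> E" for x
    by (rule finite_subring_subfield(1)[OF finite_E E_one]) (fact E_add E_neg mult that)+
  have subf: "subfield E ring_of_type_algebra"
    by (rule finite_subring_subfield(2)[OF finite_E E_one]) (fact E_add E_neg mult)+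
  have G_orb: "pact infpt g = infpt \<or> (\<exists>b\<in>E. pact infpt g = pt (\<iota> b))" if "g \<in> G" for g
    using Gamma_act'[OF inf_Gamma that] unfolding Gam by blast
  have det_orb: "pact infpt g = infpt \<or> (\<exists>b\<in>E. pact infpt g = pt (\<iota> b))" if g: "g \<in> det_group E D" "0 \<notin> D" for g D
  proof -
    obtain a b c d where m: "g = mob a b c d" and e: "a \<in> E" "b \<in> E" and det: "a * d - b * c \<in> D"
      using g(1) unfolding det_group_def by blast
    have nz: "a * d - b * c \<noteq> 0" using det g(2) by auto
    have "a / b \<in> E" using mult[OF e(1) inverse[OF e(2)]] by (simp add: divide_inverse)
    then show ?thesis unfolding m act_inf[OF nz] by (auto simp flip: emb_divide)
  qed
  \<comment> \<open>By the Bruhat argument only the stabilizers of infinity need to be compared;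
    \<open>le\<close> and \<open>ge\<close> provide the two inclusions.\<close>
  have eqI: "G = det_group E D"
    if D: "1 \<in> D" "0 \<notin> D" "\<And>x y. x \<in> D \<Longrightarrow> y \<in> D \<Longrightarrow> x * y \<in> D"
      and le: "\<And>a b. a \<in> M \<Longrightarrow> b \<in> E \<Longrightarrow> mob a 0 b 1 \<in> det_group E D"
      and ge: "\<And>a b d. a \<in> E \<Longrightarrow> b \<in> E \<Longrightarrow> d \<in> E \<Longrightarrow> a * d \<in> D \<Longrightarrow> a / d \<in> M" for D
  proof -
    have sub: "subgroup (det_group E D) PGL2"
      by (rule det_group_subgroup) (use E_neg E_add mult E_one D in auto)
    have tr: "mob 1 0 (- b) 1 \<in> G \<inter> det_group E D" if "b \<in> E" for b
      using E_neg[OF that] le[OF M_one E_neg[OF that]] by (simp add: E_def)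
    have "mob 0 (- 1) 1 0 \<in> det_group E D" unfolding det_group_def
      using E_zero E_one E_neg[OF E_one] D(1)
      by (intro CollectI exI[of _ 0] exI[of _ "- 1"] exI[of _ 1] conjI refl) simp_all
    then have J': "mob 0 (- 1) 1 0 \<in> G \<inter> det_group E D" using J by blast
    show ?thesis
    proof
      show "G \<subseteq> det_group E D"
      proof (rule subgroup_le_of_stab_inf[OF G_subgroup sub tr J' G_orb])
        fix g assume "g \<in> G" "pact infpt g = infpt"
        then have "g \<in> A.stab infpt" by (simp add: stab_Gr_iff)
        then show "g \<in> det_group E D" using le unfolding stab by auto
      qed
      show "det_group E D \<subseteq> G"
      proof (rule subgroup_le_of_stab_inf[OF sub G_subgroup _ _ det_orb[OF _ D(2)]])
        fix g assume g: "g \<in> det_group E D" "pact infpt g = infpt"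
        then obtain a b c d where m: "g = mob a b c d" and e: "a \<in> E" "c \<in> E" "d \<in> E" and det: "a * d - b * c \<in> D"
          unfolding det_group_def by blast
        have nz: "a * d - b * c \<noteq> 0" using det D(2) by auto
        have b: "b = 0" using g(2) fix_inf_iff[OF nz] unfolding m by simp
        have d0: "d \<noteq> 0" using nz b by auto
        have "a / d \<in> M" by (rule ge[OF e(1,2,3)]) (use det b in simp)
        moreover have "c / d \<in> E" using mult[OF e(2) inverse[OF e(3)]] by (simp add: divide_inverse)
        moreover have "g = mob (a / d) 0 (c / d) 1" unfolding m b mob_eq_iff using d0 by (intro exI[of _ "1 / d"]) simp
        ultimately have "g \<in> A.stab infpt" unfolding stab by blast
        then show "g \<in> G" by (simp add: stab_Gr_iff)
      qed (use tr J' in auto)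
    qed
  qed
  have "G = PSL2_over E \<or> G = PGL2_over E"
    using d
  proof
    assume "d = q - 1"
    then have MEq: "M = E - {0}" using cM cE M_subset finite_E E_zero by (intro card_subset_eq) simp_all
    have "G = det_group E (E - {0})"
    proof (rule eqI)
      show "mob a 0 b 1 \<in> det_group E (E - {0})" if "a \<in> M" "b \<in> E" for a b
        unfolding det_group_def using that M_subset E_zero E_one
        by (intro CollectI exI[of _ a] exI[of _ 0] exI[of _ b] exI[of _ 1] conjI) auto
      show "a / d \<in> M" if "a \<in> E" "d \<in> E" "a * d \<in> E - {0}" for a d
        unfolding MEq using that mult[OF that(1) inverse[OF that(2)]] by (simp add: divide_inverse)
    qed (use E_one mult in auto)
    moreover have "PGL2_over E = det_group E (E - {0})"
      by (rule PGL2_over_eq) (use inverse E_neg E_add mult in auto)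
    ultimately show ?thesis by simp
  next
    assume d2: "2 * d = q - 1"
    \<comment> \<open>The subgroup \<open>M\<close> has index two in the nonzero elements, so for x
      outside \<open>M\<close> these are covered by M and x M. A square x^2 outside \<open>M\<close>
      would lie in x M, and then x would lie in \<open>M\<close>.\<close>
    have sq: "x * x \<in> M" if x: "x \<in> E - {0}" for x
    proof (rule ccontr)
      assume nx: "x * x \<notin> M"
      then have xM: "x \<notin> M" using M_mult by blast
      have "M \<inter> (*) x ` M = {}"
      proof (rule ccontr)
        assume "M \<inter> (*) x ` M \<noteq> {}"
        then obtain a where a: "a \<in> M" "x * a \<in> M" by blast
        then have "(x * a) * (1 / a) \<in> M" using M_inv M_mult by blast
        then show False using xM M_nz[OF a(1)] by simp
      qed
      moreover have "inj_on ((*) x) M" using x by (auto intro: inj_onI)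
      ultimately have "card (M \<union> (*) x ` M) = card (E - {0})"
        using finM cM d2 cE E_zero finite_E by (subst card_Un_disjoint) (simp_all add: card_image)
      moreover have "M \<union> (*) x ` M \<subseteq> E - {0}" using M_subset x mult by auto
      ultimately have "M \<union> (*) x ` M = E - {0}" using finite_E by (intro card_subset_eq) simp_all
      moreover have "x * x \<in> E - {0}" using x mult by simp
      ultimately have "x * x \<in> (*) x ` M" using nx by blast
      then show False using x xM by auto
    qed
    have MEq: "M = (\<lambda>x. x * x) ` (E - {0})"
    proof (rule sym, rule card_subset_eq[OF finM])
      show sub: "(\<lambda>x. x * x) ` (E - {0}) \<subseteq> M" using sq by blast
      have "card (E - {0}) \<le> 2 * card ((\<lambda>x. x * x) ` (E - {0}))" using finite_E by (intro card_squares) simp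
      then have "card M \<le> card ((\<lambda>x. x * x) ` (E - {0}))" using cM d2 cE E_zero finite_E by simp
      then show "card ((\<lambda>x. x * x) ` (E - {0})) = card M" using card_mono[OF finM sub] by simp
    qed
    have "G = det_group E {1}"
    proof (rule eqI)
      show "mob a 0 b 1 \<in> det_group E {1}" if ab: "a \<in> M" "b \<in> E" for a b
      proof -
        obtain s where s: "s \<in> E" "s \<noteq> 0" "a = s * s" using ab(1) unfolding MEq by blast
        \<comment> \<open>Dividing the matrix by the square root s of a makes the determinant
          1.\<close>
        have "mob a 0 b 1 = mob s 0 (b / s) (1 / s)" unfolding mob_eq_iff s(3) using s(2) by (intro exI[of _ "1 / s"]) simp
        moreover have "b / s \<in> E" "1 / s \<in> E" using mult[OF ab(2) inverse[OF s(1)]] inverse[OF s(1)] by (simp_all add: divide_inverse)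
        ultimately show ?thesis unfolding det_group_def using s E_zero
          by (intro CollectI exI[of _ s] exI[of _ 0] exI[of _ "b / s"] exI[of _ "1 / s"] conjI) simp_all
      qed
      show "a / d \<in> M" if "a \<in> E" "d \<in> E" "a * d \<in> {1}" for a d
      proof -
        have ad: "a * d = 1" using that(3) by simp
        then have "a \<noteq> 0" "d \<noteq> 0" by auto
        moreover have "a = a * a * d" using ad by (simp add: mult.assoc)
        ultimately have "a / d = a * a" by (simp add: divide_eq_eq)
        then show ?thesis unfolding MEq using that(1) \<open>a \<noteq> 0\<close> by blast
      qed
    qed simp_all
    then show ?thesis by (simp add: PSL2_over_eq)
  qed
  moreover have "fp.\<Gamma> = P1_over \<iota> E" unfolding Gam P1_over_def by blast
  ultimately show ?thesis using finite_E subf cE by blast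
qed

end

section \<open>The exceptional group in characteristic three\<close>

context normalized_pgl
begin

text \<open>The translations form the prime field, and \<open>t0\<close> provides the map x
  \<mapsto> - x. For a swap x \<mapsto> c / x the points x + y c with x, y in the prime field
  account for all nine finite points of \<Gamma>. Once c is known, two generators suffice to recover
  all of \<open>G\<close>.\<close>

theorem exceptional_case:
  assumes Gam: "fp.\<Gamma> \<in> fp.NR" "fp.NR - {fp.\<Gamma>} = {\<Delta>}" "card G = 60" "card fp.\<Gamma> = 10" "card \<Delta> = 12"
    and Ux: "\<And>x. x \<in> fp.\<Gamma> \<Longrightarrow> card (fp.U x) = 3" and Sx: "\<And>x. x \<in> fp.\<Gamma> \<Longrightarrow> card (A.stab x) = 6"
    and char: "CHAR('a) = 3"
    and t0: "\<exists>t. t \<in> A.stab infpt \<inter> A.stab (pt 0) \<and> t \<noteq> \<one>\<^bsub>PGL2\<^esub>"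
  shows "\<exists>E i. finite E \<and> subfield E ring_of_type_algebra \<and> fp.\<Gamma> = P1_over \<iota> E \<and> card E = 9 \<and>
    i\<^sup>2 = - 1 \<and> G = A5_bar i \<and> Gr \<cong> alt_group 5"
proof -
  have three: "(3::'a) = 0" using of_nat_CHAR[where 'a = 'a] unfolding char by simp
  have n2: "(2::'a) = - 1" using three by (simp add: eq_neg_iff_add_eq_0)
  have one_ne: "(1::'a) \<noteq> - 1"
  proof
    assume "(1::'a) = - 1"
    then have "(3::'a) = 1" using n2 three by simp
    then show False using three by simp
  qed
  have triple: "x + x + x = 0" for x :: 'a
  proof -
    have "x + x + x = (1 + 1 + 1) * x" by (simp only: distrib_right mult_1_left)
    also have "(1 + 1 + 1 :: 'a) = 0" using three by simp
    finally show ?thesis by simp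
  qed
  have dbl: "x + x = - x" for x :: 'a using triple[of x] by (simp add: eq_neg_iff_add_eq_0)
  have exc: "Gr \<cong> alt_group 5"
    "\<And>z t. z \<in> fp.\<Gamma> \<Longrightarrow> t \<in> A.stab z - fp.U z \<Longrightarrow> t \<otimes>\<^bsub>Gr\<^esub> t = \<one>\<^bsub>Gr\<^esub>"
    "\<And>t. t \<in> carrier Gr \<Longrightarrow> t \<noteq> \<one>\<^bsub>Gr\<^esub> \<Longrightarrow> t \<otimes>\<^bsub>Gr\<^esub> t = \<one>\<^bsub>Gr\<^esub> \<Longrightarrow> card (Fix P1 pact t) = 2 \<and> Fix P1 pact t \<subseteq> fp.\<Gamma>"
    "\<And>g. g \<in> carrier Gr \<Longrightarrow> g [^]\<^bsub>Gr\<^esub> (4::nat) = \<one>\<^bsub>Gr\<^esub> \<Longrightarrow> g \<otimes>\<^bsub>Gr\<^esub> g = \<one>\<^bsub>Gr\<^esub>"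
    using fp.iso_alt_group_5_exceptional[OF Gam(1,2) _ Gam(4,5) Ux Sx] Gam(3) by simp_all
  have cE: "card E = 3" using card_E Ux[OF inf_Gamma] by simp
  have E3: "E = {0, 1, - 1}"
  proof (rule card_subset_eq[OF finite_E, symmetric])
    show "{0, 1, - 1} \<subseteq> E" using E_zero E_one E_neg[OF E_one] by simp
    show "card {0, 1, - 1 :: 'a} = card E" using cE one_ne by simp
  qed
  \<comment> \<open>The element from \<open>t0\<close> has the form x \<mapsto> a x and is not
    unipotent, so its square is trivial and a = - 1.\<close>
  have t: "mob (- 1) 0 0 1 \<in> G"
  proof -
    obtain t where t: "t \<in> G" "pact infpt t = infpt" "pact (pt 0) t = pt 0" "t \<noteq> \<one>\<^bsub>PGL2\<^esub>"
      using t0 by (auto simp: stab_Gr_iff)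
    obtain a c where ac: "a \<noteq> 0" "t = mob a 0 c 1" using stab_inf_form[OF G_carrier[OF t(1)] t(2)] .
    have "c = 0" using t(3) ac by (simp add: act_pt)
    then have ta: "t = mob a 0 0 1" using ac by simp
    then have a1: "a \<noteq> 1" using t(4) by (auto simp: one_PGL2)
    have "t \<notin> fp.U infpt" using a1 ac(1) unfolding U_inf ta by (auto simp: mob_eq_iff)
    then have "t \<cdot> t = \<one>\<^bsub>PGL2\<^esub>" using exc(2)[OF inf_Gamma, of t] t(1,2) by (simp add: stab_Gr_iff)
    then have "a * a = 1" using ac(1) unfolding ta by (simp add: mob_mult mob_eq_one_iff)
    then have "(a - 1) * (a + 1) = 0" by (simp add: algebra_simps)
    then have "a = - 1" using a1 by (simp add: eq_neg_iff_add_eq_0)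
    then show ?thesis using t(1) ta by simp
  qed
  have stab: "A.stab infpt = (\<lambda>(a, b). mob a 0 b 1) ` ({1, - 1} \<times> E)"
  proof (rule card_subset_eq[OF fp.finite_stab, symmetric])
    show "(\<lambda>(a, b). mob a 0 b 1) ` ({1, - 1} \<times> E) \<subseteq> A.stab infpt"
    proof
      fix g assume "g \<in> (\<lambda>(a, b). mob a 0 b 1) ` ({1, - 1} \<times> E)"
      then obtain a b where ab: "a = 1 \<or> a = - 1" "b \<in> E" "g = mob a 0 b 1" by auto
      have "mob a 0 0 1 \<cdot> mob 1 0 b 1 \<in> G" using ab t G_one by (intro G_mult) (auto simp: E_def)
      then have "g \<in> G" using ab by (auto simp: mob_mult)
      then show "g \<in> A.stab infpt" using ab by (auto simp: stab_Gr_iff act_inf)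
    qed
    have "inj_on (\<lambda>(a, b). mob a 0 b 1) ({1, - 1} \<times> E)" by (auto intro!: inj_onI simp: mob_eq_iff)
    then show "card ((\<lambda>(a, b). mob a 0 b 1) ` ({1, - 1} \<times> E)) = card (A.stab infpt)"
      using Sx[OF inf_Gamma] cE one_ne by (simp add: card_image card_cartesian_product)
  qed
  \<comment> \<open>The map x \<mapsto> - x + b fixes the point with 2 x = b, which in
    characteristic three is x = - b.\<close>
  have nbr: "\<exists>b\<in>E. y = pt (\<iota> b)"
    if y: "y \<in> fp.\<Gamma>" "y \<noteq> infpt" and g: "g \<in> A.stab infpt" "g \<noteq> \<one>\<^bsub>PGL2\<^esub>" "pact y g = y" for y g
  proof -
    obtain x where x: "y = pt (\<iota> x)" using y Gamma_rational by (auto simp: P1_over_def)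
    obtain a b where ab: "a = 1 \<or> a = - 1" "b \<in> E" "g = mob a 0 b 1" using g(1) unfolding stab by auto
    have eq: "x * a + b = x"
    proof -
      have "\<iota> x * \<iota> a + \<iota> b = \<iota> x" using g(3) ab(1) unfolding x ab(3) by (auto simp: fix_pt_iff)
      then show ?thesis by (simp flip: emb_simps(1,2))
    qed
    have "a \<noteq> 1"
    proof
      assume "a = 1"
      then have "b = 0" using eq by simp
      then show False using g(2) \<open>a = 1\<close> ab(3) by (simp add: one_PGL2)
    qed
    then have "b = x + x" using ab(1) eq by (auto simp: algebra_simps)
    then have "x = - b" using dbl[of x] by simp
    then show ?thesis using x E_neg[OF ab(2)] by blast
  qed
  obtain c where c: "c \<noteq> 0" "mob 0 1 c 0 \<in> G"
  proof (rule exists_swap)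
    fix y g assume y: "y \<in> fp.\<Gamma>" and g: "g \<in> G" "pact infpt g = pt 0" "pact y g = infpt"
    let ?t = "mob (- 1) 0 0 (1::'a)"
    have tc: "?t \<in> carrier PGL2" and gc: "g \<in> carrier PGL2" using t g(1) G_carrier by auto
    \<comment> \<open>Conjugating x \<mapsto> - x by the inverse of \<open>g\<close> gives a
      nontrivial element of \<open>G\<close> that fixes infinity and y, so \<open>nbr\<close>
      applies.\<close>
    let ?h = "P.conjg ?t (inv\<^bsub>PGL2\<^esub> g)"
    have yP: "y \<in> P1" using y by (simp add: fp.Gamma_iff)
    have gi: "pact (pt 0) (inv\<^bsub>PGL2\<^esub> g) = infpt" "pact infpt (inv\<^bsub>PGL2\<^esub> g) = y"
      using P.act_inv_cancel(1)[OF pt_in_P1(2) gc] P.act_inv_cancel(1)[OF yP gc] g(2,3) by simp_all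
    have ft: "pact infpt ?t = infpt" "pact (pt 0) ?t = pt 0" by (simp_all add: act_inf act_pt)
    have hG: "?h \<in> G" unfolding P.conjg_def using t g(1) by (intro G_mult G_inv)
    have hinf: "pact infpt ?h = infpt" unfolding P.conjg_def using gc tc gi ft g(2) by (simp add: P.act_mult P.act_closed)
    have hy: "pact y ?h = y" unfolding P.conjg_def using gc tc gi ft g(3) yP by (simp add: P.act_mult P.act_closed)
    have "?t \<noteq> \<one>\<^bsub>PGL2\<^esub>" using one_ne by (simp add: mob_eq_one_iff)
    then have h1: "?h \<noteq> \<one>\<^bsub>PGL2\<^esub>" using tc gc by simp
    have "y \<noteq> infpt" using g(2,3) by auto
    then show "\<exists>b\<in>E. y = pt (\<iota> b)" using nbr[OF y _ _ h1 hy] hG hinf by (simp add: stab_Gr_iff)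
  qed
  have mc: "mob 0 1 (- c) 0 \<in> G"
  proof -
    have "mob (- 1) 0 0 1 \<cdot> mob 0 1 c 0 \<in> G" using t c(2) by (rule G_mult)
    moreover have "mob (- 1) 0 0 1 \<cdot> mob 0 1 c 0 = mob 0 (- 1) c 0" using c(1) by (simp add: mob_mult)
    moreover have "mob 0 (- 1) c 0 = mob 0 1 (- c) (0::'a)" unfolding mob_eq_iff by (intro exI[of _ "- 1"]) simp
    ultimately show ?thesis by simp
  qed
  \<comment> \<open>For c = 1 or c = - 1 the group would contain x \<mapsto> 1 / (x + 1), which in
    characteristic three has order 4.\<close>
  have c1: "c \<noteq> 1 \<and> c \<noteq> - 1"
  proof (rule ccontr)
    assume "\<not> ?thesis"
    then have w: "mob 0 1 1 0 \<in> G" using c mc by auto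
    have gG: "mob 0 1 1 1 \<in> G" using G_mult[OF translation_one w] by (simp add: mob_mult)
    define g where "g = mob 0 1 1 (1::'a)"
    have gg: "g \<cdot> g = mob 1 1 1 (- 1)" unfolding g_def by (simp add: mob_mult n2)
    have nz: "- 1 - 1 \<noteq> (0::'a)" using one_ne by (simp add: algebra_simps)
    have "(g \<cdot> g) \<cdot> (g \<cdot> g) = \<one>\<^bsub>PGL2\<^esub>"
    proof -
      have det: "1 * (- 1) - 1 * 1 \<noteq> (0::'a)" using nz by simp
      have two: "(1 + 1 :: 'a) \<noteq> 0" using one_ne by (simp add: eq_neg_iff_add_eq_0)
      have "mob 1 1 1 (- 1) \<cdot> mob 1 1 1 (- 1) = mob (1 + 1) 0 0 (1 + 1 :: 'a)"
        unfolding mob_mult[OF det det] by simp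
      also have "\<dots> = \<one>\<^bsub>PGL2\<^esub>"
      proof -
        have "(1 + 1) * (1 + 1) - 0 * 0 \<noteq> (0::'a)"
          using no_zero_divisors[OF two two] by (simp only: mult_zero_left diff_0_right not_False_eq_True)
        from mob_eq_one_iff[OF this] show ?thesis by blast
      qed
      finally show ?thesis unfolding gg .
    qed
    moreover have "g [^]\<^bsub>PGL2\<^esub> (4::nat) = (g \<cdot> g) \<cdot> (g \<cdot> g)"
      using G_carrier[OF gG] by (simp add: g_def[symmetric] numeral_eq_Suc P.m_assoc)
    ultimately have "g \<cdot> g = \<one>\<^bsub>PGL2\<^esub>" using exc(4)[of g] gG by (simp add: g_def[symmetric] pow_Gr)
    then show False unfolding gg using nz by (simp add: mob_eq_one_iff)
  qed
  have cnE: "c \<notin> E" using c(1) c1 by (simp add: E3)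
  \<comment> \<open>In the end the field with nine elements; before c is known to be a root of - 1
    only an additive group.\<close>
  define K where "K = (\<lambda>(x, y). x + y * c) ` (E \<times> E)"
  have K_iff: "z \<in> K \<longleftrightarrow> (\<exists>x\<in>E. \<exists>y\<in>E. z = x + y * c)" for z by (auto simp: K_def)
  have E_mult: "x * y \<in> E" if "x \<in> E" "y \<in> E" for x y using that by (auto simp: E3)
  have injK: "inj_on (\<lambda>(x, y). x + y * c) (E \<times> E)"
  proof (rule inj_onI, clarify)
    fix x y x' y' assume e: "x \<in> E" "y \<in> E" "x' \<in> E" "y' \<in> E" and eq: "x + y * c = x' + y' * c"
    have eq': "(y - y') * c = x' - x" using eq by (simp add: algebra_simps)
    have sq: "z = 0 \<or> z * z = 1" if "z \<in> E" for z using that by (auto simp: E3)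
    have d: "y - y' \<in> E" "x' - x \<in> E" using E_add[OF _ E_neg] e by (metis add_uminus_conv_diff)+
    have "y - y' = 0"
    proof (rule ccontr)
      assume "y - y' \<noteq> 0"
      then have "(y - y') * (y - y') = 1" using sq d by blast
      then have "c = (y - y') * (x' - x)" unfolding eq'[symmetric] by (simp flip: mult.assoc)
      then show False using E_mult d cnE by blast
    qed
    then show "x = x' \<and> y = y'" using eq by simp
  qed
  have cK: "card K = 9" unfolding K_def using injK cE by (simp add: card_image card_cartesian_product)
  \<comment> \<open>The points c and - c are the images of 1 under x \<mapsto> c / x and x \<mapsto>
    - c / x.\<close>
  have c_Gam: "pt (\<iota> c) \<in> fp.\<Gamma>" using Gamma_act'[OF E_Gamma[OF E_one] c(2)] c(1) by (simp add: act_pt)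
  have mc_Gam: "pt (\<iota> (- c)) \<in> fp.\<Gamma>" using Gamma_act'[OF E_Gamma[OF E_one] mc] c(1) by (simp add: act_pt)
  have K_Gam: "pt (\<iota> z) \<in> fp.\<Gamma>" if z: "z \<in> K" for z
  proof -
    obtain x y where xy: "x \<in> E" "y \<in> E" "z = x + y * c" using z unfolding K_iff by blast
    have "pt (\<iota> (y * c)) \<in> fp.\<Gamma>" using xy(2) zero_Gamma c_Gam mc_Gam by (auto simp: E3)
    from translate_Gamma[OF xy(1) this] show ?thesis unfolding xy(3) by (simp only: add.commute)
  qed
  have finK: "finite K" unfolding K_def using finite_E by simp
  have GamK: "fp.\<Gamma> = insert infpt ((\<lambda>b. pt (\<iota> b)) ` K)"
  proof (rule card_subset_eq[OF finite_Gamma, symmetric])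
    show "insert infpt ((\<lambda>b. pt (\<iota> b)) ` K) \<subseteq> fp.\<Gamma>" using inf_Gamma K_Gam by blast
    have "inj_on (\<lambda>b. pt (\<iota> b)) K" by (auto intro: inj_onI)
    then show "card (insert infpt ((\<lambda>b. pt (\<iota> b)) ` K)) = card fp.\<Gamma>"
      using Gam(4) cK finK by (subst card_insert_disjoint) (auto simp: card_image)
  qed
  have root: "\<exists>r\<in>K. r * r = c"
  proof -
    let ?w = "mob 0 1 c 0"
    have w1: "?w \<noteq> \<one>\<^bsub>PGL2\<^esub>" using c(1) by (simp add: mob_eq_one_iff)
    have "?w \<cdot> ?w = \<one>\<^bsub>PGL2\<^esub>" using c(1) by (simp add: mob_mult mob_eq_one_iff)
    then have F: "Fix P1 pact ?w \<subseteq> fp.\<Gamma>" using exc(3)[of ?w] c(2) w1 by simp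
    obtain x where x: "x \<in> Fix P1 pact ?w" using has_fixed_point[OF c(2)] by blast
    have "x \<noteq> infpt" using x c(1) by (auto simp: Fix_def fix_inf_iff)
    then obtain r where r: "r \<in> K" "x = pt (\<iota> r)" using F x unfolding GamK by auto
    have "\<iota> c = \<iota> r * \<iota> r" using x c(1) unfolding r(2) by (simp add: Fix_def fix_pt_iff)
    then have "r * r = c" by (simp flip: emb_simps(2))
    then show ?thesis using r(1) by blast
  qed
  \<comment> \<open>Up to sign the root of c has the form c + b with b in the prime field. Then b =
    0 gives c = 1, and b = 1 gives (c - 1)^2 = 0, both excluded. For b = - 1 the equation reads c^2
    + 1 = 0.\<close>
  have c_sq: "c * c = - 1"
  proof -
    obtain r where r: "r \<in> K" "r * r = c" using root by blast
    then obtain x y where xy: "x \<in> E" "y \<in> E" "r = x + y * c" unfolding K_iff by blast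
    have xy_sq: "(x + y * c) * (x + y * c) = c" using r(2) unfolding xy(3) .
    have "y \<noteq> 0"
    proof
      assume "y = 0"
      then have "c \<in> E" using xy_sq E_mult[OF xy(1) xy(1)] by simp
      then show False using cnE by simp
    qed
    then have yy: "y = 1 \<or> y = - 1" using xy(2) by (simp add: E3)
    then have "(c + x * y) * (c + x * y) = c" using xy_sq by (auto simp: algebra_simps)
    moreover have "x * y \<in> E" using E_mult xy(1,2) by blast
    ultimately obtain b where b: "b \<in> E" "(c + b) * (c + b) = c" by blast
    have cc: "c + c = - c" by (rule dbl)
    from b(1) consider "b = 0" | "b = 1" | "b = - 1" by (auto simp: E3)
    then show ?thesis
    proof cases
      case 1
      then show ?thesis using b(2) c(1) c1 by simp
    next
      case 2
      have "(c - 1) * (c - 1) = (c + 1) * (c + 1) - c - (c + c + c)" by (simp add: algebra_simps)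
      also have "\<dots> = 0" using b(2) 2 triple[of c] by simp
      finally show ?thesis using c1 by simp
    next
      case 3
      have "c * c + 1 = (c - 1) * (c - 1) - c + (c + c + c)" by (simp add: algebra_simps)
      also have "\<dots> = 0" using b(2) 3 triple[of c] by simp
      finally show ?thesis by (simp add: eq_neg_iff_add_eq_0)
    qed
  qed
  have K_add: "u + v \<in> K" if uv: "u \<in> K" "v \<in> K" for u v
  proof -
    obtain x y x' y' where "x \<in> E" "y \<in> E" "x' \<in> E" "y' \<in> E" "u = x + y * c" "v = x' + y' * c"
      using uv unfolding K_iff by blast
    then show ?thesis unfolding K_iff using E_add
      by (intro bexI[of _ "x + x'"] bexI[of _ "y + y'"]) (auto simp: algebra_simps)
  qed
  have K_neg: "- u \<in> K" if u: "u \<in> K" for u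
  proof -
    obtain x y where "x \<in> E" "y \<in> E" "u = x + y * c" using u unfolding K_iff by blast
    then show ?thesis unfolding K_iff using E_neg by (intro bexI[of _ "- x"] bexI[of _ "- y"]) auto
  qed
  have K_mult: "u * v \<in> K" if uv: "u \<in> K" "v \<in> K" for u v
  proof -
    obtain x y x' y' where e: "x \<in> E" "y \<in> E" "x' \<in> E" "y' \<in> E" and eq: "u = x + y * c" "v = x' + y' * c"
      using uv unfolding K_iff by blast
    have "u * v = x * x' + y * y' * (c * c) + (x * y' + y * x') * c" unfolding eq by (simp add: algebra_simps)
    then have "u * v = (x * x' + - (y * y')) + (x * y' + y * x') * c" by (simp add: c_sq)
    moreover have "x * x' + - (y * y') \<in> E" by (rule E_add[OF E_mult[OF e(1,3)] E_neg[OF E_mult[OF e(2,4)]]])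
    moreover have "x * y' + y * x' \<in> E" by (rule E_add[OF E_mult[OF e(1,4)] E_mult[OF e(2,3)]])
    ultimately show ?thesis unfolding K_iff by blast
  qed
  have K_one: "1 \<in> K" unfolding K_iff using E_one E_zero by (intro bexI[of _ 1] bexI[of _ 0]) auto
  have subf: "subfield K ring_of_type_algebra"
    by (rule finite_subring_subfield(2)[OF finK K_one]) (fact K_add K_neg K_mult)+
  have ci: "- (1 / c) = c" using c_sq c(1) by (simp add: field_simps)
  \<comment> \<open>As - 1 / c = c, conjugating the translation by - 1 with the swap gives the
    second generator.\<close>
  have low: "mob 1 c 0 1 \<in> G"
    using lower_translation[OF c E_neg[OF E_one]] ci by simp
  define u where "u = mob 1 0 1 (1::'a)"
  define l where "l = mob 1 c 0 1"
  have uG: "u \<in> G" and lG: "l \<in> G" using translation_one low by (simp_all add: u_def l_def)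
  define H where "H = A5_bar c"
  have gens: "{vector [vector [1, 0], vector [1, 1]], vector [vector [1, c], vector [0, 1]]} = {mat2 1 0 1 1, mat2 1 c 0 (1::'a)}"
    by (simp add: mat2_def)
  have gens_sub: "{mat2 1 0 1 1, mat2 1 c 0 (1::'a)} \<subseteq> carrier GL2" by simp
  have A5: "subgroup (A5 c) GL2" unfolding A5_def gens
    by (rule group.generate_is_subgroup[OF group_GL2 gens_sub])
  have to_hom: "group_hom GL2 PGL2 to_PGL2"
    by (rule group_hom.intro)
      (auto simp: group_GL2 group_PGL2 group_hom_axioms_def hom_def to_PGL2_mult carrier_PGL2)
  have H_sub: "subgroup H PGL2" unfolding H_def A5_bar_def
    by (rule group_hom.subgroup_img_is_subgroup[OF to_hom A5])
  have "mat2 1 0 1 1 \<in> A5 c" "mat2 1 c 0 1 \<in> A5 c" unfolding A5_def gens by (auto intro: generate.incl)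
  then have uH: "u \<in> H" and lH: "l \<in> H" by (auto simp: H_def A5_bar_def u_def l_def mob_def)
  have HG: "H \<subseteq> G"
  proof -
    have "to_PGL2 A \<in> G" if "A \<in> generate GL2 {mat2 1 0 1 1, mat2 1 c 0 (1::'a)}" for A
      using that
    proof induction
      case one
      then show ?case using subgroup.one_closed[OF G_subgroup] by (simp add: to_PGL2_one)
    next
      case (incl A)
      then show ?case using uG lG by (auto simp: u_def l_def mob_def)
    next
      case (inv A)
      then have "to_PGL2 A \<in> G" using uG lG by (auto simp: u_def l_def mob_def)
      moreover have "A \<in> carrier GL2" using inv gens_sub by blast
      then have "to_PGL2 (inv\<^bsub>GL2\<^esub> A) = inv\<^bsub>PGL2\<^esub> (to_PGL2 A)" by (rule group_hom.hom_inv[OF to_hom])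
      ultimately show ?case using G_inv by simp
    next
      case (eng A B)
      then have "A \<in> carrier GL2" "B \<in> carrier GL2"
        using group.generate_in_carrier[OF group_GL2 gens_sub] by blast+
      then show ?case using eng.IH G_mult by (simp add: to_PGL2_mult)
    qed
    then show ?thesis unfolding H_def A5_bar_def A5_def gens by blast
  qed
  have H_mult: "g \<cdot> h \<in> H" if "g \<in> H" "h \<in> H" for g h by (rule subgroup.m_closed[OF H_sub that])
  have H_inv: "inv\<^bsub>PGL2\<^esub> g \<in> H" if "g \<in> H" for g by (rule subgroup.m_inv_closed[OF H_sub that])
  have uiH: "mob 1 0 (- 1) 1 \<in> H" using H_inv[OF uH] by (simp add: u_def inv_translation)
  have liH: "mob 1 (- c) 0 1 \<in> H"
  proof -
    have "inv\<^bsub>PGL2\<^esub> l = mob 1 (- c) 0 1" unfolding l_def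
      by (rule P.inv_equality) (simp_all add: mob_mult one_PGL2 mob_in_PGL2)
    then show ?thesis using H_inv[OF lH] by simp
  qed
  have trH: "mob 1 0 b 1 \<in> H" if "b \<in> E" for b
    using that uH uiH subgroup.one_closed[OF H_sub] by (auto simp: E3 u_def one_PGL2)
  have tH: "mob (- 1) 0 0 1 \<in> H"
    \<comment> \<open>the word \<open>u l u\<^sup>-\<^sup>1 l\<^sup>-\<^sup>1 u l\<close>, found by a search in \<open>SL\<^sub>2(9)\<close>\<close>
  proof -
    have 1: "u \<cdot> l = mob 1 c 1 (c + 1)" unfolding u_def l_def by (simp add: mob_mult)
    have 2: "mob 1 0 (- 1) 1 \<cdot> mob 1 (- c) 0 1 = mob 1 (- c) (- 1) (c + 1)" by (simp add: mob_mult)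
    have d: "1 * (c + 1) - c * 1 \<noteq> (0::'a)" "1 * (c + 1) - (- c) * (- 1) \<noteq> (0::'a)" by simp_all
    have "mob 1 c 1 (c + 1) \<cdot> mob 1 (- c) (- 1) (c + 1) \<cdot> mob 1 c 1 (c + 1) \<in> H"
      using H_mult[OF uH lH] H_mult[OF uiH liH] unfolding 1 2 by (intro H_mult)
    moreover have "mob 1 c 1 (c + 1) \<cdot> mob 1 (- c) (- 1) (c + 1) = mob (1 - c) (c * c) (- c) (c * c + c + 1)"
      unfolding mob_mult[OF d] by (simp add: algebra_simps)
    moreover have "mob (1 - c) (c * c) (- c) (c * c + c + 1) \<cdot> mob 1 c 1 (c + 1) = mob (- c) 0 0 c"
    proof -
      have nz: "(1 - c) * c - (- 1) * (- c) \<noteq> 0" using c_sq by (simp add: algebra_simps)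
      have "(1 - c) * c + (- 1) * (c + 1) = 0" using c_sq by (simp add: algebra_simps)
      then show ?thesis using mob_mult[OF nz d(1)] by (simp add: c_sq algebra_simps)
    qed
    moreover have "mob (- c) 0 0 c = mob (- 1) 0 0 (1::'a)" unfolding mob_eq_iff using c(1) by (intro exI[of _ "1 / c"]) simp
    ultimately show ?thesis by simp
  qed
  have stabH: "A.stab infpt \<subseteq> H"
  proof
    fix g assume "g \<in> A.stab infpt"
    then obtain a b where ab: "a = 1 \<or> a = - 1" "b \<in> E" "g = mob a 0 b 1" unfolding stab by auto
    have "mob a 0 0 1 \<in> H" using ab(1) tH subgroup.one_closed[OF H_sub] by (auto simp: one_PGL2)
    then have "mob a 0 0 1 \<cdot> mob 1 0 b 1 \<in> H" using trH[OF ab(2)] by (rule H_mult)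
    then show "g \<in> H" using ab by (auto simp: mob_mult)
  qed
  \<comment> \<open>The points that \<open>H\<close> moves to infinity. Once they include \<Gamma>,
    each element of \<open>G\<close> can be corrected by an element of \<open>H\<close> to fix
    infinity, and that stabilizer is already contained in \<open>H\<close>.\<close>
  define R where "R = {x \<in> P1. \<exists>k\<in>H. pact x k = infpt}"
  have R_back: "x \<in> R" if x: "x \<in> P1" and k: "k \<in> H" "pact x k \<in> R" for x k
  proof -
    obtain h where h: "h \<in> H" "pact (pact x k) h = infpt" using k(2) by (auto simp: R_def)
    have "pact x (k \<cdot> h) = infpt" using h x k(1) HG G_carrier by (subst P.act_mult) auto
    then show ?thesis using x H_mult[OF k(1) h(1)] by (auto simp: R_def)
  qed
  have inf_R: "infpt \<in> R" using subgroup.one_closed[OF H_sub] P.act_one[OF pt_in_P1(2)] by (auto simp: R_def)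
  \<comment> \<open>The generator \<open>l\<close> is x \<mapsto> x / (c x + 1), and c^2 + 1 = 0
    makes c its pole.\<close>
  have c_R: "pt (\<iota> c) \<in> R" 
  proof (rule R_back[OF pt_in_P1(1) lH])
    have "pact (pt (\<iota> c)) l = infpt" unfolding l_def using c_sq by (simp add: act_pt flip: emb_simps(2))
    then show "pact (pt (\<iota> c)) l \<in> R" using inf_R by simp
  qed
  have mc_R: "pt (\<iota> (- c)) \<in> R"
  proof (rule R_back[OF pt_in_P1(1) liH])
    have "pact (pt (\<iota> (- c))) (mob 1 (- c) 0 1) = infpt" using c_sq by (simp add: act_pt flip: emb_simps(2))
    then show "pact (pt (\<iota> (- c))) (mob 1 (- c) 0 1) \<in> R" using inf_R by simp
  qed
  have tr_R: "pt (\<iota> (x + b)) \<in> R" if "pt (\<iota> x) \<in> R" "b \<in> E" for x b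
  proof (rule R_back[OF pt_in_P1(1) trH[OF E_neg[OF that(2)]]])
    show "pact (pt (\<iota> (x + b))) (mob 1 0 (- b) 1) \<in> R" using that(1) by (simp add: act_pt)
  qed
  \<comment> \<open>Since (c + 1) (c - 1) = c^2 - 1 = - 2 = 1, the generator \<open>l\<close> takes
    1 to c - 1, a translate of c.\<close>
  have one_R: "pt (\<iota> 1) \<in> R"
  proof (rule R_back[OF pt_in_P1(1) lH])
    have nz: "c + 1 \<noteq> 0" using c1 by (simp add: eq_neg_iff_add_eq_0)
    have "(c + 1) * (c + - 1) = 1" using c_sq n2 by (simp add: algebra_simps)
    then have "1 / (c + 1) = c + - 1" using nz by (simp add: field_simps)
    moreover have "pact (pt (\<iota> 1)) l = pt (\<iota> (1 / (c + 1)))"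
    proof -
      have "\<iota> c + 1 \<noteq> 0" using emb_simps(5)[of "c + 1"] nz by simp
      then show ?thesis unfolding l_def by (simp add: act_pt)
    qed
    ultimately have "pact (pt (\<iota> 1)) l = pt (\<iota> (c + - 1))" by simp
    then show "pact (pt (\<iota> 1)) l \<in> R" using tr_R[OF c_R E_neg[OF E_one]] by simp
  qed
  have zero_R: "pt (\<iota> 0) \<in> R" using tr_R[OF one_R E_neg[OF E_one]] by simp
  have Gam_R: "fp.\<Gamma> \<subseteq> R"
  proof
    fix x assume "x \<in> fp.\<Gamma>"
    then consider "x = infpt" | z where "z \<in> K" "x = pt (\<iota> z)" unfolding GamK by blast
    then show "x \<in> R"
    proof cases
      case (2 z)
      then obtain a b where ab: "a \<in> E" "b \<in> E" "z = a + b * c" unfolding K_iff by blast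
      have "pt (\<iota> (b * c)) \<in> R" using ab(2) zero_R c_R mc_R by (auto simp: E3)
      from tr_R[OF this ab(1)] show ?thesis unfolding 2 ab(3) by (simp only: add.commute)
    qed (use inf_R in simp)
  qed
  have "G \<subseteq> H"
  proof
    fix g assume g: "g \<in> G"
    then have "pact infpt g \<in> R" using Gamma_act'[OF inf_Gamma] Gam_R by blast
    then obtain k where k: "k \<in> H" "pact (pact infpt g) k = infpt" by (auto simp: R_def)
    have kG: "k \<in> G" using k(1) HG by blast
    have gc: "g \<in> carrier PGL2" and kc: "k \<in> carrier PGL2" using g kG G_carrier by auto
    have "pact infpt (g \<cdot> k) = infpt" using k(2) gc kc by (simp add: P.act_mult)
    then have "g \<cdot> k \<in> H" using stabH G_mult[OF g kG] by (auto simp: stab_Gr_iff)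
    then have "g \<cdot> k \<cdot> inv\<^bsub>PGL2\<^esub> k \<in> H" using H_inv[OF k(1)] by (rule H_mult)
    then show "g \<in> H" using gc kc by (simp add: P.m_assoc)
  qed
  then have "G = A5_bar c" using HG by (simp add: H_def)
  moreover have "c\<^sup>2 = - 1" using c_sq by (simp add: power2_eq_square)
  moreover have "fp.\<Gamma> = P1_over \<iota> K" unfolding GamK P1_over_def by blast
  ultimately show ?thesis using finK subf cK exc(1) by blast
qed

end

section \<open>The classification\<close>

theorem theoremA:
  fixes \<iota> :: "'a::field \<Rightarrow> 'b::field"
    and G :: "('a^2^2) set set"
    and \<Gamma> :: "('b^2) set set"
  assumes "field_embedding \<iota>"
    and "subgroup G PGL2" and "finite G"
    and "\<forall>g\<in>G. Fix P1 (P1_act \<iota>) g \<noteq> {}"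
    and "\<Gamma> = {\<gamma> \<in> P1. \<exists>g \<in> G - {\<one>\<^bsub>PGL2\<^esub>}. {\<gamma>} = Fix P1 (P1_act \<iota>) g}"
  shows
    "(\<exists>Y \<in> orbit_set (PGL2\<lparr>carrier := G\<rparr>) P1 (P1_act \<iota>). card Y = 1 \<or> card Y = 2)
     \<or>
     (\<not> CHAR('a) dvd card G \<and> \<Gamma> = {} \<and> platonic (PGL2\<lparr>carrier := G\<rparr>) P1 (P1_act \<iota>))
     \<or>
     (CHAR('a) dvd card G \<and>
      \<Gamma> \<in> orbit_set (PGL2\<lparr>carrier := G\<rparr>) P1 (P1_act \<iota>) \<and>
      (\<exists>\<Delta>. nonregular_orbits (PGL2\<lparr>carrier := G\<rparr>) P1 (P1_act \<iota>) - {\<Gamma>} = {\<Delta>} \<and>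
        (\<exists>E :: 'a set. \<exists>h \<in> carrier PGL2.
          finite E \<and> subfield E ring_of_type_algebra \<and>
          (\<lambda>\<gamma>. P1_act \<iota> \<gamma> h) ` \<Gamma> = P1_over \<iota> E \<and>
          (let G' = (\<lambda>g. inv\<^bsub>PGL2\<^esub> h \<otimes>\<^bsub>PGL2\<^esub> g \<otimes>\<^bsub>PGL2\<^esub> h) ` G in
            ((G' = PSL2_over E \<or> G' = PGL2_over E) \<and> card \<Delta> = card E * (card E - 1))
            \<or>
            (CHAR('a) = 3 \<and>
             (\<exists>i :: 'a. i\<^sup>2 = - 1 \<and> G' = A5_bar i \<and>
                PGL2\<lparr>carrier := A5_bar i\<rparr> \<cong> alt_group 5) \<and>
             card E = 9 \<and> card \<Delta> = 12)))))"
proof (cases "\<exists>Y \<in> orbit_set (PGL2\<lparr>carrier := G\<rparr>) P1 (P1_act \<iota>). card Y = 1 \<or> card Y = 2")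
  case False
  interpret emb \<iota> by unfold_locales fact
  have large: "2 < card (pact x ` G)" if x: "x \<in> P1" for x
  proof -
    have "pact x ` G \<in> orbit_set (PGL2\<lparr>carrier := G\<rparr>) P1 pact" using x by (auto simp: orbit_set_def)
    then have "card (pact x ` G) \<noteq> 1" "card (pact x ` G) \<noteq> 2" using False by blast+
    moreover have "card (pact x ` G) \<noteq> 0" using assms(3) subgroup.one_closed[OF assms(2)] by auto
    ultimately show ?thesis by linarith
  qed
  have loc: "fin_pgl \<iota> G"
    by (intro fin_pgl.intro fin_pgl_axioms.intro emb_axioms) (use assms large in auto)
  interpret fin_pgl \<iota> G by (rule loc)
  have Gam: "\<Gamma> = fp.\<Gamma>" unfolding assms(5) fp.\<Gamma>_def by simp
  show ?thesis
  proof (cases "\<Gamma> = {}")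
    case True
    have "\<not> CHAR('a) dvd card G"
    proof (cases "CHAR('a) = 0")
      case True
      then show ?thesis using card_pos by simp
    next
      case False
      then have "prime CHAR('a)" by (intro prime_CHAR_semidom) simp
      then show ?thesis using fp.coprime_card_G \<open>\<Gamma> = {}\<close> Gam by simp
    qed
    then show ?thesis using True fp.platonic_no_unipotents Gam by simp
  next
    case nonempty: False
    then obtain x where x: "x \<in> fp.\<Gamma>" using Gam by blast
    have dvd: "CHAR('a) dvd card G" using fp.p_dvd_card_G[OF x] by simp
    have ne: "fp.\<Gamma> \<noteq> {}" using x by blast
    obtain q d and \<Delta> :: "('b^2) set set" where NR: "fp.\<Gamma> \<in> fp.NR" "fp.NR - {fp.\<Gamma>} = {\<Delta>}"
      and q: "\<And>x. x \<in> fp.\<Gamma> \<Longrightarrow> card (fp.U x) = q" and qd: "\<And>x. x \<in> fp.\<Gamma> \<Longrightarrow> card (A.stab x) = q * d"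
      and n: "card (carrier Gr) = card fp.\<Gamma> * (q * d)" and p: "CHAR('a) dvd q"
      and trich: "3 \<le> q \<and> card fp.\<Gamma> = q + 1 \<and> card \<Delta> = q * (q - 1) \<and> (d = q - 1 \<or> 2 * d = q - 1) \<or>
         q = 3 \<and> d = 2 \<and> card fp.\<Gamma> = 10 \<and> card \<Delta> = 12"
      by (rule fp.orbits_unipotents[OF ne]) (rule that)
    have orbit: "\<Gamma> \<in> orbit_set Gr P1 pact"
      using NR(1) unfolding Gam nonregular_orbits_def by blast
    define H where "H h = (\<lambda>g. P.conjg g h) ` G" for h
    have ex: "\<exists>E :: 'a set. \<exists>h\<in>carrier PGL2. finite E \<and> subfield E ring_of_type_algebra \<and>
        (\<lambda>\<gamma>. pact \<gamma> h) ` fp.\<Gamma> = P1_over \<iota> E \<and>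
        ((H h = PSL2_over E \<or> H h = PGL2_over E) \<and> card \<Delta> = card E * (card E - 1) \<or>
         CHAR('a) = 3 \<and> (\<exists>i :: 'a. i\<^sup>2 = - 1 \<and> H h = A5_bar i \<and> PGL2\<lparr>carrier := A5_bar i\<rparr> \<cong> alt_group 5) \<and>
         card E = 9 \<and> card \<Delta> = 12)"
    proof -
      \<comment> \<open>The second point, to be moved to 0. In the exceptional case it has to be the
        other fixed point of an involution \<open>t\<close> fixing x, so that the conjugate of
        \<open>t\<close> becomes a dilation.\<close>
      obtain y where y: "y \<in> fp.\<Gamma>" "x \<noteq> y"
        and y_t: "q = 3 \<and> d = 2 \<and> card fp.\<Gamma> = 10 \<Longrightarrow> \<exists>t. t \<in> A.stab x \<inter> A.stab y \<and> t \<noteq> \<one>\<^bsub>PGL2\<^esub>"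
      proof (cases "q = 3 \<and> d = 2 \<and> card fp.\<Gamma> = 10")
        case True
        have xP: "x \<in> P1" using x by (simp add: fp.Gamma_iff)
        have D: "card \<Delta> = 12" using trich True by auto
        have "\<not> A.stab x \<subseteq> fp.U x"
        proof
          assume "A.stab x \<subseteq> fp.U x"
          then have "card (A.stab x) \<le> card (fp.U x)" by (intro card_mono fp.finite_U)
          then show False using q[OF x] qd[OF x] True by simp
        qed
        then obtain t where t: "t \<in> A.stab x - fp.U x" by blast
        have t1: "t \<noteq> \<one>\<^bsub>PGL2\<^esub>" and tG: "t \<in> G" using t by (auto simp: fp.U_def stab_Gr_iff)
        have "t \<otimes>\<^bsub>Gr\<^esub> t = \<one>\<^bsub>Gr\<^esub>"
          by (rule fp.iso_alt_group_5_exceptional(2)[OF NR _ _ D _ _ x t]) (use True n q qd in auto)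
        then have F: "card (Fix P1 pact t) = 2" "Fix P1 pact t \<subseteq> fp.\<Gamma>"
          using fp.iso_alt_group_5_exceptional(3)[OF NR _ _ D, of t] True n q qd t1 tG by simp_all
        have xF: "x \<in> Fix P1 pact t" using t xP by (simp add: stab_Gr_iff Fix_def)
        obtain y where y: "y \<in> Fix P1 pact t" "y \<noteq> x"
        proof -
          have "Fix P1 pact t \<noteq> {x}" using F(1) by auto
          then show ?thesis using xF that by blast
        qed
        have "t \<in> A.stab y" using y(1) tG by (simp add: stab_Gr_iff Fix_def)
        then show ?thesis using y F(2) t t1 by (intro that[of y]) auto
      next
        case False
        have "fp.\<Gamma> \<noteq> {x}" using trich by auto
        then obtain y where "y \<in> fp.\<Gamma>" "y \<noteq> x" using x by blast
        then show ?thesis using False by (intro that[of y]) auto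
      qed
      obtain h where h: "h \<in> carrier PGL2" "normalized_pgl \<iota> (H h)" "pact x h = infpt" "pact y h = pt 0"
        unfolding H_def by (rule normalize[OF x y])
      interpret N: normalized_pgl \<iota> "H h" by (rule h(2))
      have NG: "N.fp.\<Gamma> = (\<lambda>x. pact x h) ` fp.\<Gamma>" and cH: "card (H h) = card G"
        using conj_fin_pgl(2,3)[OF loc h(1)] by (simp_all add: H_def)
      have "inj_on (\<lambda>x. pact x h) fp.\<Gamma>"
        by (rule inj_on_subset[OF P.act_inj[OF h(1)]]) (auto simp: fp.Gamma_iff)
      then have cN: "card N.fp.\<Gamma> = card fp.\<Gamma>" unfolding NG by (rule card_image)
      have neN: "N.fp.\<Gamma> \<noteq> {}" using N.inf_Gamma by blast
      \<comment> \<open>The numbers are derived anew for the conjugate group. Since |G| and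
        |\<Gamma>| are preserved, the same alternative must hold for it.\<close>
      obtain q' d' and \<Delta>' :: "('b^2) set set" where NR': "N.fp.\<Gamma> \<in> N.fp.NR" "N.fp.NR - {N.fp.\<Gamma>} = {\<Delta>'}"
        and q': "\<And>x. x \<in> N.fp.\<Gamma> \<Longrightarrow> card (N.fp.U x) = q'" and qd': "\<And>x. x \<in> N.fp.\<Gamma> \<Longrightarrow> card (N.A.stab x) = q' * d'"
        and n': "card (carrier N.Gr) = card N.fp.\<Gamma> * (q' * d')" and p': "CHAR('a) dvd q'"
        and trich': "3 \<le> q' \<and> card N.fp.\<Gamma> = q' + 1 \<and> card \<Delta>' = q' * (q' - 1) \<and> (d' = q' - 1 \<or> 2 * d' = q' - 1) \<or>
           q' = 3 \<and> d' = 2 \<and> card N.fp.\<Gamma> = 10 \<and> card \<Delta>' = 12"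
        by (rule N.fp.orbits_unipotents[OF neN]) (rule that)
      have "card fp.\<Gamma> * (q' * d') = card fp.\<Gamma> * (q * d)" using n n' cN cH by auto
      moreover have "card fp.\<Gamma> \<noteq> 0" using trich by auto
      ultimately have qdeq: "q' * d' = q * d" by simp
      show ?thesis
        using trich
      proof
        assume A: "3 \<le> q \<and> card fp.\<Gamma> = q + 1 \<and> card \<Delta> = q * (q - 1) \<and> (d = q - 1 \<or> 2 * d = q - 1)"
        have A': "3 \<le> q' \<and> card N.fp.\<Gamma> = q' + 1 \<and> (d' = q' - 1 \<or> 2 * d' = q' - 1)"
          using trich'
        proof
          assume B: "q' = 3 \<and> d' = 2 \<and> card N.fp.\<Gamma> = 10 \<and> card \<Delta>' = 12"
          \<comment> \<open>A length of 10 for \<Gamma> also fits q = 9 in the first alternative,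
            but then the stabilizer order is 72 or 36 instead of 6.\<close>
          then have "q = 9" using A cN by simp
          then show ?thesis using A B qdeq by auto
        qed simp
        then have "q' = q" using A cN by simp
        obtain E where E: "finite E" "subfield E ring_of_type_algebra" "N.fp.\<Gamma> = P1_over \<iota> E" "card E = q'"
          "H h = PSL2_over E \<or> H h = PGL2_over E"
          using N.linear_case[of q' d'] A' q'[OF N.inf_Gamma] qd'[OF N.inf_Gamma] by blast
        then show ?thesis using A h(1) \<open>q' = q\<close> unfolding NG by blast
      next
        assume B: "q = 3 \<and> d = 2 \<and> card fp.\<Gamma> = 10 \<and> card \<Delta> = 12"
        have B': "q' = 3 \<and> d' = 2 \<and> card N.fp.\<Gamma> = 10 \<and> card \<Delta>' = 12"
          using trich'
        proof
          assume A: "3 \<le> q' \<and> card N.fp.\<Gamma> = q' + 1 \<and> card \<Delta>' = q' * (q' - 1) \<and> (d' = q' - 1 \<or> 2 * d' = q' - 1)"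
          then have "q' = 9" using B cN by simp
          then show ?thesis using A B qdeq by auto
        qed simp
        obtain g where g: "g \<in> fp.U x" "g \<noteq> \<one>\<^bsub>Gr\<^esub>" "prime CHAR('a)" using x by (rule fp.Gamma_unipotent)
        have char: "CHAR('a) = 3"
        proof -
          have "CHAR('a) dvd 3" using p B by simp
          then show ?thesis using primes_dvd_imp_eq[OF g(3), of 3] by simp
        qed
        obtain t where t: "t \<in> A.stab x \<inter> A.stab y" "t \<noteq> \<one>\<^bsub>PGL2\<^esub>" using y_t B by blast
        have tc: "t \<in> carrier PGL2" "t \<in> G" using t(1) G_carrier by (auto simp: stab_Gr_iff)
        have xyP: "x \<in> P1" "y \<in> P1" using x y by (simp_all add: fp.Gamma_iff)
        have "P.conjg t h \<in> P.stab (pact x h)" "P.conjg t h \<in> P.stab (pact y h)"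
          using t(1) tc xyP h(1) by (auto simp: P.stab_act stab_Gr_iff P.stab_iff)
        moreover have "P.conjg t h \<in> H h" using tc(2) by (auto simp: H_def)
        ultimately have "P.conjg t h \<in> N.A.stab infpt \<inter> N.A.stab (pt 0)"
          unfolding h(3,4) by (simp add: N.stab_Gr_iff P.stab_iff)
        moreover have "P.conjg t h \<noteq> \<one>\<^bsub>PGL2\<^esub>" using t(2) tc h(1) by simp
        ultimately have ex_t: "\<exists>t. t \<in> N.A.stab infpt \<inter> N.A.stab (pt 0) \<and> t \<noteq> \<one>\<^bsub>PGL2\<^esub>" by blast
        have n60: "card (H h) = 60" using n' B' by simp
        obtain E i where E: "finite E" "subfield E ring_of_type_algebra" "N.fp.\<Gamma> = P1_over \<iota> E" "card E = 9"
          and i: "i\<^sup>2 = - 1" "H h = A5_bar i" "N.Gr \<cong> alt_group 5"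
          using N.exceptional_case[OF NR' n60 _ _ _ _ char ex_t] B' q' qd' by auto
        have "PGL2\<lparr>carrier := A5_bar i\<rparr> \<cong> alt_group 5" using i(3) unfolding i(2) .
        then show ?thesis using B h(1) E i(1,2) char unfolding NG by blast
      qed
    qed
    show ?thesis
    proof (intro disjI2 conjI exI[of _ \<Delta>])
      show "CHAR('a) dvd card G" by (rule dvd)
      show "\<Gamma> \<in> orbit_set Gr P1 pact" by (rule orbit)
      show "fp.NR - {\<Gamma>} = {\<Delta>}" unfolding Gam by (rule NR(2))
    qed (use ex in \<open>unfold Gam H_def P.conjg_def Let_def\<close>)
  qed
qed simp

end
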